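(* Let $k_0>0$, $p>1$, $r>0$, and let $g\in L^p(\mathbb{R}^3)$ with $\operatorname{supp}(g)\subset\mathcal{B}_r$. Suppose $u$ is the solution of $$\Delta u + k_0^2 u = -g$$ which satisfies the Sommerfeld radiation condition. Then the tempered distribution $\mathcal{F}_{1,2}u$ can be identified (i.e. it coincides as a distribution in $\mathcal{D}'(\mathbb{R}^3)$) with the locally integrable function $$\mathcal{F}_{1,2}u(k_1,k_2,r_3)=\sqrt{\frac{\pi}{2}}\,\frac{i}{\kappa}\Big(e^{i\kappa r_3}\,\mathcal{F}\big((1-H_{r_3})g\big)(k_1,k_2,\kappa)+e^{-i\kappa r_3}\,\mathcal{F}\big(H_{r_3}g\big)(k_1,k_2,-\kappa)\Big),$$ defined for almost every $(k_1,k_2,r_3)\in\mathbb{R}^3$ (namely for $k_1^2+k_2^2\neq k_0^2$).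
   Context: $\mathcal{B}_r\subset\mathbb{R}^3$ is the open ball of radius $r$ centered at $0$. The Sommerfeld radiation condition is $\lim_{s\to\infty}\max_{\|\mathbf r\|=s}\|\mathbf r\|\big(\frac{\partial u}{\partial \mathbf r}(\mathbf r)-ik_0u(\mathbf r)\big)=0$, where $\frac{\partial}{\partial\mathbf r}$ is the radial directional derivative. The Fourier transform is $\mathcal{F}g(\mathbf k)=(2\pi)^{-3/2}\int_{\mathbb{R}^3}g(\mathbf r)e^{-i\mathbf k\cdot\mathbf r}\,d\mathbf r$; for a compactly supported integrable function it extends analytically to $\mathbb{C}^3$, and this analytic continuation is used when its argument is complex. $\mathcal{F}_{1,2}$ denotes the partial Fourier transform with respect to the first two variables (with the same normalization $(2\pi)^{-1/2}$ per variable), extended to tempered distributions by duality: $\mathcal{F}_{1,2}v[\phi]=v[\mathcal{F}_{1,2}\phi]$ for Schwartz functions $\phi$. Further, $\kappa=\kappa(k_1,k_2)=\sqrt{k_0^2-k_1^2-k_2^2}$ if $k_1^2+k_2^2\le k_0^2$ and $\kappa=i\sqrt{k_1^2+k_2^2-k_0^2}$ if $k_1^2+k_2^2>k_0^2$. $H_{r_3}:\mathbb{R}^3\to\mathbb{R}$ is the Heaviside function in the third coordinate, $H_{r_3}(s_1,s_2,s_3)=0$ if $s_3<r_3$ and $=1$ otherwise. *)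

theory Defs
  imports "HOL-Analysis.Analysis"
begin

definition dpart :: "real^3 \<Rightarrow> (real^3 \<Rightarrow> complex) \<Rightarrow> real^3 \<Rightarrow> complex" where
  "dpart v f = (\<lambda>x. frechet_derivative f (at x) v)"

fun diter :: "(real^3) list \<Rightarrow> (real^3 \<Rightarrow> complex) \<Rightarrow> real^3 \<Rightarrow> complex" where
  "diter [] f = f"
| "diter (v # vs) f = dpart v (diter vs f)"

definition smooth3 :: "(real^3 \<Rightarrow> complex) \<Rightarrow> bool" where
  "smooth3 f \<longleftrightarrow> (\<forall>vs. set vs \<subseteq> Basis \<longrightarrow> (\<forall>x. diter vs f differentiable (at x)))"

definition test_fun3 :: "(real^3 \<Rightarrow> complex) \<Rightarrow> bool" where
  "test_fun3 f \<longleftrightarrow> smooth3 f \<and> bounded {x. f x \<noteq> 0}"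

definition laplacian3 :: "(real^3 \<Rightarrow> complex) \<Rightarrow> real^3 \<Rightarrow> complex" where
  "laplacian3 f x = (\<Sum>b\<in>Basis. diter [b, b] f x)"

definition loc_int3 :: "(real^3 \<Rightarrow> complex) \<Rightarrow> bool" where
  "loc_int3 u \<longleftrightarrow> (\<forall>K. compact K \<longrightarrow> set_integrable lborel K u)"

definition helmholtz_weak :: "real \<Rightarrow> (real^3 \<Rightarrow> complex) \<Rightarrow> (real^3 \<Rightarrow> complex) \<Rightarrow> bool" where
  "helmholtz_weak k0 g u \<longleftrightarrow> loc_int3 u \<and>
     (\<forall>\<phi>. test_fun3 \<phi> \<longrightarrow>
        (\<integral>x. u x * (laplacian3 \<phi> x + complex_of_real (k0\<^sup>2) * \<phi> x) \<partial>lborel)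
          = - (\<integral>x. g x * \<phi> x \<partial>lborel))"

definition sommerfeld :: "real \<Rightarrow> (real^3 \<Rightarrow> complex) \<Rightarrow> bool" where
  "sommerfeld k0 u \<longleftrightarrow>
     (\<exists>R. \<forall>x. norm x \<ge> R \<longrightarrow> u differentiable (at x)) \<and>
     (\<forall>\<epsilon>>0. \<exists>S. \<forall>x. norm x \<ge> S \<longrightarrow>
        norm x * cmod (frechet_derivative u (at x) (x /\<^sub>R norm x) - \<i> * complex_of_real k0 * u x) \<le> \<epsilon>)"

text \<open>Fourier transform on R^3, evaluated at a complex argument (a,b,c); for compactly
  supported integrable h this integral is the analytic continuation.\<close>
definition fourier3 :: "(real^3 \<Rightarrow> complex) \<Rightarrow> complex \<Rightarrow> complex \<Rightarrow> complex \<Rightarrow> complex" where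
  "fourier3 h a b c = complex_of_real ((2 * pi) powr (-3/2)) *
     (\<integral>x. h x * exp (- \<i> * (a * complex_of_real (x$1) + b * complex_of_real (x$2)
                                 + c * complex_of_real (x$3))) \<partial>lborel)"

definition fourier12 :: "(real^3 \<Rightarrow> complex) \<Rightarrow> real^3 \<Rightarrow> complex" where
  "fourier12 \<phi> x = complex_of_real ((2 * pi) powr (-1)) *
     (\<integral>k. \<phi> (vector [fst k, snd k, x$3]) *
            exp (- \<i> * complex_of_real (fst k * x$1 + snd k * x$2)) \<partial>(lborel :: (real \<times> real) measure))"

definition kappa :: "real \<Rightarrow> real \<Rightarrow> real \<Rightarrow> complex" where
  "kappa k0 k1 k2 = (if k1\<^sup>2 + k2\<^sup>2 \<le> k0\<^sup>2 then complex_of_real (sqrt (k0\<^sup>2 - k1\<^sup>2 - k2\<^sup>2))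
                     else \<i> * complex_of_real (sqrt (k1\<^sup>2 + k2\<^sup>2 - k0\<^sup>2)))"

definition heaviside3 :: "real \<Rightarrow> real^3 \<Rightarrow> real" where
  "heaviside3 r3 s = (if s$3 < r3 then 0 else 1)"

definition F12u :: "real \<Rightarrow> (real^3 \<Rightarrow> complex) \<Rightarrow> real^3 \<Rightarrow> complex" where
  "F12u k0 g k = (let k1 = k$1; k2 = k$2; r3 = k$3; \<kappa> = kappa k0 k1 k2 in
     complex_of_real (sqrt (pi / 2)) * (\<i> / \<kappa>) *
       (exp (\<i> * \<kappa> * complex_of_real r3) *
          fourier3 (\<lambda>s. complex_of_real (1 - heaviside3 r3 s) * g s) (of_real k1) (of_real k2) \<kappa>
        + exp (- \<i> * \<kappa> * complex_of_real r3) *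
          fourier3 (\<lambda>s. complex_of_real (heaviside3 r3 s) * g s) (of_real k1) (of_real k2) (- \<kappa>)))"

end

theory Submission
  imports Defs "HOL-Complex_Analysis.Complex_Analysis" "HOL-Probability.Probability" "HOL-Real_Asymp.Real_Asymp"
begin

text \<open>Write \<open>G(x) = exp (i k |x|) / (4 \<pi> |x|)\<close>. Testing the equation with a cut-off of \<open>G(x - y)\<close> shows that
  \<open>u * K\<^sub>e = g * G\<^sub>e\<close>, where \<open>G\<^sub>e\<close> is \<open>G\<close> switched off near the origin and \<open>K\<^sub>e = -(\<Delta> + k\<^sup>2) G\<^sub>e\<close> is
  an approximate identity. The radiation condition alone only gives \<open>u = o(log |x|)\<close>, which just fails to make
  the boundary term at infinity small; but that term, as a function of the radius, would have to be constant and
  at the same time a slowly varying multiple of \<open>exp (2 i k |x|)\<close>, so it vanishes once the radial cut-off is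
  chosen to average this oscillation out. In this way neither Rellich's lemma nor regularity of \<open>u\<close> is needed.
  Letting \<open>e\<close> tend to 0 gives \<open>\<integral> u \<psi> = \<integral> g (G * \<psi>)\<close> for \<open>\<psi> = F\<^sub>1\<^sub>2 \<phi>\<close>. Finally Weyl's formula for the
  partial Fourier transform of \<open>G\<close> is proved for \<open>exp (- a |x|) / |x|\<close> with \<open>a > 0\<close> by Gaussian subordination,
  extended to \<open>Re a > 0\<close> by analytic continuation, and carried over to \<open>a = - i k\<close> by dominated convergence.\<close>

text \<open>Write u = exp(ikr) v; the radiation condition says v' = o(1/r) along rays, and no more.
  In polar coordinates the boundary term for a radial cut-off h is, to leading order, the integral
  of r v (exp(2ikr) h')'. Integrating by parts once leaves r v', which is small, and v, which is
  not. A second integration by parts removes v as well, provided exp(2ikr) h' is itself the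
  derivative of a function with compact support; this dictates a correction term in the cut-off.
  Both integrations are packed into one vector field x f(x), a multiple of x because only the radial
  derivative of \<open>u\<close> is controlled. As \<open>u\<close> is merely differentiable far
  out, the divergence theorem for that field is derived from dilations under a bound on the radial
  derivative alone. The other obstacle is that Weyl's integral does not converge absolutely without
  absorption. The limit is therefore taken only after pairing with a compactly supported function of
  the two frequencies: on one side the transform of that function is integrable, on the other
  1/kappa is locally integrable in the plane, with a square root singularity on a circle.\<close>

no_notation fps_nth (infixl "$" 75)

section \<open>Radial integration and dilations\<close>

text \<open>Polar coordinates for radial functions without a surface measure: both sides give
  \<open>{..a}\<close> the volume of the ball of radius a, the right one because the density is the
  derivative of that volume, and these half lines generate the Borel sets.\<close>

lemma distr_lborel_norm:
  "distr (lborel :: 'a::euclidean_space measure) borel norm =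
   density lborel (\<lambda>r. ennreal (DIM('a) * unit_ball_vol DIM('a) * r ^ (DIM('a) - 1)) * indicator {0..} r)"
    (is "?L = ?R")
proof (rule measure_eqI_generator_eq[where E = "range (\<lambda>a. {..a::real})" and \<Omega> = UNIV and A = "\<lambda>i. {..real i}"])
  show "Int_stable (range (\<lambda>a. {..a::real}))"
    by (auto simp: Int_stable_def)
  show "range (\<lambda>a. {..a::real}) \<subseteq> Pow UNIV" by simp
  show "sets ?L = sigma_sets UNIV (range (\<lambda>a. {..a::real}))"
    by (simp add: borel_eq_atMost)
  show "sets ?R = sigma_sets UNIV (range (\<lambda>a. {..a::real}))"
    by (simp add: borel_eq_atMost)
  show "range (\<lambda>i. {..real i}) \<subseteq> range atMost" by auto
  show "(\<Union>i. {..real i}) = UNIV"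
    by (auto simp: real_arch_simple)
  have L: "emeasure ?L {..a} = (if a < 0 then 0 else ennreal (unit_ball_vol DIM('a) * a ^ DIM('a)))" for a
  proof -
    have "emeasure ?L {..a} = emeasure (lborel :: 'a measure) (cball 0 a)"
      by (subst emeasure_distr) (auto intro!: arg_cong2[where f = emeasure])
    also have "\<dots> = (if a < 0 then 0 else ennreal (unit_ball_vol DIM('a) * a ^ DIM('a)))"
      by (auto simp: emeasure_cball)
    finally show ?thesis .
  qed
  show "emeasure ?L {..real i} \<noteq> \<infinity>" for i by (simp add: L)
  fix X assume "X \<in> range (\<lambda>a. {..a::real})"
  then obtain a where X: "X = {..a}" by auto
  have "emeasure ?R {..a} = (\<integral>\<^sup>+r. ennreal (DIM('a) * unit_ball_vol DIM('a) * r ^ (DIM('a) - 1)) * indicator {0..a} r \<partial>lborel)"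
    by (subst emeasure_density) (auto intro!: nn_integral_cong split: split_indicator)
  also have "\<dots> = (if a < 0 then 0 else ennreal (unit_ball_vol DIM('a) * a ^ DIM('a)))"
  proof (cases "a < 0")
    case False
    have "(\<integral>\<^sup>+r. ennreal (DIM('a) * unit_ball_vol DIM('a) * r ^ (DIM('a) - 1)) * indicator {0..a} r \<partial>lborel)
        = ennreal (unit_ball_vol DIM('a) * a ^ DIM('a) - unit_ball_vol DIM('a) * 0 ^ DIM('a))"
      using False
      by (intro nn_integral_FTC_Icc) (auto intro!: derivative_eq_intros)
    then show ?thesis using False by simp
  qed auto
  finally show "emeasure ?L X = emeasure ?R X" by (simp add: L X)
qed

lemma nn_integral_radial:
  fixes F :: "real \<Rightarrow> ennreal"
  assumes [measurable]: "F \<in> borel_measurable borel"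
  shows "(\<integral>\<^sup>+x. F (norm x) \<partial>(lborel :: 'a::euclidean_space measure)) =
    (\<integral>\<^sup>+r. ennreal (DIM('a) * unit_ball_vol DIM('a) * r ^ (DIM('a) - 1)) * indicator {0..} r * F r \<partial>lborel)"
proof -
  have "(\<integral>\<^sup>+x. F (norm x) \<partial>(lborel :: 'a::euclidean_space measure)) = (\<integral>\<^sup>+r. F r \<partial>distr (lborel :: 'a measure) borel norm)"
    by (subst nn_integral_distr) auto
  then show ?thesis
    by (simp add: distr_lborel_norm nn_integral_density)
qed

lemma radial_integral:
  fixes F :: "real \<Rightarrow> complex"
  assumes [measurable]: "F \<in> borel_measurable borel"
  shows "(\<integral>x. F (norm x) \<partial>(lborel :: 'a::euclidean_space measure)) =
    (\<integral>r. (DIM('a) * unit_ball_vol DIM('a) * r ^ (DIM('a) - 1) * indicator {0..} r) *\<^sub>R F r \<partial>lborel)"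
proof -
  have "(\<integral>x. F (norm x) \<partial>(lborel :: 'a::euclidean_space measure)) = (\<integral>r. F r \<partial>distr (lborel :: 'a measure) borel norm)"
    by (subst integral_distr) auto
  also have "distr (lborel :: 'a measure) borel norm =
   density lborel (\<lambda>r. ennreal (DIM('a) * unit_ball_vol DIM('a) * r ^ (DIM('a) - 1) * indicator {0..} r))"
    unfolding distr_lborel_norm by (intro arg_cong2[where f = density]) (auto split: split_indicator)
  finally show ?thesis
    by (subst (asm) integral_density) (auto split: split_indicator)
qed

lemma integral_scaleR_lborel:
  fixes f :: "'a::euclidean_space \<Rightarrow> complex"
  assumes "c > 0" and [measurable]: "f \<in> borel_measurable borel"
  shows "(\<integral>x. f (c *\<^sub>R x) \<partial>lborel) = (\<integral>x. f x \<partial>lborel) /\<^sub>R (c ^ DIM('a))"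
proof -
  have "(\<integral>x. f x \<partial>lborel) = (\<integral>x. f x \<partial>density (distr lborel borel (\<lambda>x. 0 + c *\<^sub>R x)) (\<lambda>_. \<bar>c\<bar>^DIM('a)))"
    using lborel_affine[of c "0::'a"] assms by simp
  also have "\<dots> = (\<integral>x. (\<bar>c\<bar>^DIM('a)) *\<^sub>R f (c *\<^sub>R x) \<partial>lborel)"
    using assms by (subst integral_density) (auto simp: integral_distr)
  finally show ?thesis using assms by simp
qed

lemma integrable_continuous_bounded_support:
  fixes f :: "'a::euclidean_space \<Rightarrow> complex"
  assumes cont: "continuous_on UNIV f" and supp: "\<And>x. norm x > M \<Longrightarrow> f x = 0"
  shows "integrable lborel f"
proof -
  have [measurable]: "f \<in> borel_measurable borel"
    using cont by (rule borel_measurable_continuous_onI)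
  have "compact (f ` cball 0 M)" by (intro compact_continuous_image continuous_on_subset[OF cont]) auto
  then obtain K where "\<forall>y\<in>f ` cball 0 M. norm y \<le> K"
    using compact_imp_bounded bounded_iff by metis
  then have K: "\<And>x. x \<in> cball 0 M \<Longrightarrow> norm (f x) \<le> K" by simp
  show ?thesis
  proof (rule Bochner_Integration.integrable_bound)
    show "integrable lborel (\<lambda>x::'a. K * indicator (cball 0 M) x)"
      by (intro integrable_mult_right integrable_real_indicator) (use emeasure_lborel_cball_finite in auto)
    show "AE x in lborel. norm (f x) \<le> norm (K * indicator (cball 0 M) x)"
      using K supp by (fastforce split: split_indicator simp: not_le)
  qed auto
qed

text \<open>The divergence theorem for the field x f(x), whose divergence is \<open>f' x x\<close>
  plus the dimension times f. It follows by differentiating the scaling law of the integral of f(c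
  x) at c = 1. The derivative may be discontinuous; only a bound in the radial direction is
  required, which is exactly what a radiation condition can supply.\<close>

lemma dilation_integral:
  fixes f :: "'a::euclidean_space \<Rightarrow> complex"
  assumes diff: "\<And>x. (f has_derivative f' x) (at x)"
    and supp: "\<And>x. norm x > M \<Longrightarrow> f x = 0"
    and bd: "\<And>x. norm (f' x x) \<le> C"
  shows "integrable lborel (\<lambda>x. f' x x)" and "integrable lborel f"
    and "(\<integral>x. f' x x \<partial>lborel) = - of_nat DIM('a) * (\<integral>x. f x \<partial>lborel)"
proof -
  have cont: "continuous_on UNIV f"
    using diff by (intro has_derivative_continuous_on) (auto intro: has_derivative_at_withinI)
  have [measurable]: "f \<in> borel_measurable borel"
    using cont by (rule borel_measurable_continuous_onI)
  have C0: "C \<ge> 0" using bd[of 0] norm_ge_zero order_trans by blast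
  define c where "c n = 1 + inverse (real (Suc n))" for n
  have c: "c n > 1" for n by (simp add: c_def)
  define g where "g n x = real (Suc n) *\<^sub>R (f (c n *\<^sub>R x) - f x)" for n x
  have [measurable]: "g n \<in> borel_measurable borel" for n
    unfolding g_def by measurable
  have path: "((\<lambda>t. f (t *\<^sub>R x)) has_vector_derivative f' (t *\<^sub>R x) x) (at t)" for x t
  proof -
    have "((\<lambda>t. f (t *\<^sub>R x)) has_derivative (\<lambda>h. f' (t *\<^sub>R x) (h *\<^sub>R x))) (at t)"
      by (rule has_derivative_compose[OF _ diff]) (auto intro!: derivative_eq_intros)
    moreover have "linear (f' (t *\<^sub>R x))" using diff has_derivative_linear by blast
    ultimately show ?thesis
      by (simp add: has_vector_derivative_def linear_scale)
  qed
  have lim: "(\<lambda>n. g n x) \<longlonglongrightarrow> f' x x" for x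
  proof -
    have "((\<lambda>t. f (t *\<^sub>R x)) has_vector_derivative f' x x) (at 1)" using path[of x 1] by simp
    then have "((\<lambda>h. norm (f ((1 + h) *\<^sub>R x) - f x - h *\<^sub>R f' x x) / norm h) \<longlongrightarrow> 0) (at 0)"
      by (simp add: has_vector_derivative_def has_derivative_at algebra_simps)
    moreover have "filterlim (\<lambda>n. inverse (real (Suc n))) (at 0) sequentially"
      by (rule filterlim_atI[OF LIMSEQ_inverse_real_of_nat]) auto
    ultimately have "(\<lambda>n. norm (f ((1 + inverse (real (Suc n))) *\<^sub>R x) - f x - inverse (real (Suc n)) *\<^sub>R f' x x) / norm (inverse (real (Suc n)))) \<longlonglongrightarrow> 0"
      by (rule filterlim_compose)
    moreover have "norm (f ((1 + inverse (real (Suc n))) *\<^sub>R x) - f x - inverse (real (Suc n)) *\<^sub>R f' x x) / norm (inverse (real (Suc n)))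
      = norm (g n x - f' x x)" for n
    proof -
      have "g n x - f' x x = real (Suc n) *\<^sub>R (f ((1 + inverse (real (Suc n))) *\<^sub>R x) - f x - inverse (real (Suc n)) *\<^sub>R f' x x)"
        by (simp add: g_def c_def scaleR_diff_right)
      then show ?thesis by (simp add: divide_inverse)
    qed
    ultimately have "(\<lambda>n. norm (g n x - f' x x)) \<longlonglongrightarrow> 0" by simp
    then have "(\<lambda>n. g n x - f' x x) \<longlonglongrightarrow> 0" by (simp add: tendsto_norm_zero_iff)
    then show ?thesis by (simp add: LIM_zero_iff)
  qed
  \<comment> \<open>The dilations go outwards, so the difference quotients vanish off the same ball
    as f. Inside it the mean value inequality along the ray applies: the derivative of f(t x) in t
    is the radial derivative at t x divided by t, and t > 1.\<close>
  have gb: "norm (g n x) \<le> C * indicator (cball 0 M) x" for n x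
  proof (cases "norm x \<le> M")
    case False
    have "norm (c n *\<^sub>R x) \<ge> 1 * norm x"
      using mult_right_mono[of 1 "c n" "norm x"] c[of n] by simp
    then have "norm (c n *\<^sub>R x) > M" using False by linarith
    then show ?thesis using False supp by (simp add: g_def)
  next
    case True
    have "norm (f (c n *\<^sub>R x) - f (1 *\<^sub>R x)) \<le> C * c n - C * 1"
    proof (rule differentiable_bound_general[of 1 "c n" _ _ "\<lambda>t. f' (t *\<^sub>R x) x" "\<lambda>t. C"])
      show "continuous_on {1..c n} (\<lambda>t. f (t *\<^sub>R x))"
        by (intro continuous_intros continuous_on_compose2[OF cont]) auto
      fix t assume t: "1 < t" "t < c n"
      have lin: "linear (f' (t *\<^sub>R x))" using diff has_derivative_linear by blast
      have "f' (t *\<^sub>R x) x = f' (t *\<^sub>R x) (t *\<^sub>R x) /\<^sub>R t"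
        using t lin by (simp add: linear_scale)
      also have "norm \<dots> \<le> C / t" using bd[of "t *\<^sub>R x"] t by (simp add: divide_simps)
      also have "\<dots> \<le> C" using t C0 by (simp add: divide_simps mult_le_cancel_left1)
      finally show "norm (f' (t *\<^sub>R x) x) \<le> C" .
    qed (use c in \<open>auto intro!: continuous_intros derivative_eq_intros path\<close>)
    also have "C * c n - C * 1 = C * inverse (real (Suc n))" by (simp add: c_def algebra_simps)
    finally show ?thesis using True
      by (simp add: g_def indicator_def divide_simps mult.commute)
  qed
  have ind: "integrable lborel (\<lambda>x::'a. C * indicator (cball 0 M) x)"
    by (intro integrable_mult_right integrable_real_indicator) (use emeasure_lborel_cball_finite in auto)
  have [measurable]: "(\<lambda>x. f' x x) \<in> borel_measurable lborel"
    by (rule borel_measurable_LIMSEQ_metric[OF _ lim]) auto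
  show int: "integrable lborel (\<lambda>x. f' x x)" 
    by (rule integrable_dominated_convergence[where f = "\<lambda>x. f' x x" and s = g, OF _ _ ind]) (use gb lim in auto)
  have dc: "(\<lambda>n. \<integral>x. g n x \<partial>lborel) \<longlonglongrightarrow> (\<integral>x. f' x x \<partial>lborel)"
    by (rule integral_dominated_convergence[OF _ _ ind]) (use gb lim in auto)
  show fint: "integrable lborel f"
    by (rule integrable_continuous_bounded_support[OF cont supp])
  have "(\<integral>x. g n x \<partial>lborel) = (real (Suc n) * (inverse (c n ^ DIM('a)) - 1)) *\<^sub>R (\<integral>x. f x \<partial>lborel)" for n
  proof -
    have fi: "integrable lborel (\<lambda>x. f (c n *\<^sub>R x))"
    proof (rule Bochner_Integration.integrable_bound)
      show "integrable lborel (\<lambda>x. norm (f x) + C * indicator (cball 0 M) x)" using fint ind by auto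
      show "AE x in lborel. norm (f (c n *\<^sub>R x)) \<le> norm (norm (f x) + C * indicator (cball 0 M) x)"
      proof (intro always_eventually allI)
        fix x
        have "f (c n *\<^sub>R x) = f x + g n x /\<^sub>R real (Suc n)" by (simp add: g_def)
        then have "norm (f (c n *\<^sub>R x)) \<le> norm (f x) + norm (g n x /\<^sub>R real (Suc n))"
          by (metis norm_triangle_ineq)
        also have "norm (g n x /\<^sub>R real (Suc n)) \<le> norm (g n x)"
          by (simp add: divide_simps mult_le_cancel_left1)
        finally show "norm (f (c n *\<^sub>R x)) \<le> norm (norm (f x) + C * indicator (cball 0 M) x)"
          using gb[of n x] C0 by (auto split: split_indicator_asm split: split_indicator)
      qed
    qed auto
    show ?thesis unfolding g_def using fi fint c[of n]
      by (subst integral_scaleR_right, subst Bochner_Integration.integral_diff)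
         (auto simp: integral_scaleR_lborel algebra_simps)
  qed
  moreover have "(\<lambda>n. real (Suc n) * (inverse (c n ^ DIM('a)) - 1)) \<longlonglongrightarrow> - real DIM('a)"
  proof -
    have "((\<lambda>t. inverse (t ^ DIM('a))) has_real_derivative - real DIM('a)) (at 1)"
      by (auto intro!: derivative_eq_intros)
    then have "((\<lambda>h. (inverse ((1 + h) ^ DIM('a)) - 1) / h) \<longlongrightarrow> - real DIM('a)) (at 0)"
      by (simp add: DERIV_def)
    moreover have "filterlim (\<lambda>n. inverse (real (Suc n))) (at 0) sequentially"
      by (rule filterlim_atI[OF LIMSEQ_inverse_real_of_nat]) auto
    ultimately have "(\<lambda>n. (inverse ((1 + inverse (real (Suc n))) ^ DIM('a)) - 1) / inverse (real (Suc n))) \<longlonglongrightarrow> - real DIM('a)"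
      by (rule filterlim_compose)
    then show ?thesis by (simp add: c_def divide_inverse mult.commute)
  qed
  ultimately have "(\<lambda>n. \<integral>x. g n x \<partial>lborel) \<longlonglongrightarrow> (- real DIM('a)) *\<^sub>R (\<integral>x. f x \<partial>lborel)"
    by (simp only:) (intro tendsto_intros)
  with dc have "(\<integral>x. f' x x \<partial>lborel) = (- real DIM('a)) *\<^sub>R (\<integral>x. f x \<partial>lborel)"
    using LIMSEQ_unique by blast
  then show "(\<integral>x. f' x x \<partial>lborel) = - of_nat DIM('a) * (\<integral>x. f x \<partial>lborel)"
    by (simp add: scaleR_conv_of_real)
qed

section \<open>Smooth functions\<close>

text \<open>n-fold differentiability at the points of S, with no continuity demanded of the last
  derivative. Asserted for all n it is smoothness, and the recursion on the derivative makes closure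
  properties one-line inductions.\<close>

primrec Cn :: "nat \<Rightarrow> real set \<Rightarrow> (real \<Rightarrow> complex) \<Rightarrow> bool" where
  "Cn 0 S f \<longleftrightarrow> True"
| "Cn (Suc n) S f \<longleftrightarrow> (\<forall>t\<in>S. f differentiable (at t)) \<and> Cn n S (\<lambda>t. vector_derivative f (at t))"

lemma Cn_cong:
  assumes "open S" "\<And>t. t \<in> S \<Longrightarrow> f t = g t"
  shows "Cn n S f \<longleftrightarrow> Cn n S g"
  using assms(2)
proof (induction n arbitrary: f g)
  case (Suc n)
  have *: "(f has_vector_derivative D) (at t) \<longleftrightarrow> (g has_vector_derivative D) (at t)" if "t \<in> S" for t D
    using that assms(1) Suc.prems
    by (auto intro: has_vector_derivative_transform_within_open[of _ _ t S])
  have "f differentiable (at t) \<longleftrightarrow> g differentiable (at t)" if "t \<in> S" for t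
    using *[OF that] by (metis vector_derivative_works differentiableI_vector)
  moreover have "vector_derivative f (at t) = vector_derivative g (at t)" if "t \<in> S" for t
    using *[OF that] by (simp add: vector_derivative_def)
  ultimately show ?case
    using Suc.IH[of "\<lambda>t. vector_derivative f (at t)" "\<lambda>t. vector_derivative g (at t)"] by auto
qed simp

lemma Cn_SucI:
  assumes "open S" "\<And>t. t \<in> S \<Longrightarrow> (f has_vector_derivative f' t) (at t)" "Cn n S f'"
  shows "Cn (Suc n) S f"
  using assms Cn_cong[of S "\<lambda>t. vector_derivative f (at t)" f' n] 
  by (auto intro: differentiableI_vector vector_derivative_at)

lemma Cn_SucD:
  assumes "Cn (Suc n) S f" "t \<in> S"
  shows "(f has_vector_derivative vector_derivative f (at t)) (at t)"
  using assms by (auto simp: vector_derivative_works)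

lemma Cn_SucD': "Cn (Suc n) S f \<Longrightarrow> Cn n S f"
  by (induction n arbitrary: f) auto

lemma Cn_const: "open S \<Longrightarrow> Cn n S (\<lambda>t. c)"
proof (induction n arbitrary: c)
  case (Suc n)
  show ?case by (rule Cn_SucI[where f' = "\<lambda>_. 0"]) (use Suc in auto)
qed simp

lemma Cn_add:
  assumes "open S" "Cn n S f" "Cn n S g"
  shows "Cn n S (\<lambda>t. f t + g t)"
  using assms(2,3)
proof (induction n arbitrary: f g)
  case (Suc n)
  show ?case
    by (rule Cn_SucI[where f' = "\<lambda>t. vector_derivative f (at t) + vector_derivative g (at t)"])
       (use Suc assms(1) Cn_SucD in \<open>auto intro!: derivative_intros\<close>)
qed simp

lemma Cn_mult:
  assumes "open S" "Cn n S f" "Cn n S g"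
  shows "Cn n S (\<lambda>t. f t * g t)"
  using assms(2,3)
proof (induction n arbitrary: f g)
  case (Suc n)
  show ?case
  proof (rule Cn_SucI[where f' = "\<lambda>t. f t * vector_derivative g (at t) + vector_derivative f (at t) * g t"])
    show "Cn n S (\<lambda>t. f t * vector_derivative g (at t) + vector_derivative f (at t) * g t)"
      using Suc.prems Cn_SucD' by (intro Cn_add Suc.IH assms(1)) auto
    show "((\<lambda>t. f t * g t) has_vector_derivative f t * vector_derivative g (at t) + vector_derivative f (at t) * g t) (at t)" 
      if "t \<in> S" for t
      by (rule has_vector_derivative_mult[OF Cn_SucD[OF Suc.prems(1) that] Cn_SucD[OF Suc.prems(2) that]])
  qed fact
qed simp

lemma Cn_affine:
  assumes "open S" "Cn n UNIV f"
  shows "Cn n S (\<lambda>t. f (a * t + b))"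
  using assms(2)
proof (induction n arbitrary: f)
  case (Suc n)
  show ?case
  proof (rule Cn_SucI[where f' = "\<lambda>t. of_real a * vector_derivative f (at (a * t + b))"])
    fix t
    have "((\<lambda>t. a * t + b) has_vector_derivative a) (at t)"
      by (auto intro!: derivative_eq_intros simp: has_real_derivative_iff_has_vector_derivative[symmetric])
    from vector_diff_chain_at[OF this Cn_SucD[OF Suc.prems]]
    show "((\<lambda>t. f (a * t + b)) has_vector_derivative of_real a * vector_derivative f (at (a * t + b))) (at t)"
      by (simp add: o_def scaleR_conv_of_real)
    show "Cn n S (\<lambda>t. of_real a * vector_derivative f (at (a * t + b)))"
      using Suc assms(1) by (intro Cn_mult Cn_const) auto
  qed fact
qed simp

lemma Cn_exp:
  assumes "open S"
  shows "Cn n S (\<lambda>t. exp (c * of_real t))"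
proof (induction n)
  case (Suc n)
  show ?case
  proof (rule Cn_SucI[where f' = "\<lambda>t. c * exp (c * of_real t)"])
    fix t
    have "((\<lambda>z. exp (c * z)) has_field_derivative c * exp (c * of_real t)) (at (of_real t))"
      by (auto intro!: derivative_eq_intros)
    from has_vector_derivative_real_field[OF this]
    show "((\<lambda>t. exp (c * of_real t)) has_vector_derivative c * exp (c * of_real t)) (at t)" .
    show "Cn n S (\<lambda>t. c * exp (c * of_real t))"
      using Suc assms by (intro Cn_mult Cn_const) auto
  qed fact
qed simp

lemma Cn_inverse:
  assumes "open S" "0 \<notin> S"
  shows "Cn n S (\<lambda>t. inverse (of_real t))"
proof (induction n)
  case (Suc n)
  show ?case
  proof (rule Cn_SucI[where f' = "\<lambda>t. - 1 * (inverse (of_real t) * inverse (of_real t))"])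
    show "Cn n S (\<lambda>t. - 1 * (inverse (complex_of_real t) * inverse (of_real t)))"
      using Suc assms by (intro Cn_mult Cn_const) auto
    fix t assume "t \<in> S"
    then have "t \<noteq> 0" using assms by auto
    then have "((\<lambda>z. inverse z) has_field_derivative - 1 * (inverse (of_real t) * inverse (of_real t))) (at (complex_of_real t))"
      by (auto intro!: derivative_eq_intros)
    from has_vector_derivative_real_field[OF this]
    show "((\<lambda>t. inverse (complex_of_real t)) has_vector_derivative - 1 * (inverse (of_real t) * inverse (of_real t))) (at t)" .
  qed fact
qed simp

section \<open>A smooth step on the real line\<close>

lemma power_div_fact_le_exp:
  fixes x :: real
  assumes "x \<ge> 0"
  shows "x ^ n / fact n \<le> exp x"
proof -
  have "sum (\<lambda>k. x ^ k /\<^sub>R fact k) {n} \<le> (\<Sum>k. x ^ k /\<^sub>R fact k)"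
    by (rule sum_le_suminf) (use assms summable_exp_generic[of x] in auto)
  then show ?thesis by (simp add: exp_def divide_inverse mult.commute)
qed

text \<open>The powers of t in the denominator close the family under differentiation: the
  derivative combines the members j + 1 and j + 2. One induction over all j then gives smoothness,
  including at 0.\<close>

definition flat :: "nat \<Rightarrow> real \<Rightarrow> real" where
  "flat j t = (if t \<le> 0 then 0 else exp (- (1 / t)) / t ^ j)"

lemma has_derivative_flat: "(flat j has_real_derivative flat (j + 2) t - real j * flat (j + 1) t) (at t)"
proof (cases t "0::real" rule: linorder_cases)
  case less
  have "((\<lambda>_. 0) has_real_derivative 0) (at t)" by simp
  then have "(flat j has_real_derivative 0) (at t)"
    by (rule has_field_derivative_transform_within_open[of _ _ _ "{..<0}"]) (use less in \<open>auto simp: flat_def\<close>)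
  then show ?thesis using less by (simp add: flat_def)
next
  case greater
  have "((\<lambda>t. exp (- (1 / t)) / t ^ j) has_real_derivative
     (exp (- (1/t)) * (1 / t^2) * t ^ j - exp (- (1 / t)) * (real j * t ^ (j - 1))) / (t ^ j * t ^ j)) (at t)"
    using greater by (auto intro!: derivative_eq_intros simp: power2_eq_square)
  also have "(exp (- (1/t)) * (1 / t^2) * t ^ j - exp (- (1 / t)) * (real j * t ^ (j - 1))) / (t ^ j * t ^ j)
     = flat (j + 2) t - real j * flat (j + 1) t"
  proof -
    define e where "e = exp (- (1/t))"
    show ?thesis
    proof (cases j)
      case (Suc m)
      define p where "p = t ^ m"
      have "p \<noteq> 0" "t \<noteq> 0" using greater by (auto simp: p_def)
      then show ?thesis
        using greater unfolding flat_def Suc by (simp add: e_def[symmetric] p_def[symmetric] power2_eq_square divide_simps) (simp add: algebra_simps)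
    qed (use greater in \<open>simp add: flat_def power2_eq_square\<close>)
  qed
  finally show ?thesis
    by (rule has_field_derivative_transform_within_open[of _ _ _ "{0<..}"]) (use greater in \<open>auto simp: flat_def\<close>)
next
  case equal
  \<comment> \<open>One term of the exponential series, exp(1/h) \<ge> (1/h)^(j+2) / (j+2)!, leaves
    a spare factor h after division by h^(j+1). This is differentiability at 0 with derivative
    0.\<close>
  have b: "\<bar>flat j h / h\<bar> \<le> fact (j + 2) * \<bar>h\<bar>" for h
  proof (cases "h \<le> 0")
    case False
    then have h: "h > 0" by simp
    have "(1 / h) ^ (j + 2) / fact (j + 2) \<le> exp (1 / h)"
      using h by (intro power_div_fact_le_exp) auto
    then have "exp (- (1/h)) \<le> fact (j+2) * h ^ (j + 2)"
      using h by (simp add: exp_minus field_simps del: fact_Suc)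
    then show ?thesis using h by (simp add: flat_def field_simps del: fact_Suc)
  qed (auto simp: flat_def mult_nonneg_nonpos simp del: fact_Suc)
  have "((\<lambda>h. fact (j + 2) * \<bar>h\<bar>) \<longlongrightarrow> fact (j + 2) * \<bar>0\<bar>) (at (0::real))"
    by (intro tendsto_intros)
  then have lim: "((\<lambda>h. fact (j + 2) * \<bar>h\<bar>) \<longlongrightarrow> 0) (at (0::real))"
    by (simp only: abs_zero mult_zero_right)
  have "((\<lambda>h. flat j h / h) \<longlongrightarrow> 0) (at 0)"
    by (rule Lim_null_comparison[OF _ lim]) (intro always_eventually allI, use b in \<open>simp only: real_norm_def\<close>)
  then show ?thesis using equal by (simp add: DERIV_def flat_def)
qed

lemma Cn_flat: "Cn n UNIV (\<lambda>t. complex_of_real (flat j t))"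
proof (induction n arbitrary: j)
  case (Suc n)
  show ?case
  proof (rule Cn_SucI[where f' = "\<lambda>t. of_real (flat (j + 2) t) + (- of_nat j) * of_real (flat (j + 1) t)"])
    fix t 
    from has_vector_derivative_of_real[OF has_derivative_flat]
    show "((\<lambda>t. complex_of_real (flat j t)) has_vector_derivative of_real (flat (j + 2) t) + (- of_nat j) * of_real (flat (j + 1) t)) (at t)"
      by simp
    show "Cn n UNIV (\<lambda>t. complex_of_real (flat (j + 2) t) + (- of_nat j) * of_real (flat (j + 1) t))"
      by (intro Cn_add Cn_mult Cn_const Suc) auto
  qed simp
qed simp

text \<open>The product of \<open>flat 0 t\<close> and \<open>flat 0 (1 - t)\<close> is a bump
  supported in the unit interval. Its primitive B is constant on either side, and 1 - B / B(1) is
  the step.\<close>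

lemma smooth_step:
  obtains \<theta> :: "real \<Rightarrow> complex" where "\<And>n. Cn n UNIV \<theta>" "\<And>t. t \<le> 0 \<Longrightarrow> \<theta> t = 1" "\<And>t. t \<ge> 1 \<Longrightarrow> \<theta> t = 0"
proof -
  define b where "b t = flat 0 t * flat 0 (1 - t)" for t
  define B where "B t = (LBINT y=0..ereal t. b y)" for t
  have contf: "continuous_on A (flat 0)" for A
    by (rule DERIV_continuous_on, rule has_field_derivative_at_within, rule has_derivative_flat)
  have cont: "continuous_on A b" for A
    unfolding b_def by (intro continuous_intros continuous_on_compose2[OF contf[of UNIV]]) auto
  have Bd: "(B has_real_derivative b t) (at t)" for t
  proof -
    have "((\<lambda>u. LBINT y=0..u. b y) has_vector_derivative b t) (at t within {-\<bar>t\<bar>-1..\<bar>t\<bar>+1})"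
      using interval_integral_FTC2[of "-\<bar>t\<bar>-1" 0 "\<bar>t\<bar>+1" b t] cont by (simp add: zero_ereal_def)
    then show ?thesis
      by (subst (asm) at_within_interior) (auto simp: has_real_derivative_iff_has_vector_derivative B_def[abs_def])
  qed
  have B0: "B 0 = 0" by (simp add: B_def zero_ereal_def)
  have "B 0 < B 1"
  proof (rule DERIV_pos_imp_increasing_open[where a = 0 and b = 1 and f = B])
    fix x :: real assume "0 < x" "x < 1"
    then have "b x > 0" by (simp add: b_def flat_def)
    then show "\<exists>y. (B has_real_derivative y) (at x) \<and> 0 < y" using Bd[of x] by blast
  next
    show "continuous_on {0..1} B"
      by (rule DERIV_continuous_on, rule has_field_derivative_at_within, rule Bd)
  qed simp
  then have B1: "B 1 > 0" using B0 by simp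
  have b0: "b x = 0" if "x \<le> 0 \<or> x \<ge> 1" for x using that by (auto simp: b_def flat_def)
  have "\<exists>c. \<forall>x\<in>{..0}. B x = c"
  proof (rule has_field_derivative_zero_constant)
    show "(B has_real_derivative 0) (at x within {..0})" if "x \<in> {..0}" for x
      using has_field_derivative_at_within[OF Bd[of x]] b0[of x] that by simp
  qed simp
  then have neg: "B t = 0" if "t \<le> 0" for t using B0 that by force
  have "\<exists>c. \<forall>x\<in>{1..}. B x = c"
  proof (rule has_field_derivative_zero_constant)
    show "(B has_real_derivative 0) (at x within {1..})" if "x \<in> {1..}" for x
      using has_field_derivative_at_within[OF Bd[of x]] b0[of x] that by simp
  qed simp
  then have pos: "B t = B 1" if "t \<ge> 1" for t using that by force
  define \<theta> where "\<theta> t = 1 + (- of_real (1 / B 1)) * complex_of_real (B t)" for t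
  show thesis
  proof (rule that[of \<theta>])
    show "\<And>t. t \<le> 0 \<Longrightarrow> \<theta> t = 1" using neg by (simp add: \<theta>_def)
    show "\<theta> t = 0" if "t \<ge> 1" for t unfolding \<theta>_def pos[OF that] using B1 by simp
    have cb: "Cn n UNIV (\<lambda>t. complex_of_real (b t))" for n
    proof -
      have "Cn n UNIV (\<lambda>t. complex_of_real (flat 0 t) * of_real (flat 0 ((-1) * t + 1)))"
        by (intro Cn_mult Cn_affine Cn_flat) auto
      then show ?thesis by (simp add: b_def)
    qed
    have "Cn n UNIV (\<lambda>t. complex_of_real (B t))" for n
    proof (cases n)
      case (Suc m)
      show ?thesis unfolding Suc
        by (rule Cn_SucI[where f' = "\<lambda>t. complex_of_real (b t)"])
           (use cb Bd in \<open>auto intro!: has_vector_derivative_of_real\<close>)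
    qed simp
    then show "\<And>n. Cn n UNIV \<theta>" unfolding \<theta>_def by (intro Cn_add Cn_mult Cn_const) auto
  qed
qed


section \<open>Differentiability of order n in space, radial functions and their Laplacian\<close>

primrec Dn :: "nat \<Rightarrow> (real^3 \<Rightarrow> complex) \<Rightarrow> bool" where
  "Dn 0 f \<longleftrightarrow> True"
| "Dn (Suc n) f \<longleftrightarrow> (\<forall>x. f differentiable (at x)) \<and> (\<forall>b\<in>Basis. Dn n (dpart b f))"

lemma dpart_eq: "(f has_derivative f') (at x) \<Longrightarrow> dpart b f x = f' b"
  using frechet_derivative_at by (metis dpart_def)

lemma has_derivative_dpart: "f differentiable (at x) \<Longrightarrow> (f has_derivative (\<lambda>h. dpart h f x)) (at x)"
  unfolding dpart_def using frechet_derivative_works by (metis (lifting) ext)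

lemma Dn_SucI:
  assumes "\<And>x. (f has_derivative f' x) (at x)" "\<And>b. b \<in> Basis \<Longrightarrow> Dn n (\<lambda>x. f' x b)"
  shows "Dn (Suc n) f"
proof -
  have "dpart b f = (\<lambda>x. f' x b)" for b
    using assms(1) dpart_eq by blast
  then show ?thesis using assms by (auto intro: differentiableI)
qed

lemma Dn_SucD: "Dn (Suc n) f \<Longrightarrow> (f has_derivative (\<lambda>h. dpart h f x)) (at x)"
  by (simp add: has_derivative_dpart)

lemma Dn_SucD': "Dn (Suc n) f \<Longrightarrow> Dn n f"
  by (induction n arbitrary: f) auto

text \<open>\<open>diter\<close> applies the head of the list last, whereas \<open>Dn\<close>
  differentiates the function itself first. Peeling the list from its end reconciles the two
  recursions.\<close>

lemma diter_snoc: "diter (vs @ [v]) f = diter vs (dpart v f)"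
  by (induction vs) auto

lemma smooth3_iff_Dn: "smooth3 f \<longleftrightarrow> (\<forall>n. Dn n f)"
proof
  assume "smooth3 f"
  moreover have "\<forall>vs. set vs \<subseteq> Basis \<longrightarrow> (\<forall>x. diter vs f differentiable (at x)) \<Longrightarrow> Dn n f" for n
  proof (induction n arbitrary: f)
    case (Suc n)
    have "Dn n (dpart b f)" if "b \<in> Basis" for b
      using Suc.prems that by (intro Suc.IH) (auto simp: diter_snoc[symmetric])
    moreover have "f differentiable (at x)" for x
      using Suc.prems[rule_format, of "[]"] by simp
    ultimately show ?case by simp
  qed simp
  ultimately show "\<forall>n. Dn n f" unfolding smooth3_def by blast
next
  assume *: "\<forall>n. Dn n f"
  have "Dn (Suc (length vs)) f \<Longrightarrow> set vs \<subseteq> Basis \<Longrightarrow> diter vs f differentiable (at x)" for vs x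
  proof (induction vs arbitrary: f rule: rev_induct)
    case (snoc v vs)
    then show ?case by (simp add: diter_snoc)
  qed simp
  with * show "smooth3 f" unfolding smooth3_def by blast
qed

lemma smooth3_dpart: "smooth3 f \<Longrightarrow> b \<in> Basis \<Longrightarrow> smooth3 (dpart b f)"
  unfolding smooth3_iff_Dn using Dn.simps(2) by blast

lemma smooth3_has_derivative: "smooth3 f \<Longrightarrow> (f has_derivative (\<lambda>h. dpart h f x)) (at x)"
  unfolding smooth3_iff_Dn using Dn_SucD by blast

lemma Dn_const: "Dn n (\<lambda>x. c)"
proof (induction n arbitrary: c)
  case (Suc n)
  show ?case by (rule Dn_SucI[where f' = "\<lambda>_ _. 0"]) (use Suc in auto)
qed simp

lemma Dn_add: "Dn n f \<Longrightarrow> Dn n g \<Longrightarrow> Dn n (\<lambda>x. f x + g x)"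
proof (induction n arbitrary: f g)
  case (Suc n)
  show ?case
    by (rule Dn_SucI[where f' = "\<lambda>x h. dpart h f x + dpart h g x"])
       (use Suc in \<open>auto intro!: has_derivative_add Dn_SucD simp del: Dn.simps, auto\<close>)
qed simp

lemma Dn_mult: "Dn n f \<Longrightarrow> Dn n g \<Longrightarrow> Dn n (\<lambda>x. f x * g x)"
proof (induction n arbitrary: f g)
  case (Suc n)
  show ?case
  proof (rule Dn_SucI[where f' = "\<lambda>x h. f x * dpart h g x + dpart h f x * g x"])
    fix b :: "real^3" assume "b \<in> Basis"
    then show "Dn n (\<lambda>x. f x * dpart b g x + dpart b f x * g x)"
      using Suc.prems Dn_SucD' by (intro Dn_add Suc.IH) auto
  next
    show "((\<lambda>x. f x * g x) has_derivative (\<lambda>h. f x * dpart h g x + dpart h f x * g x)) (at x)" for x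
      by (rule has_derivative_mult[OF Dn_SucD[OF Suc.prems(1)] Dn_SucD[OF Suc.prems(2)]])
  qed
qed simp

lemma Dn_inner: "Dn n (\<lambda>x. of_real ((x - y) \<bullet> b))"
proof (cases n)
  case (Suc m)
  show ?thesis unfolding Suc
    by (rule Dn_SucI[where f' = "\<lambda>x h. of_real (h \<bullet> b)"]) (auto intro!: derivative_eq_intros Dn_const)
qed simp

text \<open>Constancy of P near 0 removes the singularity of the norm at y, where the formula reads
  0 because x - y = 0. The derivative is deliberately a linear function of x times the radial
  function P'(t)/t, so that the same rule applies again to the radial factor.\<close>

lemma has_derivative_radial:
  fixes P :: "real \<Rightarrow> complex" and y :: "real^3"
  assumes P': "\<And>t. t > 0 \<Longrightarrow> (P has_vector_derivative P' t) (at t)"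
    and const: "\<And>t. 0 \<le> t \<Longrightarrow> t \<le> \<delta> \<Longrightarrow> P t = c" and "\<delta> > 0" "P' 0 = 0"
  shows "((\<lambda>x. P (norm (x - y))) has_derivative (\<lambda>h. of_real ((x - y) \<bullet> h) * (P' (norm (x - y)) / of_real (norm (x - y))))) (at x)"
proof (cases "x = y")
  case True
  have "((\<lambda>x. c) has_derivative (\<lambda>h. 0)) (at x)" by simp
  then have "((\<lambda>x. P (norm (x - y))) has_derivative (\<lambda>h. 0)) (at x)"
    by (rule has_derivative_transform_within_open[of _ _ _ UNIV "ball y \<delta>"])
       (use True assms in \<open>auto simp: dist_norm norm_minus_commute\<close>)
  then show ?thesis using True by simp
next
  case False
  have "((\<lambda>x. norm (x - y)) has_derivative (\<lambda>h. sgn (x - y) \<bullet> h)) (at x)"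
    unfolding inner_commute[of "sgn (x - y)"]
    by (rule has_derivative_compose[where g = norm and f = "\<lambda>x. x - y" and f' = "\<lambda>h. h"])
       (use False in \<open>auto intro!: derivative_eq_intros has_derivative_norm\<close>)
  moreover have "(P has_derivative (\<lambda>h. h *\<^sub>R P' (norm (x - y)))) (at (norm (x - y)))"
    using P'[of "norm (x - y)"] False by (simp add: has_vector_derivative_def)
  ultimately have "((\<lambda>x. P (norm (x - y))) has_derivative (\<lambda>h. (sgn (x - y) \<bullet> h) *\<^sub>R P' (norm (x - y)))) (at x)"
    by (rule has_derivative_compose)
  also have "(\<lambda>h. (sgn (x - y) \<bullet> h) *\<^sub>R P' (norm (x - y))) = (\<lambda>h. of_real ((x - y) \<bullet> h) * (P' (norm (x - y)) / of_real (norm (x - y))))"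
    by (auto simp: sgn_div_norm scaleR_conv_of_real[where 'a = complex] divide_inverse)
  finally show ?thesis .
qed

text \<open>Induction on n through P'(t)/t: it is as smooth for t > 0 as the derivative of P, and it
  vanishes near 0, so it satisfies the same hypotheses with the constant 0.\<close>

lemma Dn_radial:
  fixes P :: "real \<Rightarrow> complex" and y :: "real^3"
  assumes "Cn n {0<..} P" "\<And>t. 0 \<le> t \<Longrightarrow> t \<le> \<delta> \<Longrightarrow> P t = c" "\<delta> > 0"
  shows "Dn n (\<lambda>x. P (norm (x - y)))"
  using assms
proof (induction n arbitrary: P \<delta> c)
  case (Suc n)
  define P' where "P' t = (if t > 0 then vector_derivative P (at t) else 0)" for t
  have P': "(P has_vector_derivative P' t) (at t)" if "t > 0" for t
    using Cn_SucD[OF Suc.prems(1)] that by (simp add: P'_def)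
  have P'0: "P' t = 0" if "t < \<delta>" for t
  proof (cases "t > 0")
    case True
    have "((\<lambda>_. c) has_vector_derivative 0) (at t)" by simp
    then have "(P has_vector_derivative 0) (at t)"
      by (rule has_vector_derivative_transform_within_open[of _ _ _ "{0<..<\<delta>}"]) (use True that Suc.prems in auto)
    then show ?thesis using P'[OF True] vector_derivative_unique_at by blast
  qed (simp add: P'_def)
  show ?case
  proof (rule Dn_SucI)
    show "((\<lambda>x. P (norm (x - y))) has_derivative (\<lambda>h. of_real ((x - y) \<bullet> h) * (P' (norm (x - y)) / of_real (norm (x - y))))) (at x)" for x
      by (rule has_derivative_radial[OF P' Suc.prems(2,3)]) (auto simp: P'_def)
    have "Cn n {0<..} (\<lambda>t. vector_derivative P (at t) * inverse (of_real t))"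
      using Suc.prems by (intro Cn_mult Cn_inverse) auto
    also have "?this \<longleftrightarrow> Cn n {0<..} (\<lambda>t. P' t / of_real t)"
      by (intro Cn_cong) (auto simp: P'_def divide_inverse)
    \<comment> \<open>\<open>P'\<close> is known to vanish for t < \<delta> only, while the
      hypothesis asks for a closed interval; hence half the radius.\<close>
    finally have "Dn n (\<lambda>x. P' (norm (x - y)) / of_real (norm (x - y)))"
      using Suc.prems(3) P'0 by (intro Suc.IH[of _ "\<delta>/2" 0]) auto
    then show "Dn n (\<lambda>x. of_real ((x - y) \<bullet> b) * (P' (norm (x - y)) / of_real (norm (x - y))))" for b
      by (intro Dn_mult Dn_inner)
  qed
qed simp

text \<open>With R(t) = P'(t)/t the gradient is (x - y) R, whose divergence in three dimensions is t
  R' + 3 R. This simplifies to P'' + 2 P'/t.\<close>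

lemma laplacian_radial:
  fixes P :: "real \<Rightarrow> complex" and y :: "real^3"
  assumes P': "\<And>t. t > 0 \<Longrightarrow> (P has_vector_derivative P' t) (at t)"
    and P'': "\<And>t. t > 0 \<Longrightarrow> (P' has_vector_derivative P'' t) (at t)"
    and const: "\<And>t. 0 \<le> t \<Longrightarrow> t \<le> \<delta> \<Longrightarrow> P t = c" and "\<delta> > 0" "\<And>t. t < \<delta> \<Longrightarrow> P' t = 0" "P'' 0 = 0"
  shows "laplacian3 (\<lambda>x. P (norm (x - y))) x = P'' (norm (x - y)) + 2 * P' (norm (x - y)) / of_real (norm (x - y))"
proof -
  define R where "R t = P' t / of_real t" for t
  define R' where "R' t = (P'' t - P' t / of_real t) / of_real t" for t
  define \<rho> where "\<rho> = norm (x - y)"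
  have d1: "dpart b (\<lambda>x. P (norm (x - y))) = (\<lambda>x. of_real ((x - y) \<bullet> b) * R (norm (x - y)))" for b
    using dpart_eq[OF has_derivative_radial[OF P' const \<open>\<delta> > 0\<close>]] assms(5)[of 0] \<open>\<delta> > 0\<close> by (auto simp: R_def)
  have R': "(R has_vector_derivative R' t) (at t)" if "t > 0" for t
  proof -
    have "((\<lambda>z. inverse z) has_field_derivative - (inverse (of_real t) * inverse (of_real t))) (at (complex_of_real t))"
      using that by (auto intro!: derivative_eq_intros)
    note has_vector_derivative_mult[OF P''[OF that] has_vector_derivative_real_field[OF this]]
    then show ?thesis
      unfolding R_def[abs_def] R'_def divide_inverse by (simp add: algebra_simps)
  qed
  have "((\<lambda>x. R (norm (x - y))) has_derivative (\<lambda>h. of_real ((x - y) \<bullet> h) * (R' (norm (x - y)) / of_real (norm (x - y))))) (at x)" for x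
    by (rule has_derivative_radial[OF R', of "\<delta>/2" 0])
       (use assms in \<open>auto simp: R_def R'_def\<close>)
  then have d2: "((\<lambda>x. of_real ((x - y) \<bullet> b) * R (norm (x - y))) has_derivative
     (\<lambda>h. of_real ((x - y) \<bullet> b) * (of_real ((x - y) \<bullet> h) * (R' (norm (x - y)) / of_real (norm (x - y)))) + of_real (h \<bullet> b) * R (norm (x - y)))) (at x)" for b
    by (intro has_derivative_mult) (auto intro!: derivative_eq_intros)
  have "laplacian3 (\<lambda>x. P (norm (x - y))) x = (\<Sum>b\<in>Basis. of_real ((x - y) \<bullet> b) * (of_real ((x - y) \<bullet> b) * (R' \<rho> / of_real \<rho>)) + of_real (b \<bullet> b) * R \<rho>)"
    unfolding laplacian3_def by (simp add: d1 dpart_eq[OF d2] \<rho>_def)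
  also have "\<dots> = of_real (\<Sum>b\<in>Basis. ((x - y) \<bullet> b) * ((x - y) \<bullet> b)) * (R' \<rho> / of_real \<rho>) + 3 * R \<rho>"
    by (simp add: sum.distrib sum_distrib_right sum_divide_distrib mult.assoc inner_Basis)
  also have "(\<Sum>b\<in>Basis. ((x - y) \<bullet> b) * ((x - y) \<bullet> b)) = \<rho> * \<rho>"
    unfolding \<rho>_def by (metis euclidean_inner power2_eq_square power2_norm_eq_inner)
  also have "of_real (\<rho> * \<rho>) * (R' \<rho> / of_real \<rho>) + 3 * R \<rho> = P'' \<rho> + 2 * P' \<rho> / of_real \<rho>"
  proof (cases "\<rho> = 0")
    case True then show ?thesis using assms by (simp add: R_def)
  next
    case False then show ?thesis by (simp add: R_def R'_def field_simps)
  qed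
  finally show ?thesis by (simp add: \<rho>_def)
qed

lemma laplacian_mult:
  assumes "Dn 2 f" "Dn 2 g"
  shows "laplacian3 (\<lambda>x. f x * g x) x = laplacian3 f x * g x + 2 * (\<Sum>b\<in>Basis. dpart b f x * dpart b g x) + f x * laplacian3 g x"
proof -
  have 1: "(h has_derivative (\<lambda>v. dpart v h x)) (at x)" if "Dn 2 h" for h x
    using that by (intro Dn_SucD[of 1]) (simp add: numeral_2_eq_2)
  have 2: "(dpart b h has_derivative (\<lambda>v. dpart v (dpart b h) x)) (at x)" if "Dn 2 h" "b \<in> Basis" for h x b
    using that by (intro Dn_SucD[of 0]) (simp add: numeral_2_eq_2)
  have d1: "dpart b (\<lambda>x. f x * g x) = (\<lambda>x. f x * dpart b g x + dpart b f x * g x)" for b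
    by (rule ext, rule dpart_eq[OF has_derivative_mult[OF 1 1], of f g]) (use assms in auto)
  have "((\<lambda>x. f x * dpart b g x + dpart b f x * g x) has_derivative
     (\<lambda>v. (f x * dpart v (dpart b g) x + dpart v f x * dpart b g x) + (dpart b f x * dpart v g x + dpart v (dpart b f) x * g x))) (at x)"
    if "b \<in> Basis" for b
    using assms that by (intro has_derivative_add has_derivative_mult 1 2)
  from dpart_eq[OF this] have "dpart b (\<lambda>x. f x * dpart b g x + dpart b f x * g x) x = 
     (f x * dpart b (dpart b g) x + dpart b f x * dpart b g x) + (dpart b f x * dpart b g x + dpart b (dpart b f) x * g x)" if "b \<in> Basis" for b
    using that by blast
  then show ?thesis
    unfolding laplacian3_def
    by (simp add: d1 sum.distrib sum_distrib_left sum_distrib_right algebra_simps)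
qed

section \<open>A cut-off outgoing fundamental solution\<close>

text \<open>Chosen once and for all, so that every cut-off below is an affine rescaling of the same
  function and the bounds on its derivatives are absolute constants.\<close>

definition step :: "real \<Rightarrow> complex" where
  "step = (SOME \<theta>. (\<forall>n. Cn n UNIV \<theta>) \<and> (\<forall>t\<le>0. \<theta> t = 1) \<and> (\<forall>t\<ge>1. \<theta> t = 0))"

definition "step1 t = vector_derivative step (at t)"
definition "step2 t = vector_derivative step1 (at t)"
definition "step3 t = vector_derivative step2 (at t)"

lemma step_props: "(\<forall>n. Cn n UNIV step) \<and> (\<forall>t\<le>0. step t = 1) \<and> (\<forall>t\<ge>1. step t = 0)"
proof -
  have "\<exists>\<theta>. (\<forall>n. Cn n UNIV \<theta>) \<and> (\<forall>t\<le>0. \<theta> t = 1) \<and> (\<forall>t\<ge>1. \<theta> t = (0::complex))"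
    using smooth_step by metis
  then show ?thesis unfolding step_def by (rule someI_ex)
qed

lemma step_eq: "t \<le> 0 \<Longrightarrow> step t = 1" "t \<ge> 1 \<Longrightarrow> step t = 0"
  using step_props by auto

lemma Cn_step: "Cn n UNIV step" "Cn n UNIV step1" "Cn n UNIV step2" "Cn n UNIV step3"
proof -
  show 0: "Cn n UNIV step" for n using step_props by blast
  show 1: "Cn n UNIV step1" for n using 0[of "Suc n"] by (simp add: step1_def[abs_def])
  show 2: "Cn n UNIV step2" for n using 1[of "Suc n"] by (simp add: step2_def[abs_def])
  show "Cn n UNIV step3" for n using 2[of "Suc n"] by (simp add: step3_def[abs_def])
qed

lemma step_deriv:
  "(step has_vector_derivative step1 t) (at t)"
  "(step1 has_vector_derivative step2 t) (at t)"
  "(step2 has_vector_derivative step3 t) (at t)"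
  using Cn_SucD[OF Cn_step(1)[of "Suc 0"], of t] Cn_SucD[OF Cn_step(2)[of "Suc 0"], of t]
    Cn_SucD[OF Cn_step(3)[of "Suc 0"], of t]
  by (simp_all add: step1_def[symmetric] step2_def[symmetric] step3_def[symmetric])

lemma continuous_step:
  "continuous_on A step" "continuous_on A step1" "continuous_on A step2" "continuous_on A step3"
proof -
  have *: "continuous_on A f" if "Cn (Suc 0) UNIV f" for f
    by (rule continuous_at_imp_continuous_on)
       (use has_vector_derivative_continuous[OF Cn_SucD[OF that UNIV_I]] in blast)
  show "continuous_on A step" "continuous_on A step1" "continuous_on A step2" "continuous_on A step3"
    by (intro * Cn_step)+
qed

lemma measurable_step [measurable]:
  "step \<in> borel_measurable borel" "step1 \<in> borel_measurable borel" "step2 \<in> borel_measurable borel" "step3 \<in> borel_measurable borel"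
  by (intro borel_measurable_continuous_onI continuous_step)+

text \<open>On the open half lines the function is constant. The endpoints 0 and 1 are reached
  because the derivatives are continuous, so their zero sets are closed.\<close>

lemma step_deriv_zero:
  assumes "t \<le> 0 \<or> t \<ge> 1"
  shows "step1 t = 0" "step2 t = 0" "step3 t = 0"
proof -
  have *: "f' t = 0"
    if d: "\<And>t. (f has_vector_derivative f' t) (at t)" and c: "continuous_on UNIV f'"
      and 0: "\<And>t. t \<le> 0 \<Longrightarrow> f t = a" "\<And>t. t \<ge> 1 \<Longrightarrow> f t = b" and t: "t \<le> 0 \<or> t \<ge> 1" for f f' :: "real \<Rightarrow> complex" and a b t
  proof -
    have l: "f' t = 0" if "t < 0" for t
    proof -
      have "((\<lambda>_. a) has_vector_derivative 0) (at t)" by simp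
      then have "(f has_vector_derivative 0) (at t)"
        by (rule has_vector_derivative_transform_within_open[of _ _ _ "{..<0}"]) (use that 0 in auto)
      then show ?thesis using d vector_derivative_unique_at by blast
    qed
    have r: "f' t = 0" if "t > 1" for t
    proof -
      have "((\<lambda>_. b) has_vector_derivative 0) (at t)" by simp
      then have "(f has_vector_derivative 0) (at t)"
        by (rule has_vector_derivative_transform_within_open[of _ _ _ "{1<..}"]) (use that 0 in auto)
      then show ?thesis using d vector_derivative_unique_at by blast
    qed
    have cl: "closed {t. f' t = 0}"
      by (intro closed_Collect_eq c continuous_on_const)
    have "closure {..<0} \<subseteq> {t. f' t = 0}" "closure {1<..} \<subseteq> {t. f' t = 0}"
      by (rule closure_minimal[OF _ cl]; use l r in blast)+
    then show ?thesis using t by auto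
  qed
  have 1: "step1 t = 0" if "t \<le> 0 \<or> t \<ge> 1" for t
    using *[OF step_deriv(1) continuous_step(2) step_eq that] .
  have 2: "step2 t = 0" if "t \<le> 0 \<or> t \<ge> 1" for t
    using *[OF step_deriv(2) continuous_step(3) _ _ that, of 0 0] 1 by blast
  have 3: "step3 t = 0" if "t \<le> 0 \<or> t \<ge> 1" for t
    using *[OF step_deriv(3) continuous_step(4) _ _ that, of 0 0] 2 by blast
  show "step1 t = 0" "step2 t = 0" "step3 t = 0" using 1 2 3 assms by auto
qed

lemma step_bounded:
  obtains C where "C \<ge> 1" "\<And>t. norm (step t) \<le> C" "\<And>t. norm (step1 t) \<le> C" "\<And>t. norm (step2 t) \<le> C" "\<And>t. norm (step3 t) \<le> C"
proof -
  have *: "\<exists>C. \<forall>t. norm (f t) \<le> C" if "continuous_on UNIV f" "\<And>t. t \<le> 0 \<or> t \<ge> 1 \<Longrightarrow> norm (f t) \<le> 1" for f :: "real \<Rightarrow> complex"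
  proof -
    have "compact (f ` {0..1})" by (intro compact_continuous_image continuous_on_subset[OF that(1)]) auto
    then obtain K where "\<forall>y\<in>f ` {0..1}. norm y \<le> K"
      using compact_imp_bounded bounded_iff by metis
    then have "norm (f t) \<le> max K 1" for t
      using that(2)[of t] by (cases "t \<le> 0 \<or> t \<ge> 1") (auto simp: le_max_iff_disj)
    then show ?thesis by blast
  qed
  obtain A B C D where "\<forall>t. norm (step t) \<le> A" "\<forall>t. norm (step1 t) \<le> B" "\<forall>t. norm (step2 t) \<le> C" "\<forall>t. norm (step3 t) \<le> D"
    using *[OF continuous_step(1)] *[OF continuous_step(2)] *[OF continuous_step(3)] *[OF continuous_step(4)]
    by (metis norm_one norm_zero order_refl step_deriv_zero step_eq zero_le_one)
  then show thesis
    by (intro that[of "max 1 (max A (max B (max C D)))"]) (auto simp: le_max_iff_disj)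
qed

definition outgoing :: "real \<Rightarrow> real \<Rightarrow> complex" where
  "outgoing k t = exp (\<i> * of_real k * of_real t) / (4 * of_real pi * of_real t)"

text \<open>The argument t / e - 1 places the transition in e \<le> t \<le> 2 e. Being 0 near the
  origin, the function is smooth in space and may be used to test the equation.\<close>

definition outgoing_cut :: "real \<Rightarrow> real \<Rightarrow> real \<Rightarrow> complex" where
  "outgoing_cut k e t = (1 - step (t / e - 1)) * outgoing k t"

text \<open>For a radial w the Laplacian is (t w)'' / t, and t times \<open>outgoing\<close> is a
  multiple of exp(ikt), a solution of y'' + k^2 y = 0. Hence applying - (Laplacian + k^2) to
  \<open>outgoing_cut\<close> leaves only the terms in which the step is differentiated.\<close>

definition outgoing_ker :: "real \<Rightarrow> real \<Rightarrow> real \<Rightarrow> complex" where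
  "outgoing_ker k e t = (step2 (t / e - 1) / of_real (e ^ 2) + 2 * \<i> * of_real k * step1 (t / e - 1) / of_real e) * outgoing k t"

lemma measurable_outgoing [measurable]:
  "outgoing k \<in> borel_measurable borel" "outgoing_cut k e \<in> borel_measurable borel" "outgoing_ker k e \<in> borel_measurable borel"
  unfolding outgoing_def[abs_def] outgoing_cut_def[abs_def] outgoing_ker_def[abs_def] by measurable

lemma outgoing_deriv:
  assumes "t \<noteq> 0"
  shows "(outgoing k has_vector_derivative outgoing k t * (\<i> * of_real k - 1 / of_real t)) (at t)"
proof -
  have "((\<lambda>z. exp (\<i> * of_real k * z) / (4 * of_real pi * z)) has_field_derivative 
      outgoing k t * (\<i> * of_real k - 1 / of_real t)) (at (complex_of_real t))"
    using assms by (auto intro!: derivative_eq_intros simp: outgoing_def field_simps)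
  from has_vector_derivative_real_field[OF this] show ?thesis
    by (simp add: outgoing_def[abs_def])
qed

lemma norm_outgoing: "norm (outgoing k t) = 1 / (4 * pi * \<bar>t\<bar>)"
proof -
  have "norm (exp (\<i> * of_real k * of_real t)) = 1" by (simp add: norm_exp_eq_Re)
  then show ?thesis by (simp add: outgoing_def norm_divide norm_mult)
qed

lemma vector_derivative_affine:
  fixes f f' :: "real \<Rightarrow> complex"
  assumes "\<And>t. (f has_vector_derivative f' t) (at t)" "e \<noteq> 0"
  shows "((\<lambda>t. f (t / e - c)) has_vector_derivative f' (t / e - c) / of_real e) (at t)"
proof -
  have "((\<lambda>t. t / e - c) has_vector_derivative 1 / e) (at t)"
    by (use assms(2) in \<open>auto intro!: derivative_eq_intros simp: has_real_derivative_iff_has_vector_derivative[symmetric]\<close>)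
  from vector_diff_chain_at[OF this assms(1)] show ?thesis
    by (simp add: o_def scaleR_conv_of_real of_real_inverse divide_inverse mult.commute)
qed

lemma outgoing_cut_deriv:
  assumes "t > 0" "e > 0"
  shows "(outgoing_cut k e has_vector_derivative
      (1 - step (t / e - 1)) * (outgoing k t * (\<i> * of_real k - 1 / of_real t)) - step1 (t / e - 1) / of_real e * outgoing k t) (at t)"
proof -
  have "((\<lambda>t. 1 - step (t / e - 1)) has_vector_derivative 0 - step1 (t / e - 1) / of_real e) (at t)"
    by (intro has_vector_derivative_diff has_vector_derivative_const vector_derivative_affine step_deriv) (use assms in auto)
  from has_vector_derivative_mult[OF this outgoing_deriv, of k] show ?thesis
    using assms by (simp add: outgoing_cut_def[abs_def])
qed

lemma outgoing_cut_deriv2: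
  assumes "t > 0" "e > 0"
  shows "((\<lambda>t. (1 - step (t / e - 1)) * (outgoing k t * (\<i> * of_real k - 1 / of_real t)) - step1 (t / e - 1) / of_real e * outgoing k t)
      has_vector_derivative
      (1 - step (t / e - 1)) * (outgoing k t * (\<i> * of_real k - 1 / of_real t) * (\<i> * of_real k - 1 / of_real t) + outgoing k t * (1 / of_real t ^ 2))
      - 2 * (step1 (t / e - 1) / of_real e) * (outgoing k t * (\<i> * of_real k - 1 / of_real t))
      - step2 (t / e - 1) / of_real e / of_real e * outgoing k t) (at t)"
proof -
  have 1: "((\<lambda>t. 1 - step (t / e - 1)) has_vector_derivative 0 - step1 (t / e - 1) / of_real e) (at t)"
    by (intro has_vector_derivative_diff has_vector_derivative_const vector_derivative_affine step_deriv) (use assms in auto)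
  have 2: "((\<lambda>t. step1 (t / e - 1) / of_real e) has_vector_derivative step2 (t / e - 1) / of_real e / of_real e) (at t)"
    by (intro has_vector_derivative_divide vector_derivative_affine step_deriv) (use assms in auto)
  have "((\<lambda>z. \<i> * of_real k - 1 / z) has_field_derivative 1 / of_real t ^ 2) (at (complex_of_real t))"
    using assms by (auto intro!: derivative_eq_intros simp: power2_eq_square)
  note 3 = has_vector_derivative_real_field[OF this]
  have o: "(outgoing k has_vector_derivative outgoing k t * (\<i> * of_real k - 1 / of_real t)) (at t)"
    using assms by (intro outgoing_deriv) auto
  show ?thesis
    using has_vector_derivative_diff[OF has_vector_derivative_mult[OF 1 has_vector_derivative_mult[OF o 3]] has_vector_derivative_mult[OF 2 o]]
    by (rule has_vector_derivative_eq_rhs) (simp add: algebra_simps)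
qed


lemma outgoing_cut_eq_0: "e > 0 \<Longrightarrow> t \<le> e \<Longrightarrow> outgoing_cut k e t = 0"
  by (simp add: outgoing_cut_def step_eq)

lemma outgoing_cut_eq: "e > 0 \<Longrightarrow> t \<ge> 2 * e \<Longrightarrow> outgoing_cut k e t = outgoing k t"
  by (simp add: outgoing_cut_def step_eq field_simps)

lemma outgoing_ker_eq_0: "e > 0 \<Longrightarrow> t \<le> e \<or> t \<ge> 2 * e \<Longrightarrow> outgoing_ker k e t = 0"
  by (auto simp: outgoing_ker_def step_deriv_zero field_simps)

lemma Cn_outgoing_cut:
  "Cn n {0<..} (outgoing_cut k e)"
proof -
  have "Cn n {0<..} (\<lambda>t. (1 + (-1) * step ((1 / e) * t + -1)) * (exp ((\<i> * of_real k) * of_real t) * (inverse (of_real t) * (1 / (4 * of_real pi)))))"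
    by (intro Cn_mult Cn_add Cn_const Cn_affine Cn_exp Cn_inverse Cn_step) auto
  moreover have "(1 + (-1) * step ((1 / e) * t + -1)) * (exp ((\<i> * of_real k) * of_real t) * (inverse (of_real t) * (1 / (4 * of_real pi))))
     = outgoing_cut k e t" for t
  proof -
    have "1 + (-1) * step ((1 / e) * t + -1) = 1 - step (t / e - 1)" by simp
    moreover have "exp ((\<i> * of_real k) * of_real t) * (inverse (of_real t) * (1 / (4 * of_real pi))) = outgoing k t"
      by (simp add: outgoing_def inverse_eq_divide)
    ultimately show ?thesis by (simp only: outgoing_cut_def)
  qed
  ultimately show ?thesis by (simp only:) 
qed

lemma Dn_outgoing_cut: "e > 0 \<Longrightarrow> Dn n (\<lambda>x. outgoing_cut k e (norm (x - y)))"
  by (rule Dn_radial[OF Cn_outgoing_cut, of e _ _ 0]) (auto simp: outgoing_cut_eq_0)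

lemma helmholtz_outgoing_cut:
  assumes "e > 0"
  shows "laplacian3 (\<lambda>x. outgoing_cut k e (norm (x - y))) x + of_real (k\<^sup>2) * outgoing_cut k e (norm (x - y)) = - outgoing_ker k e (norm (x - y))"
proof -
  define P' where "P' t = (1 - step (t / e - 1)) * (outgoing k t * (\<i> * of_real k - 1 / of_real t)) - step1 (t / e - 1) / of_real e * outgoing k t" for t
  define P'' where "P'' t = (1 - step (t / e - 1)) * (outgoing k t * (\<i> * of_real k - 1 / of_real t) * (\<i> * of_real k - 1 / of_real t) + outgoing k t * (1 / of_real t ^ 2))
      - 2 * (step1 (t / e - 1) / of_real e) * (outgoing k t * (\<i> * of_real k - 1 / of_real t))
      - step2 (t / e - 1) / of_real e / of_real e * outgoing k t" for t
  have "laplacian3 (\<lambda>x. outgoing_cut k e (norm (x - y))) x = P'' (norm (x - y)) + 2 * P' (norm (x - y)) / of_real (norm (x - y))"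
  proof (rule laplacian_radial[where \<delta> = e and c = 0])
    show "(outgoing_cut k e has_vector_derivative P' t) (at t)" if "t > 0" for t
      unfolding P'_def by (rule outgoing_cut_deriv[OF that assms])
    show "(P' has_vector_derivative P'' t) (at t)" if "t > 0" for t
      unfolding P'_def[abs_def] P''_def by (rule outgoing_cut_deriv2[OF that assms])
    show "P' t = 0" if "t < e" for t
      using that assms unfolding P'_def by (simp add: step_eq step_deriv_zero)
    show "P'' 0 = 0" by (simp add: P''_def step_eq step_deriv_zero)
  qed (use assms outgoing_cut_eq_0 in auto)
  also have "\<dots> + of_real (k\<^sup>2) * outgoing_cut k e (norm (x - y)) = - outgoing_ker k e (norm (x - y))"
  \<comment> \<open>At x = y every term is 0, since the cut-off function vanishes near the origin
    and division by 0 yields 0.\<close>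
  proof (cases "x = y")
    case True
    then show ?thesis using assms
      by (simp add: P'_def P''_def outgoing_cut_eq_0 outgoing_ker_eq_0 step_eq step_deriv_zero)
  next
    case False
    define t where "t = norm (x - y)"
    have "complex_of_real t \<noteq> 0" "complex_of_real e \<noteq> 0" using False assms by (auto simp: t_def)
    then have "P'' t + 2 * P' t / of_real t + of_real (k\<^sup>2) * outgoing_cut k e t = - outgoing_ker k e t"
      unfolding P''_def P'_def outgoing_cut_def outgoing_ker_def
      by (simp add: power2_eq_square field_simps)
    then show ?thesis by (simp add: t_def)
  qed
  finally show ?thesis .
qed

text \<open>The correction term makes the oscillation average out: exp(2ikt) times
  \<open>shell1\<close> is the derivative of exp(2ikt) step1(t - s) / (2ik), a function supported in
  [s, s + 1]. With \<open>step\<close> alone the mean of exp(2ikt) h'(t) would in general not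
  vanish.\<close>

definition shell :: "real \<Rightarrow> real \<Rightarrow> real \<Rightarrow> complex" where
  "shell k s t = step (t - s) + step1 (t - s) / (2 * \<i> * of_real k)"
definition shell1 :: "real \<Rightarrow> real \<Rightarrow> real \<Rightarrow> complex" where
  "shell1 k s t = step1 (t - s) + step2 (t - s) / (2 * \<i> * of_real k)"
definition shell2 :: "real \<Rightarrow> real \<Rightarrow> real \<Rightarrow> complex" where
  "shell2 k s t = step2 (t - s) + step3 (t - s) / (2 * \<i> * of_real k)"

lemma vector_derivative_shift:
  fixes f f' :: "real \<Rightarrow> complex"
  assumes "\<And>t. (f has_vector_derivative f' t) (at t)"
  shows "((\<lambda>t. f (t - c)) has_vector_derivative f' (t - c)) (at t)"
  using vector_derivative_affine[OF assms, of 1 c] by simp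

lemma shell_deriv:
  "(shell k s has_vector_derivative shell1 k s t) (at t)"
  "(shell1 k s has_vector_derivative shell2 k s t) (at t)"
  unfolding shell_def[abs_def] shell1_def[abs_def] shell2_def[abs_def]
  by (intro has_vector_derivative_add has_vector_derivative_divide vector_derivative_shift step_deriv)+

lemma shell_eq: "t \<le> s \<Longrightarrow> shell k s t = 1" "t \<ge> s + 1 \<Longrightarrow> shell k s t = 0"
  by (simp_all add: shell_def step_eq step_deriv_zero)

lemma shell_deriv_zero: "t \<le> s \<or> t \<ge> s + 1 \<Longrightarrow> shell1 k s t = 0" "t \<le> s \<or> t \<ge> s + 1 \<Longrightarrow> shell2 k s t = 0"
  by (auto simp: shell1_def shell2_def step_deriv_zero)

lemma Dn_shell:
  assumes "s > 0"
  shows "Dn n (\<lambda>x. shell k s (norm x))"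
proof -
  have "Cn n {0<..} (\<lambda>t. step (1 * t + - s) + step1 (1 * t + - s) * (1 / (2 * \<i> * of_real k)))"
    by (intro Cn_mult Cn_add Cn_const Cn_affine Cn_step) auto
  then have "Cn n {0<..} (shell k s)" by (simp add: shell_def[abs_def])
  from Dn_radial[OF this, of s 1 0] show ?thesis using assms shell_eq by auto
qed

lemma laplacian_shell:
  assumes "s > 0"
  shows "laplacian3 (\<lambda>x. shell k s (norm x)) x = shell2 k s (norm x) + 2 * shell1 k s (norm x) / of_real (norm x)"
  using laplacian_radial[of "shell k s" "shell1 k s" "shell2 k s" s 1 0 x] assms
  by (simp add: shell_deriv shell_eq shell_deriv_zero)

lemma dpart_shell:
  assumes "s > 0"
  shows "dpart h (\<lambda>x. shell k s (norm x)) x = of_real (x \<bullet> h) * (shell1 k s (norm x) / of_real (norm x))"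
  using dpart_eq[OF has_derivative_radial[of "shell k s" "shell1 k s" s 1 0 x]] assms
  by (simp add: shell_deriv shell_eq shell_deriv_zero)

section \<open>Growth under the radiation condition\<close>

lemma loc_int3_measurable:
  assumes "loc_int3 u"
  shows "u \<in> borel_measurable borel"
proof (rule borel_measurable_LIMSEQ_metric)
  show "(\<lambda>x. indicator (cball 0 (real n)) x *\<^sub>R u x) \<in> borel_measurable borel" for n
  proof -
    have "set_integrable lborel (cball 0 (real n)) u"
      using assms compact_cball by (simp add: loc_int3_def)
    from borel_measurable_integrable[OF this[unfolded set_integrable_def]] show ?thesis by simp
  qed
  fix x :: "real^3"
  have "eventually (\<lambda>n. indicator (cball 0 (real n)) x *\<^sub>R u x = u x) sequentially"
    using eventually_ge_at_top[of "nat \<lceil>norm x\<rceil>"] 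
  proof eventually_elim
    case (elim n)
    then have "norm x \<le> real n" by linarith
    then show ?case by simp
  qed
  then show "(\<lambda>n. indicator (cball 0 (real n)) x *\<^sub>R u x) \<longlonglongrightarrow> u x"
    by (rule tendsto_eventually)
qed

text \<open>By linearity of the derivative the factor |x| moves into its direction. The derivative
  along x itself is the one that occurs in the divergence of x f(x).\<close>

lemma sommerfeld_radial:
  assumes "sommerfeld k u" "\<eta> > 0"
  obtains S where "S \<ge> 1" "\<And>x. norm x \<ge> S \<Longrightarrow> u differentiable (at x)"
    "\<And>x. norm x \<ge> S \<Longrightarrow> cmod (frechet_derivative u (at x) x - \<i> * of_real k * of_real (norm x) * u x) \<le> \<eta>"
proof -
  obtain R where R: "\<And>x. norm x \<ge> R \<Longrightarrow> u differentiable (at x)"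
    using assms unfolding sommerfeld_def by blast
  obtain S where S: "\<And>x. norm x \<ge> S \<Longrightarrow>
        norm x * cmod (frechet_derivative u (at x) (x /\<^sub>R norm x) - \<i> * complex_of_real k * u x) \<le> \<eta>"
    using assms unfolding sommerfeld_def by blast
  show thesis
  proof (rule that[of "max 1 (max R S)"])
    fix x :: "real^3" assume x: "max 1 (max R S) \<le> norm x"
    then show d: "u differentiable (at x)" using R by simp
    have "linear (frechet_derivative u (at x))" using d by (rule linear_frechet_derivative)
    then have "frechet_derivative u (at x) x = norm x *\<^sub>R frechet_derivative u (at x) (x /\<^sub>R norm x)"
      using x linear_scale[of "frechet_derivative u (at x)" "inverse (norm x)" x] by (cases "x = 0") auto
    then have "frechet_derivative u (at x) x - \<i> * of_real k * of_real (norm x) * u x =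
       of_real (norm x) * (frechet_derivative u (at x) (x /\<^sub>R norm x) - \<i> * complex_of_real k * u x)"
      by (simp add: scaleR_conv_of_real algebra_simps)
    then show "cmod (frechet_derivative u (at x) x - \<i> * of_real k * of_real (norm x) * u x) \<le> \<eta>"
      using S[of x] x by (simp add: norm_mult)
  qed simp
qed

text \<open>Along a ray v(t) = exp(-ikt) u(t e) has the modulus of u, and its derivative is bounded
  by 1/t. Integrating outwards from a sphere bounds u uniformly in the direction.\<close>

lemma sommerfeld_growth:
  assumes "sommerfeld k u"
  obtains A R where "A > 0" "R \<ge> 1" "\<And>x. norm x \<ge> R \<Longrightarrow> cmod (u x) \<le> A * sqrt (norm x)"
proof -
  obtain R where R: "R \<ge> 1" "\<And>x. norm x \<ge> R \<Longrightarrow> u differentiable (at x)"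
    "\<And>x. norm x \<ge> R \<Longrightarrow> cmod (frechet_derivative u (at x) x - \<i> * of_real k * of_real (norm x) * u x) \<le> 1"
    using sommerfeld_radial[OF assms, of 1] by (auto intro: that)
  \<comment> \<open>Differentiability at the points of the sphere makes u continuous there, so
    compactness bounds the initial values of all rays at once.\<close>
  have "continuous_on (sphere 0 R) u"
    using R by (intro continuous_at_imp_continuous_on ballI differentiable_imp_continuous_within) auto
  then have "compact (u ` sphere 0 R)" by (rule compact_continuous_image) auto
  then obtain M where M: "\<forall>z\<in>u ` sphere 0 R. norm z \<le> M"
    using compact_imp_bounded bounded_iff by metis
  have "cmod (u x) \<le> (\<bar>M\<bar> + 2) * sqrt (norm x)" if x: "norm x > R" for x
  proof -
    define e where "e = sgn x"
    have "norm x > 0" using x R(1) by linarith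
    then have e: "norm e = 1" by (simp add: e_def norm_sgn)
    have xe: "x = norm x *\<^sub>R e" using \<open>norm x > 0\<close> by (simp add: e_def sgn_div_norm)
    define v where "v t = exp (- (\<i> * of_real k * of_real t)) * u (t *\<^sub>R e)" for t
    define v' where "v' t = exp (- (\<i> * of_real k * of_real t)) * frechet_derivative u (at (t *\<^sub>R e)) e
       + (- (\<i> * of_real k) * exp (- (\<i> * of_real k * of_real t))) * u (t *\<^sub>R e)" for t
    have v: "(v has_vector_derivative v' t) (at t)" if "t \<ge> R" for t
    proof -
      have d: "u differentiable (at (t *\<^sub>R e))" using that R e by simp
      have "((\<lambda>t. u (t *\<^sub>R e)) has_derivative (\<lambda>h. frechet_derivative u (at (t *\<^sub>R e)) (h *\<^sub>R e))) (at t)"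
        by (rule has_derivative_compose[where g = u and f = "\<lambda>t. t *\<^sub>R e" and f' = "\<lambda>h. h *\<^sub>R e"])
           (use d[unfolded frechet_derivative_works] in \<open>auto intro!: derivative_eq_intros\<close>)
      then have 1: "((\<lambda>t. u (t *\<^sub>R e)) has_vector_derivative frechet_derivative u (at (t *\<^sub>R e)) e) (at t)"
        using linear_scale[OF linear_frechet_derivative[OF d]] by (simp add: has_vector_derivative_def)
      have "((\<lambda>z. exp (- (\<i> * of_real k * z))) has_field_derivative (- (\<i> * of_real k) * exp (- (\<i> * of_real k * of_real t)))) (at (complex_of_real t))"
        by (auto intro!: derivative_eq_intros)
      from has_vector_derivative_mult[OF has_vector_derivative_real_field[OF this] 1]
      show ?thesis by (simp add: v_def[abs_def] v'_def)
    qed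
    have v'_bd: "norm (v' t) \<le> 1 / sqrt t" if "t \<ge> R" for t
    proof -
      have t: "t \<ge> 1" using that R by simp
      have d: "u differentiable (at (t *\<^sub>R e))" using that R e by simp
      have "frechet_derivative u (at (t *\<^sub>R e)) (t *\<^sub>R e) = t *\<^sub>R frechet_derivative u (at (t *\<^sub>R e)) e"
        using linear_scale[OF linear_frechet_derivative[OF d]] .
      then have "t *\<^sub>R v' t = exp (- (\<i> * of_real k * of_real t)) * (frechet_derivative u (at (t *\<^sub>R e)) (t *\<^sub>R e) - \<i> * of_real k * of_real (norm (t *\<^sub>R e)) * u (t *\<^sub>R e))"
        using e t by (simp add: v'_def scaleR_conv_of_real[where 'a = complex] algebra_simps)
      also have "norm \<dots> \<le> 1"
        using R(3)[of "t *\<^sub>R e"] that t e by (simp add: norm_mult norm_exp_eq_Re)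
      finally have "norm (v' t) \<le> 1 / t" using t by (simp add: field_simps)
      \<comment> \<open>The logarithm is traded for a square root, whose primitive is simpler. The
        commutator estimate consumes only that u grows more slowly than |x|.\<close>
      also have "\<dots> \<le> 1 / sqrt t"
        using t real_sqrt_le_mono[of t "t * t"] by (intro divide_left_mono) (auto simp: mult_le_cancel_left1)
      finally show ?thesis .
    qed
    have "norm (v (norm x) - v R) \<le> 2 * sqrt (norm x) - 2 * sqrt R"
    proof (rule differentiable_bound_general[of R "norm x" v "\<lambda>t. 2 * sqrt t" v' "\<lambda>t. 1 / sqrt t"])
      show "continuous_on {R..norm x} v"
        by (rule continuous_at_imp_continuous_on) (use v has_vector_derivative_continuous in fastforce)
      show "((\<lambda>t. 2 * sqrt t) has_vector_derivative 1 / sqrt t) (at t)" if "R < t" for t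
        using that R by (auto intro!: derivative_eq_intros simp: has_real_derivative_iff_has_vector_derivative[symmetric] field_simps)
    qed (use x v v'_bd in \<open>auto intro!: continuous_intros\<close>)
    moreover have "norm (v R) \<le> \<bar>M\<bar>"
    proof -
      have "norm (u (R *\<^sub>R e)) \<le> M" using M e R by auto
      then show ?thesis by (simp add: v_def norm_mult norm_exp_eq_Re)
    qed
    moreover have "norm (v (norm x)) = norm (u x)"
      using xe by (simp add: v_def norm_mult norm_exp_eq_Re)
    moreover have "norm (v (norm x)) \<le> norm (v (norm x) - v R) + norm (v R)"
      using norm_triangle_ineq[of "v (norm x) - v R" "v R"] by simp
    moreover have "sqrt R \<ge> 0" using R by simp
    ultimately have "norm (u x) \<le> \<bar>M\<bar> + 2 * sqrt (norm x)" by linarith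
    moreover have "\<bar>M\<bar> * 1 \<le> \<bar>M\<bar> * sqrt (norm x)"
      using x R by (intro mult_left_mono) auto
    ultimately show ?thesis by (simp add: algebra_simps)
  qed
  then show thesis
    using R by (intro that[of "\<bar>M\<bar> + 2" "R + 1"]) auto
qed

text \<open>\<sigma> and c are the components of x and y along the unit vector of x - y, and
  \<sigma> = \<rho> + c. Both |x|^2 - \<sigma>^2 and |y|^2 - c^2 are the squared distance of the
  origin from the line through x and y. Therefore \<sigma> differs from |x| by O(1/|x|) only,
  although \<rho> differs from |x| by O(1).\<close>

lemma phase_estimate:
  fixes x y :: "'a::real_inner"
  assumes "norm x \<ge> 2 * norm y + 2"
  defines "\<rho> \<equiv> norm (x - y)"
  defines "\<sigma> \<equiv> ((x - y) \<bullet> x) / \<rho>"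
  shows "\<rho> \<ge> norm x / 2" "\<bar>\<sigma> - norm x\<bar> \<le> (norm y)\<^sup>2 / norm x" "\<bar>\<sigma> / \<rho> - 1\<bar> \<le> 2 * norm y / norm x"
proof -
  have r: "norm x > 0" using assms norm_ge_zero[of y] by linarith
  have "norm x \<le> \<rho> + norm y" unfolding \<rho>_def using norm_triangle_ineq[of "x - y" y] by simp
  then show \<rho>: "\<rho> \<ge> norm x / 2" using assms(1) by simp
  then have \<rho>0: "\<rho> > 0" using r by linarith
  define c where "c = ((x - y) \<bullet> y) / \<rho>"
  have c: "\<bar>c\<bar> \<le> norm y"
    using Cauchy_Schwarz_ineq2[of "x - y" y] \<rho>0 by (simp add: c_def \<rho>_def field_simps)
  have sc: "\<sigma> = \<rho> + c"
  proof -
    have "(x - y) \<bullet> x = \<rho> * \<rho> + (x - y) \<bullet> y"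
      unfolding \<rho>_def by (simp add: power2_norm_eq_inner[symmetric] power2_eq_square[symmetric] inner_diff_right[symmetric]) (simp add: power2_norm_eq_inner inner_diff_left inner_diff_right)
    then show ?thesis using \<rho>0 by (simp add: \<sigma>_def c_def field_simps)
  qed
  have "\<bar>\<sigma> / \<rho> - 1\<bar> = \<bar>c\<bar> / \<rho>" using \<rho>0 by (simp add: sc field_simps)
  also have "\<dots> \<le> norm y / (norm x / 2)"
    using c \<rho> r by (intro frac_le) auto
  finally show "\<bar>\<sigma> / \<rho> - 1\<bar> \<le> 2 * norm y / norm x" by (simp add: mult.commute)
  have s0: "\<sigma> \<ge> 0" using sc c \<rho> assms(1) by linarith
  have s1: "\<sigma> \<le> norm x"
    using norm_cauchy_schwarz[of "x - y" x] \<rho>0 by (simp add: \<sigma>_def \<rho>_def field_simps)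
  have "(norm x)\<^sup>2 - \<sigma>\<^sup>2 = (norm y)\<^sup>2 - c\<^sup>2"
  proof -
    have "(norm x)\<^sup>2 = \<rho>\<^sup>2 + 2 * ((x - y) \<bullet> y) + (norm y)\<^sup>2"
      unfolding \<rho>_def by (simp add: power2_norm_eq_inner inner_diff_left inner_diff_right inner_commute)
    moreover have "(x - y) \<bullet> y = c * \<rho>" using \<rho>0 by (simp add: c_def)
    ultimately show ?thesis by (simp add: sc power2_eq_square algebra_simps)
  qed
  then have "(norm x)\<^sup>2 - \<sigma>\<^sup>2 \<le> (norm y)\<^sup>2" using zero_le_power2[of c] by linarith
  then have "(norm x - \<sigma>) * (norm x + \<sigma>) \<le> (norm y)\<^sup>2"
    by (simp add: power2_eq_square algebra_simps)
  moreover have "(norm x - \<sigma>) * norm x \<le> (norm x - \<sigma>) * (norm x + \<sigma>)"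
    using s0 s1 by (intro mult_left_mono) auto
  ultimately have "(norm x - \<sigma>) * norm x \<le> (norm y)\<^sup>2" by linarith
  then show "\<bar>\<sigma> - norm x\<bar> \<le> (norm y)\<^sup>2 / norm x"
    using s1 r by (simp add: field_simps)
qed

text \<open>The growth s^2 matches the pointwise error \<eta> / s^2 of the commutator. The constant
  comes from (s + 1)^3 - s^3 \<le> 7 s^2 and 28 pi / 3 \<le> 30.\<close>

lemma measure_shell:
  assumes "s \<ge> 1"
  shows "measure lborel {x :: real^3. s \<le> norm x \<and> norm x \<le> s + 1} \<le> 30 * s\<^sup>2"
proof -
  have eq: "{x :: real^3. s \<le> norm x \<and> norm x \<le> s + 1} = cball 0 (s + 1) - ball 0 s" by auto
  have "measure lborel (cball 0 (s + 1) - ball (0::real^3) s) = measure lborel (cball (0::real^3) (s + 1)) - measure lborel (ball (0::real^3) s)"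
    by (rule measure_Diff) (use assms emeasure_lborel_cball_finite[of "0::real^3" "s+1"] in auto)
  also have "\<dots> = 4 / 3 * pi * ((s + 1) ^ 3 - s ^ 3)"
    using assms by (simp add: content_cball content_ball unit_ball_vol_3 right_diff_distrib)
  also have "\<dots> \<le> 4 / 3 * pi * (7 * s\<^sup>2)"
  proof -
    have "s * 1 \<le> s * s" "1 * 1 \<le> s * s" using assms mult_mono[of 1 s 1 s] by auto
    then have "(s + 1) ^ 3 - s ^ 3 \<le> 7 * s\<^sup>2" by (simp add: power3_eq_cube power2_eq_square algebra_simps)
    then show ?thesis by (intro mult_left_mono) auto
  qed
  also have "\<dots> \<le> 30 * s\<^sup>2"
    using pi_approx mult_right_mono[of "pi * 28 / 3" 30 "s\<^sup>2"] by simp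
  finally show ?thesis by (simp add: eq)
qed

section \<open>Representation of radiating solutions by convolution\<close>

lemma shell_bounds:
  assumes "k > 0"
  obtains C where "C \<ge> 1" "\<And>s t. norm (shell1 k s t) \<le> C" "\<And>s t. norm (shell2 k s t) \<le> C" "\<And>t. norm (step1 t / (2 * \<i> * of_real k)) \<le> C"
proof -
  obtain C where C: "C \<ge> 1" "\<And>t. norm (step1 t) \<le> C" "\<And>t. norm (step2 t) \<le> C" "\<And>t. norm (step3 t) \<le> C"
    using step_bounded by metis
  show thesis
  proof (rule that[of "C + C / (2 * k)"])
    show "C + C / (2 * k) \<ge> 1" using C assms by (simp add: add_increasing2)
    show "norm (shell1 k s t) \<le> C + C / (2 * k)" for s t
      unfolding shell1_def using C(2,3)[of "t - s"] assms
      by (intro norm_triangle_mono) (auto simp: norm_divide norm_mult intro!: divide_right_mono)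
    show "norm (shell2 k s t) \<le> C + C / (2 * k)" for s t
      unfolding shell2_def using C(3,4)[of "t - s"] assms
      by (intro norm_triangle_mono) (auto simp: norm_divide norm_mult intro!: divide_right_mono)
    have "norm (step1 t / (2 * \<i> * of_real k)) \<le> C / (2 * k)" for t
      using C(2)[of t] assms by (auto simp: norm_divide norm_mult intro!: divide_right_mono)
    moreover have "C / (2 * k) \<le> C + C / (2 * k)" using C by simp
    ultimately show "norm (step1 t / (2 * \<i> * of_real k)) \<le> C + C / (2 * k)" for t
      using order_trans by blast
  qed
qed

text \<open>Two derivatives of the step cost 1 / e^2, and \<open>outgoing\<close> is at most 1 / e
  for t \<ge> e. Since the kernel lives in a ball of radius 2 e, its L^1 norm is bounded uniformly
  in e.\<close>

lemma outgoing_ker_bound: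
  obtains C where "C \<ge> 0" "\<And>e t. 0 < e \<Longrightarrow> e \<le> 1 \<Longrightarrow> norm (outgoing_ker k e t) \<le> C / e ^ 3"
proof -
  obtain C where C: "C \<ge> 1" "\<And>t. norm (step1 t) \<le> C" "\<And>t. norm (step2 t) \<le> C"
    using step_bounded by metis
  show thesis
  proof (rule that[of "C + 2 * \<bar>k\<bar> * C"])
    fix e t :: real assume e: "0 < e" "e \<le> 1"
    show "norm (outgoing_ker k e t) \<le> (C + 2 * \<bar>k\<bar> * C) / e ^ 3"
    proof (cases "t \<le> e")
      case False
      then have t: "t > e" by simp
      have "norm (step2 (t / e - 1) / of_real (e ^ 2) + 2 * \<i> * of_real k * step1 (t / e - 1) / of_real e)
        \<le> C / e\<^sup>2 + 2 * \<bar>k\<bar> * C / e"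
        using C e by (intro norm_triangle_mono) (auto simp: norm_divide norm_mult norm_power intro!: divide_right_mono mult_left_mono)
      also have "\<dots> \<le> C / e\<^sup>2 + 2 * \<bar>k\<bar> * C / e\<^sup>2"
        using C e by (intro add_left_mono divide_left_mono) (auto simp: power2_eq_square mult_le_cancel_left1)
      also have "\<dots> = (C + 2 * \<bar>k\<bar> * C) / e\<^sup>2" by (simp add: add_divide_distrib)
      finally have 1: "norm (step2 (t / e - 1) / of_real (e ^ 2) + 2 * \<i> * of_real k * step1 (t / e - 1) / of_real e) \<le> (C + 2 * \<bar>k\<bar> * C) / e\<^sup>2" .
      have "norm (outgoing k t) = 1 / (4 * pi * t)" using t e by (simp add: norm_outgoing)
      also have "\<dots> \<le> 1 / e"
      proof (rule divide_left_mono)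
        have "e \<le> 1 * t" using t by simp
        also have "\<dots> \<le> 4 * pi * t" using t e pi_gt3 by (intro mult_right_mono) auto
        finally show "e \<le> 4 * pi * t" .
      qed (use t e in auto)
      finally have 2: "norm (outgoing k t) \<le> 1 / e" .
      have "norm (outgoing_ker k e t) \<le> (C + 2 * \<bar>k\<bar> * C) / e\<^sup>2 * (1 / e)"
        unfolding outgoing_ker_def norm_mult using 1 2 C by (intro mult_mono) auto
      then show ?thesis by (simp add: power2_eq_square power3_eq_cube)
    qed (use e C in \<open>simp add: outgoing_ker_eq_0\<close>)
  qed (use C in auto)
qed

lemma integrable_mult_outgoing_ker:
  assumes u: "loc_int3 u" and e: "0 < e" "e \<le> 1"
  shows "integrable lborel (\<lambda>x. u x * outgoing_ker k e (norm (x - y)))"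
proof -
  note [measurable] = loc_int3_measurable[OF u]
  obtain C where C: "C \<ge> 0" "\<And>e t. 0 < e \<Longrightarrow> e \<le> 1 \<Longrightarrow> norm (outgoing_ker k e t) \<le> C / e ^ 3"
    using outgoing_ker_bound[of k] by metis
  show ?thesis
  proof (rule Bochner_Integration.integrable_bound)
    show "integrable lborel (\<lambda>x. (C / e ^ 3) *\<^sub>R (indicator (cball y (2 * e)) x *\<^sub>R u x))"
      using u by (intro integrable_scaleR_right) (simp add: loc_int3_def set_integrable_def)
    show "AE x in lborel. norm (u x * outgoing_ker k e (norm (x - y))) \<le> norm ((C / e ^ 3) *\<^sub>R (indicator (cball y (2 * e)) x *\<^sub>R u x))"
    proof (intro always_eventually allI)
      fix x
      show "norm (u x * outgoing_ker k e (norm (x - y))) \<le> norm ((C / e ^ 3) *\<^sub>R (indicator (cball y (2 * e)) x *\<^sub>R u x))"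
      proof (cases "x \<in> cball y (2 * e)")
        case True
        then show ?thesis using mult_left_mono[OF C(2)[OF e, of "norm (x - y)"], of "norm (u x)"] C(1) e
          by (simp add: norm_mult mult.commute abs_of_nonneg)
      next
        case False
        then have "norm (x - y) \<ge> 2 * e" by (simp add: dist_norm norm_minus_commute)
        then show ?thesis using e by (simp add: outgoing_ker_eq_0)
      qed
    qed
  qed measurable
qed

text \<open>Multiplying the Helmholtz equation by \<open>shell k s |x|\<close> times the outgoing function centred at \<open>y\<close>
  leaves a commutator supported in \<open>s \<le> |x| \<le> s + 1\<close>.  The factor \<open>shell\<close> is chosen such that, up to
  the errors estimated here, this commutator is the divergence of \<open>x f(x)\<close>, whose integral vanishes.\<close>

lemma commutator_bound:
  fixes u :: "real^3 \<Rightarrow> complex" and y :: "real^3"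
  assumes k: "k > 0" and e: "e > 0" "e \<le> 1" and u: "loc_int3 u" "sommerfeld k u"
  obtains M where "M \<ge> 0" "\<And>\<eta>. 0 < \<eta> \<Longrightarrow> \<eta> \<le> 1 \<Longrightarrow> \<exists>s0. \<forall>s\<ge>s0.
    cmod (\<integral>x. u x * (laplacian3 (\<lambda>x. shell k s (norm x) * outgoing_cut k e (norm (x - y))) x
             + of_real (k\<^sup>2) * (shell k s (norm x) * outgoing_cut k e (norm (x - y)))) \<partial>lborel
      + (\<integral>x. u x * outgoing_ker k e (norm (x - y)) \<partial>lborel)) \<le> M * \<eta>"
proof -
  note [measurable] = loc_int3_measurable[OF u(1)]
  obtain A R where A: "A > 0" "R \<ge> 1" "\<And>x. norm x \<ge> R \<Longrightarrow> cmod (u x) \<le> A * sqrt (norm x)"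
    using sommerfeld_growth[OF u(2)] by metis
  obtain C where C: "C \<ge> 1" "\<And>s t. norm (shell1 k s t) \<le> C" "\<And>s t. norm (shell2 k s t) \<le> C" "\<And>t. norm (step1 t / (2 * \<i> * of_real k)) \<le> C"
    using shell_bounds[OF k] by metis
  \<comment> \<open>L / |x| bounds the error of replacing the phase and amplitude centred at y by
    those centred at 0; the two summands are the last two estimates of
    \<open>phase_estimate\<close>.\<close>
  define L where "L = k * (norm y)\<^sup>2 + 2 * norm y"
  have L: "L \<ge> 0" using k by (simp add: L_def)
  \<comment> \<open>The sum of the coefficients of the three error terms \<open>b1\<close>,
    \<open>b2\<close>, \<open>b3\<close> below; the shell volume contributes another factor 30 at
    the end.\<close>
  define M where "M = 4 * A * C * L + 2 * C"
  have M: "M \<ge> 0" using A C L by (simp add: M_def)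
  define \<rho> where "\<rho> x = norm (x - y)" for x
  define W where "W x = outgoing_cut k e (\<rho> x)" for x
  define P' where "P' t = (1 - step (t / e - 1)) * (outgoing k t * (\<i> * of_real k - 1 / of_real t)) - step1 (t / e - 1) / of_real e * outgoing k t" for t
  have [measurable]: "P' \<in> borel_measurable borel" unfolding P'_def[abs_def] by measurable
  have P'0: "P' t = 0" if "t \<le> e" for t
    using that e unfolding P'_def by (simp add: step_eq step_deriv_zero)
  define dW where "dW x h = of_real ((x - y) \<bullet> h) * (P' (\<rho> x) / of_real (\<rho> x))" for x h
  have W_deriv: "(W has_derivative dW x) (at x)" for x
    unfolding W_def[abs_def] dW_def[abs_def] \<rho>_def
  proof (rule has_derivative_radial[where \<delta> = e and c = 0])
    show "(outgoing_cut k e has_vector_derivative P' t) (at t)" if "t > 0" for t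
      unfolding P'_def by (rule outgoing_cut_deriv[OF that e(1)])
  qed (use e outgoing_cut_eq_0 P'0[of 0] in auto)
  have [measurable]: "W \<in> borel_measurable borel" "(\<lambda>x. dW x x) \<in> borel_measurable borel"
    unfolding W_def[abs_def] dW_def \<rho>_def by measurable
  have far: "W x = outgoing k (\<rho> x)" "P' (\<rho> x) = outgoing k (\<rho> x) * (\<i> * of_real k - 1 / of_real (\<rho> x))"
    "outgoing_ker k e (\<rho> x) = 0" if "\<rho> x \<ge> 2 * e" for x
    using that e by (auto simp: W_def outgoing_cut_eq P'_def step_eq step_deriv_zero outgoing_ker_eq_0 field_simps)

  have main: "\<exists>s0. \<forall>s\<ge>s0.
    cmod (\<integral>x. u x * (laplacian3 (\<lambda>x. shell k s (norm x) * W x) x + of_real (k\<^sup>2) * (shell k s (norm x) * W x)) \<partial>lborel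
      + (\<integral>x. u x * outgoing_ker k e (\<rho> x) \<partial>lborel)) \<le> 30 * M * \<eta>" if \<eta>: "0 < \<eta>" "\<eta> \<le> 1" for \<eta>
  proof -
    obtain S where S: "S \<ge> 1" "\<And>x. norm x \<ge> S \<Longrightarrow> u differentiable (at x)"
      "\<And>x. norm x \<ge> S \<Longrightarrow> cmod (frechet_derivative u (at x) x - \<i> * of_real k * of_real (norm x) * u x) \<le> \<eta>"
      using sommerfeld_radial[OF u(2) \<eta>(1)] by metis
    show ?thesis
    proof (intro exI allI impI)
      \<comment> \<open>The lower bound involving y and e keeps the shell where
        \<open>outgoing_cut\<close> has become \<open>outgoing\<close> and the phase estimates hold.
        The bound 1 / \<eta>^2 turns sqrt r into at most r \<eta>.\<close>
      fix s assume s: "max (max S R) (max (2 * norm y + 2 + 4 * e) (1 / \<eta>\<^sup>2)) \<le> s"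
      then have sS: "s \<ge> S" "s \<ge> R" "s \<ge> 1" "s \<ge> 2 * norm y + 2 + 4 * e" "s \<ge> 1 / \<eta>\<^sup>2" using S by auto
      have s0: "s > 0" using sS by simp
      define T where "T x = (shell2 k s (norm x) + 2 * shell1 k s (norm x) / of_real (norm x)) * W x
         + 2 * (shell1 k s (norm x) / of_real (norm x)) * dW x x - shell k s (norm x) * outgoing_ker k e (\<rho> x)" for x
      have T: "laplacian3 (\<lambda>x. shell k s (norm x) * W x) x + of_real (k\<^sup>2) * (shell k s (norm x) * W x) = T x" for x
      proof -
        have lap: "laplacian3 W x = - outgoing_ker k e (\<rho> x) - of_real (k\<^sup>2) * W x"
          using helmholtz_outgoing_cut[OF e(1), of k y x] by (simp add: W_def[abs_def] \<rho>_def algebra_simps eq_neg_iff_add_eq_0)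
        have "(\<Sum>b\<in>Basis. dpart b (\<lambda>x. shell k s (norm x)) x * dpart b W x)
          = (\<Sum>b\<in>Basis. (shell1 k s (norm x) / of_real (norm x)) * (of_real (x \<bullet> b) * dW x b))"
          by (simp add: dpart_shell[OF s0] dpart_eq[OF W_deriv] mult_ac)
        also have "\<dots> = (shell1 k s (norm x) / of_real (norm x)) * (\<Sum>b\<in>Basis. of_real (x \<bullet> b) * dW x b)"
          by (simp add: sum_distrib_left)
        also have "(\<Sum>b\<in>Basis. of_real (x \<bullet> b) * dW x b) = of_real (\<Sum>b\<in>Basis. (x \<bullet> b) * ((x - y) \<bullet> b)) * (P' (\<rho> x) / of_real (\<rho> x))"
          by (simp add: dW_def sum_distrib_right sum_divide_distrib mult.assoc)
        also have "(\<Sum>b\<in>Basis. (x \<bullet> b) * ((x - y) \<bullet> b)) = (x - y) \<bullet> x"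
          by (subst euclidean_inner) (simp add: mult.commute)
        finally have grad: "(\<Sum>b\<in>Basis. dpart b (\<lambda>x. shell k s (norm x)) x * dpart b W x)
          = (shell1 k s (norm x) / of_real (norm x)) * dW x x" by (simp add: dW_def)
        have "Dn 2 W" unfolding W_def[abs_def] \<rho>_def by (rule Dn_outgoing_cut[OF e(1)])
        from laplacian_mult[OF Dn_shell[OF s0] this, of k x] show ?thesis
          unfolding grad lap laplacian_shell[OF s0] T_def by (simp add: algebra_simps)
      qed
      have [measurable]: "shell k s \<in> borel_measurable borel" "shell1 k s \<in> borel_measurable borel" "shell2 k s \<in> borel_measurable borel"
        unfolding shell_def[abs_def] shell1_def[abs_def] shell2_def[abs_def] by measurable
      have [measurable]: "T \<in> borel_measurable borel" unfolding T_def[abs_def] \<rho>_def by measurable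
      \<comment> \<open>Y solves Y' + 2ik Y = - \<open>shell1\<close> and is supported in the shell.
        Such a compactly supported solution exists precisely because of the correction term in
        \<open>shell\<close>.\<close>
      define Y where "Y t = - (step1 (t - s) / (2 * \<i> * of_real k))" for t
      define Y' where "Y' t = - (step2 (t - s) / (2 * \<i> * of_real k))" for t
      \<comment> \<open>To leading order the divergence of x u W Q is u W (r Q' + (2ikr + 2) Q), and
        this should equal u W (\<open>shell2\<close> + 2ik \<open>shell1\<close>). The choice Q =
        \<open>shell1\<close> / r misses by \<open>shell1\<close> / r, which the second term
        cancels.\<close>
      define Q where "Q t = shell1 k s t / of_real t + Y t / of_real t ^ 2" for t
      define Q' where "Q' t = shell2 k s t / of_real t - shell1 k s t / of_real t ^ 2 + Y' t / of_real t ^ 2 - 2 * Y t / of_real t ^ 3" for t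
      have Q0: "Q t = 0" "Q' t = 0" if "t \<le> s \<or> t \<ge> s + 1" for t
        using that by (auto simp: Q_def Q'_def Y_def Y'_def shell_deriv_zero step_deriv_zero)
      have Q_deriv: "(Q has_vector_derivative Q' t) (at t)" if "t > 0" for t
      proof -
        have t: "complex_of_real t \<noteq> 0" using that by simp
        have "((\<lambda>z. inverse z) has_field_derivative - (inverse (of_real t) * inverse (of_real t))) (at (complex_of_real t))"
          using t by (auto intro!: derivative_eq_intros)
        note 1 = has_vector_derivative_real_field[OF this]
        have "((\<lambda>z. inverse z ^ 2) has_field_derivative - 2 * inverse (of_real t) ^ 3) (at (complex_of_real t))"
          using t by (auto intro!: derivative_eq_intros simp: power2_eq_square power3_eq_cube)
        note 2 = has_vector_derivative_real_field[OF this]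
        have "(Y has_vector_derivative Y' t) (at t)"
          unfolding Y_def[abs_def] Y'_def
          by (intro has_vector_derivative_minus has_vector_derivative_divide vector_derivative_shift step_deriv)
        from has_vector_derivative_add[OF has_vector_derivative_mult[OF shell_deriv(2) 1] has_vector_derivative_mult[OF this 2], of k s]
        have "((\<lambda>t. shell1 k s t * inverse (of_real t) + Y t * inverse (of_real t) ^ 2) has_vector_derivative
          shell1 k s t * - (inverse (of_real t) * inverse (of_real t)) + shell2 k s t * inverse (of_real t) +
          (Y t * (- 2 * inverse (of_real t) ^ 3) + Y' t * inverse (of_real t) ^ 2)) (at t)" .
        moreover have "(\<lambda>t. shell1 k s t * inverse (of_real t) + Y t * inverse (of_real t) ^ 2) = Q"
          by (auto simp: Q_def divide_inverse power_inverse)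
        moreover have "shell1 k s t * - (inverse (of_real t) * inverse (of_real t)) + shell2 k s t * inverse (of_real t) +
          (Y t * (- 2 * inverse (of_real t) ^ 3) + Y' t * inverse (of_real t) ^ 2) = Q' t"
          by (simp add: Q'_def divide_inverse power_inverse power2_eq_square)
        ultimately show ?thesis by simp
      qed
      define dQ where "dQ x h = of_real (x \<bullet> h) * (Q' (norm x) / of_real (norm x))" for x h :: "real^3"
      have dQ: "((\<lambda>x. Q (norm x)) has_derivative dQ x) (at x)" for x
        using has_derivative_radial[of Q Q' s 0 0 x] Q_deriv Q0 s0 by (simp add: dQ_def[abs_def])
      define f where "f x = u x * W x * Q (norm x)" for x
      \<comment> \<open>Inside the ball of radius s the function u need not be differentiable. There
        f is 0, since Q vanishes up to s, so the derivative is set to 0 by cases.\<close>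
      define f' where "f' x h = (if norm x < s then 0 else 
         (u x * W x) * dQ x h + (u x * dW x h + frechet_derivative u (at x) h * W x) * Q (norm x))" for x h
      have f_deriv: "(f has_derivative f' x) (at x)" for x
      proof (cases "norm x < s")
        case True
        have "((\<lambda>x. 0) has_derivative (\<lambda>h. 0)) (at x)" by simp
        then have "(f has_derivative (\<lambda>h. 0)) (at x)"
          by (rule has_derivative_transform_within_open[of _ _ _ UNIV "ball 0 s"])
             (use True Q0 in \<open>auto simp: f_def\<close>)
        then show ?thesis using True by (simp add: f'_def[abs_def])
      next
        case False
        then have "u differentiable (at x)" using S(2)[of x] sS by simp
        then have "(u has_derivative frechet_derivative u (at x)) (at x)" by (simp add: frechet_derivative_works)
        from has_derivative_mult[OF has_derivative_mult[OF this W_deriv] dQ]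
        show ?thesis using False by (simp add: f_def[abs_def] f'_def[abs_def])
      qed
      \<comment> \<open>The part of the commutator that is not the divergence of x f(x); the factor
        3 is the dimension. The kernel term, which comes from the region near y where
        \<open>shell\<close> is 1, is added back.\<close>
      define Rs where "Rs x = u x * T x + u x * outgoing_ker k e (\<rho> x) - (f' x x + 3 * f x)" for x
      define S' where "S' = {x :: real^3. s \<le> norm x \<and> norm x \<le> s + 1}"
      have S': "S' \<in> sets borel" "emeasure lborel S' < \<infinity>"
      proof -
        have eq: "S' = cball 0 (s + 1) - ball 0 s" by (auto simp: S'_def)
        then show "S' \<in> sets borel" by simp
        have "emeasure lborel S' \<le> emeasure lborel (cball (0::real^3) (s + 1))"
          by (rule emeasure_mono) (auto simp: eq)
        also have "\<dots> < \<infinity>" by (rule emeasure_lborel_cball_finite)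
        finally show "emeasure lborel S' < \<infinity>" .
      qed
      have est: "f' x x = 0 \<and> Rs x = 0" if "x \<notin> S'" for x
      proof (cases "norm x < s")
        case True
        then have "f' x x = 0" "f x = 0" "T x = - outgoing_ker k e (\<rho> x)"
          using Q0[of "norm x"] by (simp_all add: f'_def f_def T_def shell_eq shell_deriv_zero)
        then show ?thesis by (simp add: Rs_def)
      next
        case False
        then have n: "norm x \<ge> s + 1" using that by (auto simp: S'_def)
        have "norm x \<le> \<rho> x + norm y" unfolding \<rho>_def using norm_triangle_ineq[of "x - y" y] by simp
        then have "\<rho> x \<ge> 2 * e" using n sS e norm_ge_zero[of y] by linarith
        then have "outgoing_ker k e (\<rho> x) = 0" using far by simp
        moreover have "f' x x = 0" "f x = 0" using Q0[of "norm x"] n by (simp_all add: f'_def f_def dQ_def)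
        moreover have "T x = 0" using n \<open>outgoing_ker k e (\<rho> x) = 0\<close> by (simp add: T_def shell_deriv_zero)
        ultimately show ?thesis by (simp add: Rs_def)
      qed
      \<comment> \<open>B and K are crude bounds on u and on the radial derivative of f for this
        fixed s. Only their finiteness enters, as the domination demanded by
        \<open>dilation_integral\<close>.\<close>
      define B where "B = A * (s + 1)"
      have B: "B \<ge> 0" using A s0 by (simp add: B_def)
      define K where "K = B * 1 * (C + 2 * k * C) + 1 * 1 * (2 * C) + B * 1 * (2 * C) * L + 3 * (B * 1 * (2 * C))"
      have K: "K \<ge> 0" using B C L k by (simp add: K_def)
      have est2: "cmod (Rs x) \<le> M * \<eta> / s\<^sup>2" "cmod (f' x x) \<le> K" if xS: "x \<in> S'" for x
      proof -
        define r where "r = norm x"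
        have r: "r \<ge> s" "r \<le> s + 1" using xS by (auto simp: S'_def r_def)
        have r0: "r \<ge> 1" "r > 0" using r sS by auto
        have rc: "complex_of_real r \<noteq> 0" using r0 by simp
        have ry: "norm x \<ge> 2 * norm y + 2" using r sS e by (simp add: r_def)
        define \<sigma> where "\<sigma> = ((x - y) \<bullet> x) / \<rho> x"
        note ph = phase_estimate[OF ry, folded \<rho>_def, folded \<sigma>_def, folded r_def]
        have \<rho>0: "\<rho> x > 0" "\<rho> x \<ge> 2 * e" using ph(1) r sS e norm_ge_zero[of y] by linarith+
        define E where "E = outgoing k (\<rho> x)"
        define lm where "lm = (\<i> * of_real k - 1 / of_real (\<rho> x)) * of_real \<sigma>"
        have WE: "W x = E" and dWE: "dW x x = lm * E" and ker0: "outgoing_ker k e (\<rho> x) = 0"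
          using far[OF \<rho>0(2)] by (simp_all add: E_def dW_def lm_def \<sigma>_def)
        have E: "norm E \<le> 1 / r"
        proof -
          have "norm E = 1 / (4 * pi * \<rho> x)" using \<rho>0 by (simp add: E_def norm_outgoing)
          also have "\<dots> \<le> 1 / r"
          proof (rule divide_left_mono)
            have "r \<le> 2 * \<rho> x" using ph(1) by simp
            also have "\<dots> \<le> 4 * pi * \<rho> x" using \<rho>0 pi_gt3 by (intro mult_right_mono) auto
            finally show "r \<le> 4 * pi * \<rho> x" .
          qed (use r0 \<rho>0 in auto)
          finally show ?thesis .
        qed
        define \<mu> where "\<mu> = lm - (\<i> * of_real k * of_real r - 1)"
        have \<mu>: "norm \<mu> \<le> L / r"
        proof -
          have "\<mu> = \<i> * of_real k * of_real (\<sigma> - r) - of_real (\<sigma> / \<rho> x - 1)"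
            by (simp add: \<mu>_def lm_def algebra_simps)
          also have "norm \<dots> \<le> norm (\<i> * complex_of_real k * of_real (\<sigma> - r)) + norm (complex_of_real (\<sigma> / \<rho> x - 1))"
            by (rule norm_triangle_ineq4)
          also have "\<dots> = k * \<bar>\<sigma> - r\<bar> + \<bar>\<sigma> / \<rho> x - 1\<bar>"
            using k by (simp only: norm_mult norm_of_real norm_ii)
          also have "\<dots> \<le> k * ((norm y)\<^sup>2 / r) + 2 * norm y / r"
            using ph k by (intro add_mono mult_left_mono) auto
          also have "\<dots> = L / r" using r0 by (simp add: L_def field_simps)
          finally show ?thesis .
        qed
        define D where "D = frechet_derivative u (at x) x - \<i> * of_real k * of_real r * u x"
        have D: "norm D \<le> \<eta>" using S(3)[of x] r sS by (simp add: D_def r_def)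
        define X1 where "X1 = shell1 k s r"
        define X2 where "X2 = shell2 k s r"
        have Q: "norm (Q r) \<le> 2 * C / r"
        proof -
          have "norm (Q r) \<le> norm (X1 / of_real r) + norm (Y r / of_real r ^ 2)"
            unfolding Q_def X1_def by (rule norm_triangle_ineq)
          also have "\<dots> = norm X1 / r + norm (Y r) / r\<^sup>2"
            using r0 by (simp add: norm_divide norm_power)
          also have "\<dots> \<le> C / r + C / r"
          proof (intro add_mono frac_le divide_right_mono)
            show "r \<le> r\<^sup>2" using r0 by (simp add: power2_eq_square)
            show "norm (Y r) \<le> C" using C(4) by (simp add: Y_def del: norm_divide)
          qed (use C r0 in \<open>auto simp: X1_def\<close>)
          finally show ?thesis by simp
        qed
        have fx: "f x = u x * E * Q r" by (simp add: f_def WE r_def)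
        have dQx: "dQ x x = of_real r * Q' r"
          using r0 by (simp add: dQ_def r_def power2_norm_eq_inner[symmetric] power2_eq_square)
        have f'x: "f' x x = u x * E * (of_real r * Q' r) + (u x * (lm * E) + (D + \<i> * of_real k * of_real r * u x) * E) * Q r"
          using r by (simp add: f'_def WE dWE dQx D_def r_def)
        \<comment> \<open>The equation that Q was built for. In the coefficient 2ikr + 2, the number
          2 is the dimension 3 minus the 1 from the decay 1/r of W; u and W contribute ikr
          each.\<close>
        have shell2: "of_real r * Q' r + (2 * \<i> * of_real k * of_real r + 2) * Q r = X2 + 2 * \<i> * of_real k * X1"
        proof -
          have "X1 = - (Y' r + 2 * \<i> * of_real k * Y r)"
            using k by (simp add: X1_def shell1_def Y_def Y'_def field_simps)
          moreover have "of_real r * Q' r + (2 * \<i> * of_real k * of_real r + 2) * Q r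
             = X2 + 2 * \<i> * of_real k * X1 + (X1 + (Y' r + 2 * \<i> * of_real k * Y r)) / of_real r"
            using rc unfolding Q_def Q'_def X1_def X2_def
            by (simp add: power2_eq_square power3_eq_cube field_simps)
          ultimately show ?thesis by simp
        qed
        have div: "f' x x + 3 * f x = u x * E * (X2 + 2 * \<i> * of_real k * X1) + D * E * Q r + u x * E * Q r * \<mu>"
        proof -
          have "f' x x + 3 * f x = u x * E * (of_real r * Q' r + (2 * \<i> * of_real k * of_real r + 2) * Q r) + D * E * Q r + u x * E * Q r * \<mu>"
            unfolding f'x fx \<mu>_def by (simp add: algebra_simps)
          then show ?thesis by (simp add: shell2)
        qed
        \<comment> \<open>The term 2 \<open>shell1\<close> / r of the radial Laplacian cancels
          against the -1 in ikr - 1, so that only the two leading terms and a multiple of \<mu>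
          survive.\<close>
        have Tx: "T x = E * (X2 + 2 * \<i> * of_real k * X1) + 2 * E * X1 * \<mu> / of_real r"
          using rc unfolding T_def WE dWE ker0 \<mu>_def
          by (simp add: X1_def[symmetric] X2_def[symmetric] r_def[symmetric] field_simps)
        have Rx: "Rs x = 2 * u x * E * X1 * \<mu> / of_real r - D * E * Q r - u x * E * Q r * \<mu>"
          unfolding Rs_def div Tx ker0 by (simp add: algebra_simps)
        \<comment> \<open>u is not small, but u / r is at most a multiple of \<eta> on the shell. In
          the first and third error terms this gain meets the further decay 1 / r^2 from the
          remaining factors.\<close>
        have ux: "norm (u x) \<le> A * r * \<eta>"
        proof -
          have "norm (u x) \<le> A * sqrt r" using A(3)[of x] r sS by (simp add: r_def)
          also have "sqrt r \<le> r * \<eta>"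
          proof -
            have "1 / \<eta>\<^sup>2 \<le> r" using r sS by linarith
            then have "1 \<le> r * \<eta>\<^sup>2" using \<eta> by (simp add: field_simps)
            then have "r * 1 \<le> r * (r * \<eta>\<^sup>2)" using r0 by (intro mult_left_mono) auto
            then have "r \<le> (r * \<eta>)\<^sup>2" by (simp add: power2_eq_square algebra_simps)
            then show ?thesis using r0 \<eta> by (intro real_le_lsqrt) auto
          qed
          finally show ?thesis using A by (simp add: mult.assoc)
        qed
        have X1: "norm X1 \<le> C" using C by (simp add: X1_def)
        have b1: "norm (2 * u x * E * X1 * \<mu> / of_real r) \<le> 2 * (A * r * \<eta>) * (1 / r) * C * (L / r) / r"
          using ux E X1 \<mu> r0 A C L \<eta>
          by (auto simp only: norm_mult norm_divide norm_of_real norm_numeral abs_of_pos intro!: divide_right_mono mult_mono mult_nonneg_nonneg norm_ge_zero)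
             auto
        have b2: "norm (D * E * Q r) \<le> \<eta> * (1 / r) * (2 * C / r)"
          unfolding norm_mult using D E Q \<eta> r0 C by (intro mult_mono mult_nonneg_nonneg norm_ge_zero) auto
        have b3: "norm (u x * E * Q r * \<mu>) \<le> (A * r * \<eta>) * (1 / r) * (2 * C / r) * (L / r)"
          unfolding norm_mult using ux E Q \<mu> r0 A C L \<eta> by (intro mult_mono mult_nonneg_nonneg norm_ge_zero) auto
        have "norm (Rs x) \<le> norm (2 * u x * E * X1 * \<mu> / of_real r) + norm (D * E * Q r) + norm (u x * E * Q r * \<mu>)"
          unfolding Rx by (meson norm_triangle_ineq4 order_trans add_right_mono)
        also have "\<dots> \<le> 2 * (A * r * \<eta>) * (1 / r) * C * (L / r) / r + \<eta> * (1 / r) * (2 * C / r) + (A * r * \<eta>) * (1 / r) * (2 * C / r) * (L / r)"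
          using b1 b2 b3 by (intro add_mono)
        also have "\<dots> = M * \<eta> / r\<^sup>2"
          using r0 by (simp add: M_def field_simps power2_eq_square)
        also have "\<dots> \<le> M * \<eta> / s\<^sup>2"
          using r s0 M \<eta> by (intro divide_left_mono power_mono mult_nonneg_nonneg) auto
        finally show "cmod (Rs x) \<le> M * \<eta> / s\<^sup>2" .
        have uB: "norm (u x) \<le> B"
        proof -
          have "A * r * \<eta> \<le> A * (s + 1) * 1" using A r0 r \<eta> by (intro mult_mono mult_nonneg_nonneg) auto
          then show ?thesis using ux by (simp add: B_def)
        qed
        have r1: "c / r \<le> c" if "c \<ge> 0" for c
          using that r0 by (simp add: divide_le_eq mult_le_cancel_left1)
        have E1: "norm E \<le> 1" using E r1[of 1] by simp
        have Q1: "norm (Q r) \<le> 2 * C" using Q r1[of "2 * C"] C by simp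
        have \<mu>1: "norm \<mu> \<le> L" using \<mu> r1[OF L] by simp
        have D1: "norm D \<le> 1" using D \<eta> by simp
        have X12: "norm (X2 + 2 * \<i> * of_real k * X1) \<le> C + 2 * k * C"
          using C(2,3) k by (intro norm_triangle_mono) (auto simp: norm_mult X1_def X2_def intro!: mult_left_mono)
        have "f' x x = u x * E * (X2 + 2 * \<i> * of_real k * X1) + D * E * Q r + u x * E * Q r * \<mu> - 3 * f x"
          using div by (simp add: algebra_simps)
        also have "norm \<dots> \<le> norm (u x * E * (X2 + 2 * \<i> * of_real k * X1)) + norm (D * E * Q r) + norm (u x * E * Q r * \<mu>) + norm (3 * f x)"
          by (intro order_trans[OF norm_triangle_ineq4] add_right_mono order_trans[OF norm_triangle_ineq] order_refl)
        also have "\<dots> \<le> K"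
          unfolding K_def fx norm_mult using uB E1 Q1 \<mu>1 D1 X12 B C L k
          by (intro add_mono mult_mono mult_nonneg_nonneg norm_ge_zero) auto
        finally show "cmod (f' x x) \<le> K" .
      qed
      have supp: "f x = 0" if "norm x > s + 1" for x using that Q0[of "norm x"] by (simp add: f_def)
      have bd: "norm (f' x x) \<le> K" for x using est[of x] est2(2)[of x] K by (cases "x \<in> S'") auto
      note dil = dilation_integral[OF f_deriv supp bd]
      \<comment> \<open>The integral of the divergence of x f(x). The dominant part of the
        commutator disappears here instead of being estimated.\<close>
      have zero: "(\<integral>x. f' x x + 3 * f x \<partial>lborel) = 0"
        using dil by (simp add: integral_add)
      have [measurable]: "(\<lambda>x. f' x x) \<in> borel_measurable borel" "f \<in> borel_measurable borel"
        using dil(1,2)[THEN borel_measurable_integrable] by simp_all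
      have [measurable]: "Rs \<in> borel_measurable borel" unfolding Rs_def[abs_def] \<rho>_def by measurable
      have indS: "integrable lborel (\<lambda>x. (M * \<eta> / s\<^sup>2) * indicator S' x :: real)"
        using S' by (intro integrable_mult_right integrable_real_indicator) auto
      have Rb: "norm (Rs x) \<le> (M * \<eta> / s\<^sup>2) * indicator S' x" for x
        using est[of x] est2(1)[of x] by (cases "x \<in> S'") auto
      have Ri: "integrable lborel Rs"
        by (rule Bochner_Integration.integrable_bound[OF indS]) (use Rb M \<eta> in \<open>auto intro!: always_eventually simp: abs_mult abs_of_nonneg\<close>)
      have ki: "integrable lborel (\<lambda>x. u x * outgoing_ker k e (\<rho> x))"
        unfolding \<rho>_def by (rule integrable_mult_outgoing_ker[OF u(1) e])
      have uT: "u x * T x = Rs x - u x * outgoing_ker k e (\<rho> x) + (f' x x + 3 * f x)" for x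
        by (simp add: Rs_def)
      have "(\<integral>x. u x * T x \<partial>lborel) = (\<integral>x. Rs x \<partial>lborel) - (\<integral>x. u x * outgoing_ker k e (\<rho> x) \<partial>lborel) + (\<integral>x. f' x x + 3 * f x \<partial>lborel)"
        unfolding uT using Ri ki dil(1,2) by (simp add: integral_add integral_diff)
      then have "(\<integral>x. u x * T x \<partial>lborel) + (\<integral>x. u x * outgoing_ker k e (\<rho> x) \<partial>lborel) = (\<integral>x. Rs x \<partial>lborel)"
        by (simp add: zero)
      also have "cmod \<dots> \<le> (\<integral>x. (M * \<eta> / s\<^sup>2) * indicator S' x \<partial>lborel)"
        by (rule Bochner_Integration.integral_norm_bound_integral[OF Ri indS Rb])
      also have "\<dots> = (M * \<eta> / s\<^sup>2) * measure lborel S'"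
        using S' by simp
      also have "\<dots> \<le> (M * \<eta> / s\<^sup>2) * (30 * s\<^sup>2)"
        using measure_shell[OF sS(3)] M \<eta> by (intro mult_left_mono) (auto simp: S'_def)
      also have "\<dots> = 30 * M * \<eta>" using s0 by simp
      finally show "cmod ((\<integral>x. u x * (laplacian3 (\<lambda>x. shell k s (norm x) * W x) x + of_real (k\<^sup>2) * (shell k s (norm x) * W x)) \<partial>lborel)
        + (\<integral>x. u x * outgoing_ker k e (\<rho> x) \<partial>lborel)) \<le> 30 * M * \<eta>"
        unfolding T .
    qed
  qed
  show thesis
    by (rule that[of "30 * M"]) (use M main in \<open>auto simp: W_def \<rho>_def\<close>)
qed


text \<open>\<open>shell\<close> times \<open>outgoing_cut\<close> is smooth with bounded support,
  hence an admissible test function, and for s \<ge> r it agrees with \<open>outgoing_cut\<close> on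
  the support of g. The equation then reads -J up to the commutator error, which is at most a
  multiple of every \<eta>; so I and J coincide. No limit in s has to be taken in the
  integrals.\<close>

lemma convolution_representation:
  assumes k: "k > 0" and e: "0 < e" "e \<le> 1" and u: "helmholtz_weak k g u" "sommerfeld k u"
    and g: "\<And>x. norm x \<ge> r \<Longrightarrow> g x = 0"
  shows "(\<integral>x. u x * outgoing_ker k e (norm (x - y)) \<partial>lborel) = (\<integral>x. g x * outgoing_cut k e (norm (x - y)) \<partial>lborel)"
    (is "?I = ?J")
proof -
  have loc: "loc_int3 u" using u(1) by (simp add: helmholtz_weak_def)
  obtain M where M: "M \<ge> 0" "\<And>\<eta>. 0 < \<eta> \<Longrightarrow> \<eta> \<le> 1 \<Longrightarrow> \<exists>s0. \<forall>s\<ge>s0.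
    cmod (\<integral>x. u x * (laplacian3 (\<lambda>x. shell k s (norm x) * outgoing_cut k e (norm (x - y))) x
             + of_real (k\<^sup>2) * (shell k s (norm x) * outgoing_cut k e (norm (x - y)))) \<partial>lborel + ?I) \<le> M * \<eta>"
    using commutator_bound[OF k e loc u(2), of y] by blast
  have *: "cmod (?I - ?J) \<le> M * \<eta>" if \<eta>: "0 < \<eta>" "\<eta> \<le> 1" for \<eta>
  proof -
    obtain s0 where s0: "\<And>s. s \<ge> s0 \<Longrightarrow> cmod (\<integral>x. u x * (laplacian3 (\<lambda>x. shell k s (norm x) * outgoing_cut k e (norm (x - y))) x
             + of_real (k\<^sup>2) * (shell k s (norm x) * outgoing_cut k e (norm (x - y)))) \<partial>lborel + ?I) \<le> M * \<eta>"
      using M(2)[OF \<eta>] by blast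
    define s where "s = max s0 (max 1 r)"
    have s: "s \<ge> s0" "s > 0" "s \<ge> r" by (auto simp: s_def)
    define \<phi> where "\<phi> x = shell k s (norm x) * outgoing_cut k e (norm (x - y))" for x
    have "test_fun3 \<phi>"
      unfolding test_fun3_def smooth3_iff_Dn
    proof (intro conjI allI)
      show "Dn n \<phi>" for n unfolding \<phi>_def[abs_def] by (intro Dn_mult Dn_shell Dn_outgoing_cut s e)
      have "{x. \<phi> x \<noteq> 0} \<subseteq> cball 0 (s + 1)"
      proof
        fix x assume "x \<in> {x. \<phi> x \<noteq> 0}"
        then show "x \<in> cball 0 (s + 1)"
          using shell_eq(2)[of s "norm x" k] by (cases "s + 1 \<le> norm x") (auto simp: \<phi>_def)
      qed
      then show "bounded {x. \<phi> x \<noteq> 0}" using bounded_cball bounded_subset by blast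
    qed
    with u(1) have "(\<integral>x. u x * (laplacian3 \<phi> x + of_real (k\<^sup>2) * \<phi> x) \<partial>lborel) = - (\<integral>x. g x * \<phi> x \<partial>lborel)"
      by (simp add: helmholtz_weak_def)
    also have "(\<integral>x. g x * \<phi> x \<partial>lborel) = ?J"
    proof (rule Bochner_Integration.integral_cong)
      show "g x * \<phi> x = g x * outgoing_cut k e (norm (x - y))" for x
        using g[of x] s shell_eq(1)[of "norm x" s k] by (cases "norm x \<ge> r") (auto simp: \<phi>_def)
    qed simp
    finally have "cmod (- ?J + ?I) \<le> M * \<eta>"
      using s0[OF s(1)] by (simp add: \<phi>_def[abs_def])
    then show ?thesis by (simp add: algebra_simps)
  qed
  have "cmod (?I - ?J) \<le> 0"
  proof (rule tendsto_lowerbound[of "\<lambda>n. M * inverse (real (Suc n))" _ sequentially])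
    have "(\<lambda>n. M * inverse (real (Suc n))) \<longlonglongrightarrow> M * 0"
      by (intro tendsto_intros LIMSEQ_inverse_real_of_nat)
    then show "(\<lambda>n. M * inverse (real (Suc n))) \<longlonglongrightarrow> 0" by simp
    show "\<forall>\<^sub>F n in sequentially. cmod (?I - ?J) \<le> M * inverse (real (Suc n))"
      by (intro always_eventually allI *) (auto simp: field_simps)
  qed simp
  then show ?thesis by simp
qed

section \<open>The partial Fourier transform of a test function\<close>

text \<open>The translation analogue of \<open>dilation_integral\<close>: the difference quotients
  in direction v integrate to 0 by translation invariance, and they are dominated through the bound
  on the directional derivative.\<close>

lemma integral_directional_derivative_eq_0:
  fixes f :: "'a::euclidean_space \<Rightarrow> complex"
  assumes diff: "\<And>x. (f has_derivative f' x) (at x)"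
    and supp: "\<And>x. norm x > M \<Longrightarrow> f x = 0"
    and bd: "\<And>x. norm (f' x v) \<le> C"
  shows "(\<integral>x. f' x v \<partial>lborel) = 0"
proof -
  have cont: "continuous_on UNIV f"
    using diff by (intro has_derivative_continuous_on) (auto intro: has_derivative_at_withinI)
  have [measurable]: "f \<in> borel_measurable borel"
    using cont by (rule borel_measurable_continuous_onI)
  have C0: "C \<ge> 0" using bd[of 0] norm_ge_zero order_trans by blast
  define h where "h n = inverse (real (Suc n))" for n
  have h: "h n > 0" "h n \<le> 1" for n by (auto simp: h_def field_simps)
  define g where "g n x = real (Suc n) *\<^sub>R (f (h n *\<^sub>R v + x) - f x)" for n x
  have [measurable]: "g n \<in> borel_measurable borel" for n
    unfolding g_def by measurable
  have path: "((\<lambda>t. f (t *\<^sub>R v + x)) has_vector_derivative f' (t *\<^sub>R v + x) v) (at t)" for x t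
  proof -
    have "((\<lambda>t. f (t *\<^sub>R v + x)) has_derivative (\<lambda>h. f' (t *\<^sub>R v + x) (h *\<^sub>R v))) (at t)"
      by (rule has_derivative_compose[where g = f and f = "\<lambda>t. t *\<^sub>R v + x" and f' = "\<lambda>h. h *\<^sub>R v"])
         (use diff in \<open>auto intro!: derivative_eq_intros\<close>)
    moreover have "linear (f' (t *\<^sub>R v + x))" using diff has_derivative_linear by blast
    ultimately show ?thesis
      by (simp add: has_vector_derivative_def linear_scale)
  qed
  have lim: "(\<lambda>n. g n x) \<longlonglongrightarrow> f' x v" for x
  proof -
    have "((\<lambda>t. f (t *\<^sub>R v + x)) has_vector_derivative f' x v) (at 0)" using path[of x 0] by simp
    then have "((\<lambda>t. norm (f (t *\<^sub>R v + x) - f x - t *\<^sub>R f' x v) / norm t) \<longlongrightarrow> 0) (at 0)"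
      by (simp add: has_vector_derivative_def has_derivative_at algebra_simps)
    moreover have "filterlim h (at 0) sequentially"
      unfolding h_def[abs_def] by (rule filterlim_atI[OF LIMSEQ_inverse_real_of_nat]) auto
    ultimately have "(\<lambda>n. norm (f (h n *\<^sub>R v + x) - f x - h n *\<^sub>R f' x v) / norm (h n)) \<longlonglongrightarrow> 0"
      by (rule filterlim_compose)
    moreover have "norm (f (h n *\<^sub>R v + x) - f x - h n *\<^sub>R f' x v) / norm (h n) = norm (g n x - f' x v)" for n
    proof -
      have "g n x - f' x v = real (Suc n) *\<^sub>R (f (h n *\<^sub>R v + x) - f x - h n *\<^sub>R f' x v)"
        by (simp add: g_def h_def scaleR_diff_right)
      then show ?thesis by (simp add: divide_inverse h_def)
    qed
    ultimately have "(\<lambda>n. norm (g n x - f' x v)) \<longlonglongrightarrow> 0" by simp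
    then have "(\<lambda>n. g n x - f' x v) \<longlonglongrightarrow> 0" by (simp add: tendsto_norm_zero_iff)
    then show ?thesis by (simp add: LIM_zero_iff)
  qed
  \<comment> \<open>All step lengths are at most 1, so a translated support stays in the ball of
    radius M + |v|.\<close>
  have gb: "norm (g n x) \<le> C * indicator (cball 0 (M + norm v)) x" for n x
  proof (cases "norm x \<le> M + norm v")
    case False
    have "norm x \<le> norm (h n *\<^sub>R v + x) + norm (h n *\<^sub>R v)"
      using norm_triangle_ineq4[of "h n *\<^sub>R v + x" "h n *\<^sub>R v"] by simp
    also have "norm (h n *\<^sub>R v) \<le> norm v" using h[of n] mult_right_mono[of "h n" 1 "norm v"] by simp
    finally have "norm (h n *\<^sub>R v + x) > M" "norm x > M" using False norm_ge_zero[of v] by linarith+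
    then show ?thesis using False supp by (simp add: g_def)
  next
    case True
    have "norm (f (h n *\<^sub>R v + x) - f (0 *\<^sub>R v + x)) \<le> C * h n - C * 0"
    proof (rule differentiable_bound_general[of 0 "h n" "\<lambda>t. f (t *\<^sub>R v + x)" "\<lambda>t. C * t" "\<lambda>t. f' (t *\<^sub>R v + x) v" "\<lambda>t. C"])
      show "continuous_on {0..h n} (\<lambda>t. f (t *\<^sub>R v + x))"
        by (intro continuous_intros continuous_on_compose2[OF cont]) auto
    qed (use h bd in \<open>auto intro!: continuous_intros derivative_eq_intros path\<close>)
    then have "real (Suc n) * norm (f (h n *\<^sub>R v + x) - f x) \<le> real (Suc n) * (C * h n)" 
      by (intro mult_left_mono) auto
    also have "\<dots> = C" by (simp add: h_def)
    finally show ?thesis using True by (simp add: g_def)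
  qed
  have ind: "integrable lborel (\<lambda>x::'a. C * indicator (cball 0 (M + norm v)) x)"
    by (intro integrable_mult_right integrable_real_indicator) (use emeasure_lborel_cball_finite in auto)
  have [measurable]: "(\<lambda>x. f' x v) \<in> borel_measurable lborel"
    by (rule borel_measurable_LIMSEQ_metric[OF _ lim]) auto
  have dc: "(\<lambda>n. \<integral>x. g n x \<partial>lborel) \<longlonglongrightarrow> (\<integral>x. f' x v \<partial>lborel)"
    by (rule integral_dominated_convergence[OF _ _ ind]) (use gb lim in auto)
  have fint: "integrable lborel f"
    by (rule integrable_continuous_bounded_support[OF cont supp])
  have "(\<integral>x. g n x \<partial>lborel) = 0" for n
  proof -
    have "lborel = distr lborel borel ((+) (h n *\<^sub>R v))" using lborel_distr_plus[of "h n *\<^sub>R v"] by simp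
    then have "(\<integral>x. f (h n *\<^sub>R v + x) \<partial>lborel) = (\<integral>x. f x \<partial>lborel)" "integrable lborel (\<lambda>x. f (h n *\<^sub>R v + x))"
      using integral_distr[of "(+) (h n *\<^sub>R v)" lborel borel f] integrable_distr_eq[of "(+) (h n *\<^sub>R v)" lborel borel f] fint by simp_all
    then show ?thesis using fint by (simp add: g_def)
  qed
  with dc show ?thesis by (simp add: LIMSEQ_const_iff)
qed

lemma test_fun3_dpart: "test_fun3 \<phi> \<Longrightarrow> b \<in> Basis \<Longrightarrow> test_fun3 (dpart b \<phi>)"
  unfolding test_fun3_def
proof (intro conjI)
  assume a: "smooth3 \<phi> \<and> bounded {x. \<phi> x \<noteq> 0}" "b \<in> Basis"
  then show "smooth3 (dpart b \<phi>)" by (auto intro: smooth3_dpart)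
  have "{x. dpart b \<phi> x \<noteq> 0} \<subseteq> closure {x. \<phi> x \<noteq> 0}"
  proof (rule ccontr)
    assume "\<not> ?thesis"
    then obtain x where x: "dpart b \<phi> x \<noteq> 0" "x \<in> - closure {x. \<phi> x \<noteq> 0}" by auto
    have "((\<lambda>_. 0) has_derivative (\<lambda>_. 0)) (at x)" by simp
    then have "(\<phi> has_derivative (\<lambda>_. 0)) (at x)"
      by (rule has_derivative_transform_within_open[of _ _ _ UNIV "- closure {x. \<phi> x \<noteq> 0}"])
         (use x closure_subset[of "{x. \<phi> x \<noteq> 0}"] in auto)
    from dpart_eq[OF this] x show False by simp
  qed
  with a show "bounded {x. dpart b \<phi> x \<noteq> 0}" using bounded_closure bounded_subset by blast
qed

lemma test_fun3_continuous: "test_fun3 \<phi> \<Longrightarrow> continuous_on A \<phi>"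
  unfolding test_fun3_def using smooth3_has_derivative
  by (meson continuous_at_imp_continuous_on has_derivative_continuous)

lemma test_fun3_bounds:
  assumes "test_fun3 \<phi>"
  obtains B M where "B > 0" "M > 0" "\<And>x. norm (\<phi> x) \<le> B" "\<And>x. norm x > M \<Longrightarrow> \<phi> x = 0"
proof -
  obtain M where M: "M > 0" "\<And>x. \<phi> x \<noteq> 0 \<Longrightarrow> norm x \<le> M"
    using assms unfolding test_fun3_def bounded_pos by auto
  have "compact (\<phi> ` cball 0 M)" by (intro compact_continuous_image test_fun3_continuous[OF assms]) auto
  then obtain K where K: "\<forall>z\<in>\<phi> ` cball 0 M. norm z \<le> K"
    using compact_imp_bounded bounded_iff by metis
  show thesis
  proof (rule that[of "\<bar>K\<bar> + 1" M])
    show "norm (\<phi> x) \<le> \<bar>K\<bar> + 1" for x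
    proof (cases "\<phi> x = 0")
      case False
      then have "norm (\<phi> x) \<le> K" using M(2) K by auto
      then show ?thesis by simp
    qed simp
  qed (use M in \<open>auto simp: not_le[symmetric]\<close>)
qed

section \<open>Splitting space into a plane and a height, and slices of test functions\<close>

definition vec3 :: "real \<times> real \<Rightarrow> real \<Rightarrow> real^3" where
  "vec3 p c = vector [fst p, snd p, c]"

lemma vec3_nth [simp]: "vec3 p c $ 1 = fst p" "vec3 p c $ 2 = snd p" "vec3 p c $ 3 = c"
  by (simp_all add: vec3_def)

lemma vec3_eq: "vec3 p c = fst p *\<^sub>R axis 1 1 + snd p *\<^sub>R axis 2 1 + c *\<^sub>R axis 3 1"
  by (simp add: vec_eq_iff forall_3 axis_def)

lemma norm_vec3: "norm (vec3 p c) = sqrt ((norm p)\<^sup>2 + c\<^sup>2)"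
  by (simp add: norm_vec_def L2_set_def sum_3 norm_prod_def)

lemma continuous_on_vec3 [continuous_intros]:
  "continuous_on A f \<Longrightarrow> continuous_on A g \<Longrightarrow> continuous_on A (\<lambda>x. vec3 (f x) (g x))"
  unfolding vec3_eq by (intro continuous_intros)

lemma norm_le_norm_vec3: "norm p \<le> norm (vec3 p c)" "\<bar>c\<bar> \<le> norm (vec3 p c)"
  by (auto simp: norm_vec3 intro!: real_le_rsqrt)

lemma measurable_test_fun3: "test_fun3 \<phi> \<Longrightarrow> \<phi> \<in> borel_measurable borel"
  using test_fun3_continuous by (intro borel_measurable_continuous_onI)

lemma measurable_vec3 [measurable (raw)]:
  assumes f: "f \<in> borel_measurable M" and [measurable]: "g \<in> borel_measurable M"
  shows "(\<lambda>x. vec3 (f x) (g x)) \<in> borel_measurable M"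
proof -
  have [measurable]: "(\<lambda>x. fst (f x)) \<in> borel_measurable M" "(\<lambda>x. snd (f x)) \<in> borel_measurable M"
    by (intro borel_measurable_continuous_on[OF _ f] continuous_intros)+
  show ?thesis unfolding vec3_eq
    by (intro borel_measurable_add borel_measurable_scaleR) measurable
qed

definition osc12 :: "real \<times> real \<Rightarrow> real \<times> real \<Rightarrow> complex" where
  "osc12 p q = exp (- \<i> * complex_of_real (fst p * fst q + snd p * snd q))"

lemma norm_osc12 [simp]: "norm (osc12 p q) = 1"
  by (simp add: osc12_def norm_exp_eq_Re)

lemma measurable_osc12 [measurable (raw)]:
  assumes f: "f \<in> borel_measurable M" and g: "g \<in> borel_measurable M"
  shows "(\<lambda>x. osc12 (f x) (g x)) \<in> borel_measurable M"
proof -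
  have [measurable]: "(\<lambda>x. fst (f x)) \<in> borel_measurable M" "(\<lambda>x. snd (f x)) \<in> borel_measurable M"
    "(\<lambda>x. fst (g x)) \<in> borel_measurable M" "(\<lambda>x. snd (g x)) \<in> borel_measurable M"
    by (intro borel_measurable_continuous_on[OF _ f] borel_measurable_continuous_on[OF _ g] continuous_intros)+
  show ?thesis unfolding osc12_def by measurable
qed

lemma fourier12_vec3:
  "fourier12 \<phi> (vec3 q c) = of_real (1 / (2 * pi)) * (\<integral>k. \<phi> (vec3 k c) * osc12 k q \<partial>lborel)"
  by (simp add: fourier12_def osc12_def vec3_def powr_minus_divide)

lemma vec3_surj: "x = vec3 (x $ 1, x $ 2) (x $ 3)"
  by (simp add: vec_eq_iff forall_3)

lemma test_fun3_slice:
  assumes "test_fun3 \<phi>"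
  obtains B M where "B > 0" "M > 0" "\<And>k c q. norm (\<phi> (vec3 k c) * osc12 k q) \<le> B * indicator (cball 0 M) k"
    "\<And>k c. \<bar>c\<bar> > M \<Longrightarrow> \<phi> (vec3 k c) = 0"
proof -
  obtain B M where B: "B > 0" "M > 0" "\<And>x. norm (\<phi> x) \<le> B" "\<And>x. norm x > M \<Longrightarrow> \<phi> x = 0"
    using test_fun3_bounds[OF assms] by metis
  show thesis
  proof (rule that[OF B(1,2)])
    show "norm (\<phi> (vec3 k c) * osc12 k q) \<le> B * indicator (cball 0 M) k" for k c q
      using B(1) B(3,4)[of "vec3 k c"] norm_le_norm_vec3(1)[of k c]
      by (cases "norm k \<le> M") (auto simp: norm_mult)
    show "\<phi> (vec3 k c) = 0" if "\<bar>c\<bar> > M" for k c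
      using B(4)[of "vec3 k c"] norm_le_norm_vec3(2)[of c k] that by simp
  qed
qed

lemma integrable_indicator_cball: "integrable lborel (\<lambda>x::'a::euclidean_space. B * indicator (cball 0 M) x :: real)"
  by (intro integrable_mult_right integrable_real_indicator) (use emeasure_lborel_cball_finite in auto)

lemma integrable_test_fun3_slice:
  assumes "test_fun3 \<phi>"
  shows "integrable lborel (\<lambda>k. \<phi> (vec3 k c) * osc12 k q)"
proof -
  obtain B M where B: "B > 0" "\<And>k c q. norm (\<phi> (vec3 k c) * osc12 k q) \<le> B * indicator (cball 0 M) k"
    using test_fun3_slice[OF assms] by metis
  note [measurable] = measurable_test_fun3[OF assms]
  show ?thesis
    by (rule Bochner_Integration.integrable_bound[OF integrable_indicator_cball[of B M]])
       (measurable, use B in \<open>auto intro!: always_eventually simp: abs_mult\<close>)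
qed

section \<open>Boundedness, support, continuity and decay of the partial transform\<close>

lemma fourier12_bounded:
  assumes "test_fun3 \<phi>"
  obtains C where "\<And>x. norm (fourier12 \<phi> x) \<le> C"
proof -
  obtain B M where B: "B > 0" "\<And>k c q. norm (\<phi> (vec3 k c) * osc12 k q) \<le> B * indicator (cball 0 M) k"
    using test_fun3_slice[OF assms] by metis
  show thesis
  proof (rule that)
    fix x :: "real^3"
    have "norm (\<integral>k. \<phi> (vec3 k (x $ 3)) * osc12 k (x $ 1, x $ 2) \<partial>lborel) \<le> (\<integral>k. B * indicator (cball 0 M) (k :: real \<times> real) \<partial>lborel)"
      by (rule Bochner_Integration.integral_norm_bound_integral[OF integrable_test_fun3_slice[OF assms] integrable_indicator_cball B(2)])
    then show "norm (fourier12 \<phi> x) \<le> (1 / (2 * pi)) * (\<integral>k. B * indicator (cball 0 M) (k :: real \<times> real) \<partial>lborel)"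
      by (subst vec3_surj[of x]) (simp add: fourier12_vec3 norm_mult norm_divide divide_right_mono)
  qed
qed

lemma fourier12_support:
  assumes "test_fun3 \<phi>"
  obtains M where "M > 0" "\<And>x. \<bar>x $ 3\<bar> > M \<Longrightarrow> fourier12 \<phi> x = 0"
proof -
  obtain B M where B: "M > 0" "\<And>k c. \<bar>c\<bar> > M \<Longrightarrow> \<phi> (vec3 k c) = 0"
    using test_fun3_slice[OF assms] by metis
  show thesis
  proof (rule that[OF B(1)])
    show "fourier12 \<phi> x = 0" if "\<bar>x $ 3\<bar> > M" for x
      by (subst vec3_surj[of x]) (simp add: fourier12_vec3 B(2)[OF that])
  qed
qed

lemma continuous_fourier12:
  assumes "test_fun3 \<phi>"
  shows "continuous_on A (fourier12 \<phi>)"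
proof -
  obtain B M where B: "B > 0" "\<And>k c q. norm (\<phi> (vec3 k c) * osc12 k q) \<le> B * indicator (cball 0 M) k"
    using test_fun3_slice[OF assms] by metis
  note [measurable] = measurable_test_fun3[OF assms]
  have cont: "continuous_on UNIV (\<lambda>x::real^3. \<phi> (vec3 k (x $ 3)) * osc12 k (x $ 1, x $ 2))" for k
    unfolding osc12_def by (intro continuous_intros continuous_on_compose2[OF test_fun3_continuous[OF assms, of UNIV]]) auto
  have "isCont (\<lambda>x. \<integral>k. \<phi> (vec3 k (x $ 3)) * osc12 k (x $ 1, x $ 2) \<partial>lborel) x" for x :: "real^3"
    unfolding continuous_at_sequentially comp_def
  proof (intro allI impI)
    fix X assume X: "X \<longlonglongrightarrow> x"
    show "(\<lambda>n. \<integral>k. \<phi> (vec3 k (X n $ 3)) * osc12 k (X n $ 1, X n $ 2) \<partial>lborel) \<longlonglongrightarrow> (\<integral>k. \<phi> (vec3 k (x $ 3)) * osc12 k (x $ 1, x $ 2) \<partial>lborel)"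
    proof (rule integral_dominated_convergence[OF _ _ integrable_indicator_cball[of B M]])
      show "AE k in lborel. (\<lambda>n. \<phi> (vec3 k (X n $ 3)) * osc12 k (X n $ 1, X n $ 2)) \<longlonglongrightarrow> \<phi> (vec3 k (x $ 3)) * osc12 k (x $ 1, x $ 2)"
        using continuous_on_tendsto_compose[OF cont X] by (intro always_eventually) auto
    qed (use B in \<open>measurable, auto\<close>)
  qed
  moreover have "fourier12 \<phi> = (\<lambda>x. of_real (1 / (2 * pi)) * (\<integral>k. \<phi> (vec3 k (x $ 3)) * osc12 k (x $ 1, x $ 2) \<partial>lborel))"
    by (rule ext, subst vec3_surj) (simp only: fourier12_vec3 vec3_nth fst_conv snd_conv prod.collapse)
  ultimately show ?thesis
    by (auto intro!: continuous_at_imp_continuous_on continuous_intros)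
qed

text \<open>Integration by parts: the derivative of \<open>\<phi>\<close> times the oscillation
  along a plane direction integrates to 0 over the slice. Only the first two variables are
  transformed, so only these derivatives become multiplications.\<close>

lemma fourier12_dpart:
  assumes "test_fun3 \<phi>"
  shows "fourier12 (dpart (axis 1 1) \<phi>) x = \<i> * of_real (x $ 1) * fourier12 \<phi> x"
    and "fourier12 (dpart (axis 2 1) \<phi>) x = \<i> * of_real (x $ 2) * fourier12 \<phi> x"
proof -
  obtain B M where B: "B > 0" "\<And>k c q. norm (\<phi> (vec3 k c) * osc12 k q) \<le> B * indicator (cball 0 M) k"
    using test_fun3_slice[OF assms] by metis
  define q where "q = (x $ 1, x $ 2)"
  define c where "c = x $ 3"
  define F where "F k = \<phi> (vec3 k c) * osc12 k q" for k
  define F' where "F' k h = \<phi> (vec3 k c) * (- \<i> * of_real (fst h * fst q + snd h * snd q) * osc12 k q)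
     + dpart (fst h *\<^sub>R axis 1 1 + snd h *\<^sub>R axis 2 1) \<phi> (vec3 k c) * osc12 k q" for k h
  have F': "(F has_derivative F' k) (at k)" for k
  proof -
    have "((\<lambda>k. vec3 k c) has_derivative (\<lambda>h. fst h *\<^sub>R axis 1 1 + snd h *\<^sub>R axis 2 1)) (at k)"
      unfolding vec3_eq by (auto intro!: derivative_eq_intros)
    from has_derivative_compose[OF this smooth3_has_derivative[of \<phi>]]
    have 1: "((\<lambda>k. \<phi> (vec3 k c)) has_derivative (\<lambda>h. dpart (fst h *\<^sub>R axis 1 1 + snd h *\<^sub>R axis 2 1) \<phi> (vec3 k c))) (at k)"
      using assms by (simp add: test_fun3_def)
    have d: "((\<lambda>z. exp (- \<i> * z)) has_field_derivative (- \<i> * exp (- \<i> * z))) (at z)" for z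
      by (auto intro!: derivative_eq_intros)
    have "((\<lambda>k. complex_of_real (fst k * fst q + snd k * snd q)) has_derivative (\<lambda>h. of_real (fst h * fst q + snd h * snd q))) (at k)"
      by (auto intro!: derivative_eq_intros)
    from has_derivative_compose[OF this d[THEN has_field_derivative_imp_has_derivative]]
    have 2: "((\<lambda>k. osc12 k q) has_derivative (\<lambda>h. - \<i> * of_real (fst h * fst q + snd h * snd q) * osc12 k q)) (at k)"
      by (simp add: osc12_def mult_ac)
    show ?thesis
      unfolding F_def[abs_def] F'_def[abs_def] by (rule has_derivative_mult[OF 1 2])
  qed
  have supp: "F k = 0" if "norm k > M" for k using B(2)[of k c q] that by (simp add: F_def)
  have main: "fourier12 (dpart b \<phi>) x = \<i> * of_real t * fourier12 \<phi> x"
    if b: "b = fst v *\<^sub>R axis 1 1 + snd v *\<^sub>R axis 2 1" "b \<in> Basis" and t: "t = fst v * fst q + snd v * snd q" for b v t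
  proof -
    have test: "test_fun3 (dpart b \<phi>)" using assms b(2) by (rule test_fun3_dpart)
    obtain B' M' where B': "B' > 0" "\<And>k c q. norm (dpart b \<phi> (vec3 k c) * osc12 k q) \<le> B' * indicator (cball 0 M') k"
      using test_fun3_slice[OF test] by metis
    have F'v: "F' k v = (- \<i> * of_real t) * F k + dpart b \<phi> (vec3 k c) * osc12 k q" for k
      by (simp add: F'_def F_def t b(1) mult_ac)
    have "norm (F' k v) \<le> \<bar>t\<bar> * B + B'" for k
    proof -
      have "norm ((- \<i> * of_real t) * F k) \<le> \<bar>t\<bar> * B"
        using B(2)[of k c q] B(1) by (cases "k \<in> cball 0 M") (auto simp: norm_mult F_def intro!: mult_left_mono)
      moreover have "norm (dpart b \<phi> (vec3 k c) * osc12 k q) \<le> B'"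
        using B'(2)[of k c q] B'(1) by (cases "k \<in> cball 0 M'") auto
      ultimately show ?thesis unfolding F'v using norm_triangle_mono by blast
    qed
    from integral_directional_derivative_eq_0[OF F' supp this]
    have "(\<integral>k. (- \<i> * of_real t) * F k + dpart b \<phi> (vec3 k c) * osc12 k q \<partial>lborel) = 0"
      by (simp only: F'v)
    then have "(- \<i> * of_real t) * (\<integral>k. F k \<partial>lborel) + (\<integral>k. dpart b \<phi> (vec3 k c) * osc12 k q \<partial>lborel) = 0"
      unfolding F_def using integrable_test_fun3_slice[OF assms] integrable_test_fun3_slice[OF test] by simp
    then have "(\<integral>k. dpart b \<phi> (vec3 k c) * osc12 k q \<partial>lborel) = \<i> * of_real t * (\<integral>k. F k \<partial>lborel)"
      by (simp add: algebra_simps eq_neg_iff_add_eq_0)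
    then show ?thesis
      unfolding vec3_surj[of x, folded c_def q_def] fourier12_vec3 F_def by simp
  qed
  have "axis 1 1 \<in> (Basis :: (real^3) set)" "axis 2 1 \<in> (Basis :: (real^3) set)" by (auto simp: axis_in_Basis_iff)
  then show "fourier12 (dpart (axis 1 1) \<phi>) x = \<i> * of_real (x $ 1) * fourier12 \<phi> x"
    "fourier12 (dpart (axis 2 1) \<phi>) x = \<i> * of_real (x $ 2) * fourier12 \<phi> x"
    using main[of "axis 1 1" "(1, 0)" "x $ 1"] main[of "axis 2 1" "(0, 1)" "x $ 2"] by (auto simp: q_def)
qed

lemma fourier12_decay_aux:
  assumes "test_fun3 \<phi>"
  shows "\<exists>C. \<forall>x. \<bar>x $ 1\<bar> ^ n * norm (fourier12 \<phi> x) \<le> C" "\<exists>C. \<forall>x. \<bar>x $ 2\<bar> ^ n * norm (fourier12 \<phi> x) \<le> C"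
proof -
  have ax: "axis 1 1 \<in> (Basis :: (real^3) set)" "axis 2 1 \<in> (Basis :: (real^3) set)" by (auto simp: axis_in_Basis_iff)
  show "\<exists>C. \<forall>x. \<bar>x $ 1\<bar> ^ n * norm (fourier12 \<phi> x) \<le> C"
    using assms
  proof (induction n arbitrary: \<phi>)
    case 0 then show ?case using fourier12_bounded by fastforce
  next
    case (Suc n)
    from Suc.IH[OF test_fun3_dpart[OF Suc.prems ax(1)]] show ?case
      by (simp add: fourier12_dpart[OF Suc.prems] norm_mult mult_ac)
  qed
  show "\<exists>C. \<forall>x. \<bar>x $ 2\<bar> ^ n * norm (fourier12 \<phi> x) \<le> C"
    using assms
  proof (induction n arbitrary: \<phi>)
    case 0 then show ?case using fourier12_bounded by fastforce
  next
    case (Suc n)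
    from Suc.IH[OF test_fun3_dpart[OF Suc.prems ax(2)]] show ?case
      by (simp add: fourier12_dpart[OF Suc.prems] norm_mult mult_ac)
  qed
qed

text \<open>The transform of a test function is no test function, so the weak equation does not
  apply to it directly; this decay takes over the role of compact support. In the third variable the
  support stays compact, and in the other two every derivative gains one power.\<close>

lemma fourier12_decay:
  assumes "test_fun3 \<phi>"
  obtains C where "C > 0" "\<And>x. norm (fourier12 \<phi> x) \<le> C / (1 + norm x) ^ n"
proof -
  obtain M where M: "M > 0" "\<And>x. \<bar>x $ 3\<bar> > M \<Longrightarrow> fourier12 \<phi> x = 0"
    using fourier12_support[OF assms] by metis
  obtain C0 C1 C2 where C: "\<And>x. norm (fourier12 \<phi> x) \<le> C0" "\<And>x. \<bar>x $ 1\<bar> ^ n * norm (fourier12 \<phi> x) \<le> C1"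
    "\<And>x. \<bar>x $ 2\<bar> ^ n * norm (fourier12 \<phi> x) \<le> C2"
    using fourier12_decay_aux[OF assms, of n] fourier12_bounded[OF assms] by metis
  have C_nonneg: "C0 \<ge> 0" "C1 \<ge> 0" "C2 \<ge> 0"
    using C(1)[of 0] C(2)[of 0] C(3)[of 0] by (auto intro: order_trans[OF _ C(1)] order_trans[OF _ C(2)] order_trans[OF _ C(3)])
  define K where "K = 4 ^ n * ((1 + M ^ n) * C0 + C1 + C2) + 1"
  have K: "K > 0" using C_nonneg M unfolding K_def
    by (intro add_nonneg_pos mult_nonneg_nonneg add_nonneg_nonneg zero_le_power) auto
  show thesis
  proof (rule that[OF K])
    fix x :: "real^3"
    show "norm (fourier12 \<phi> x) \<le> K / (1 + norm x) ^ n"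
    proof (cases "\<bar>x $ 3\<bar> > M")
      case False
      have "norm x \<le> (\<Sum>i\<in>UNIV. \<bar>x $ i\<bar>)" by (rule norm_le_l1_cart)
      then have n: "norm x \<le> \<bar>x $ 1\<bar> + \<bar>x $ 2\<bar> + \<bar>x $ 3\<bar>" by (simp add: sum_3)
      \<comment> \<open>1 and the three coordinates are each at most m, the third because its
        modulus is at most M here. This gives 1 + |x| \<le> 4 m, and the maximum makes m^n at most
        the sum of the four powers.\<close>
      define m where "m = max (max 1 M) (max \<bar>x $ 1\<bar> \<bar>x $ 2\<bar>)"
      have "1 + norm x \<le> 4 * m" using n False by (simp add: m_def)
      then have "(1 + norm x) ^ n \<le> 4 ^ n * m ^ n" by (metis power_mono power_mult_distrib add_nonneg_nonneg norm_ge_zero zero_le_one)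
      also have "m ^ n \<le> 1 + M ^ n + \<bar>x $ 1\<bar> ^ n + \<bar>x $ 2\<bar> ^ n"
      proof -
        have "0 \<le> M ^ n" "0 \<le> \<bar>x $ 1\<bar> ^ n" "0 \<le> \<bar>x $ 2\<bar> ^ n" using M by auto
        moreover have "m = 1 \<or> m = M \<or> m = \<bar>x $ 1\<bar> \<or> m = \<bar>x $ 2\<bar>" by (auto simp: m_def max_def)
        ultimately show ?thesis by (elim disjE) auto
      qed
      finally have "(1 + norm x) ^ n * norm (fourier12 \<phi> x) \<le> 4 ^ n * (1 + M ^ n + \<bar>x $ 1\<bar> ^ n + \<bar>x $ 2\<bar> ^ n) * norm (fourier12 \<phi> x)"
        by (intro mult_right_mono) auto
      also have "\<dots> = 4 ^ n * ((1 + M ^ n) * norm (fourier12 \<phi> x) + \<bar>x $ 1\<bar> ^ n * norm (fourier12 \<phi> x) + \<bar>x $ 2\<bar> ^ n * norm (fourier12 \<phi> x))"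
        by (simp add: algebra_simps)
      also have "\<dots> \<le> 4 ^ n * ((1 + M ^ n) * C0 + C1 + C2)"
        using C M by (intro mult_left_mono add_mono) auto
      also have "\<dots> \<le> K" by (simp add: K_def)
      moreover have "(1 + norm x) ^ n > 0" by (intro zero_less_power add_pos_nonneg) auto
      ultimately show ?thesis by (simp add: pos_le_divide_eq mult.commute)
    qed (use K M in simp)
  qed
qed

section \<open>Gaussian integrals\<close>

lemma has_bochner_integral_eq_rhs: "has_bochner_integral M f x \<Longrightarrow> x = y \<Longrightarrow> has_bochner_integral M f y"
  by simp

text \<open>The primitive vanishing at 0 is odd, so the limit at minus infinity follows from the one
  at plus infinity, which is the Gaussian integral over a half line.\<close>

lemma gauss_primitive:
  obtains E :: "real \<Rightarrow> real" where "\<And>t. (E has_real_derivative exp (- t\<^sup>2)) (at t)"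
    "(E \<longlongrightarrow> sqrt pi / 2) at_top" "(E \<longlongrightarrow> - (sqrt pi / 2)) at_bot"
proof -
  define E :: "real \<Rightarrow> real" where "E t = (LBINT y=0..ereal t. exp (- y\<^sup>2))" for t
  have D: "(E has_real_derivative exp (- t\<^sup>2)) (at t)" for t
  proof -
    have "((\<lambda>u. LBINT y=ereal 0..ereal u. exp (- y\<^sup>2)) has_vector_derivative exp (- t\<^sup>2)) (at t within {-\<bar>t\<bar>-1..\<bar>t\<bar>+1})"
      by (rule interval_integral_FTC2) (auto intro!: continuous_intros)
    then show ?thesis
      by (subst (asm) at_within_interior) (auto simp: has_real_derivative_iff_has_vector_derivative E_def[abs_def] zero_ereal_def)
  qed
  have odd: "E (- t) = - E t" for t
  proof -
    have "E (- t) = (LBINT y=ereal (- 0)..ereal (- t). exp (- y\<^sup>2))" by (simp add: E_def zero_ereal_def)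
    also have "\<dots> = (LBINT y=ereal t..ereal 0. exp (- y\<^sup>2))"
      by (subst interval_integral_reflect) simp
    also have "\<dots> = - E t"
      by (subst interval_integral_endpoints_reverse) (simp add: E_def zero_ereal_def)
    finally show ?thesis .
  qed
  have i: "integrable lborel (\<lambda>x. indicator {0..} x *\<^sub>R exp (- x\<^sup>2) :: real)"
    using gaussian_moment_0 by (simp only: has_bochner_integral_iff)
  have "((\<lambda>y. \<integral>x. indicator {..y} x *\<^sub>R (indicator {0..} x *\<^sub>R exp (- x\<^sup>2)) \<partial>lborel) \<longlongrightarrow> (\<integral>x. indicator {0..} x *\<^sub>R exp (- x\<^sup>2 :: real) \<partial>lborel)) at_top"
    by (rule tendsto_integral_at_top[OF _ i]) simp
  also have "(\<integral>x. indicator {0..} x *\<^sub>R exp (- x\<^sup>2 :: real) \<partial>lborel) = sqrt pi / 2"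
    using gaussian_moment_0 by (simp add: has_bochner_integral_iff)
  finally have top: "(E \<longlongrightarrow> sqrt pi / 2) at_top"
  proof (rule Lim_transform_eventually)
    show "\<forall>\<^sub>F t in at_top. (\<integral>x. indicator {..t} x *\<^sub>R (indicator {0..} x *\<^sub>R exp (- x\<^sup>2)) \<partial>lborel) = E t"
      using eventually_ge_at_top[of 0]
    proof eventually_elim
      case (elim t)
      have "E t = (\<integral>x. indicator {0..t} x *\<^sub>R exp (- x\<^sup>2) \<partial>lborel)"
        using elim by (simp add: E_def zero_ereal_def interval_integral_Icc set_lebesgue_integral_def)
      also have "\<dots> = (\<integral>x. indicator {..t} x *\<^sub>R (indicator {0..} x *\<^sub>R exp (- x\<^sup>2)) \<partial>lborel)"
        by (intro Bochner_Integration.integral_cong) (auto split: split_indicator)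
      finally show ?case by simp
    qed
  qed
  have "((\<lambda>t. - E (- t)) \<longlongrightarrow> - (sqrt pi / 2)) at_bot"
    by (intro tendsto_minus filterlim_compose[OF top] filterlim_uminus_at_top_at_bot)
  then have "(E \<longlongrightarrow> - (sqrt pi / 2)) at_bot" by (simp add: odd)
  with D top show thesis by (rule that)
qed

lemma has_bochner_integral_FTC_half_line:
  fixes f F :: "real \<Rightarrow> real"
  assumes F: "\<And>v. v > 0 \<Longrightarrow> (F has_real_derivative f v) (at v)"
    and f: "\<And>v. v > 0 \<Longrightarrow> isCont f v" "\<And>v. v > 0 \<Longrightarrow> f v \<ge> 0"
    and A: "(F \<longlongrightarrow> A) (at_right 0)" and B: "(F \<longlongrightarrow> B) at_top"
  shows "has_bochner_integral lborel (\<lambda>v. indicator {0<..} v *\<^sub>R f v) (B - A)"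
proof -
  have A': "((F \<circ> real_of_ereal) \<longlongrightarrow> A) (at_right 0)"
    using A by (simp add: ereal_tendsto_simps1 zero_ereal_def)
  have B': "((F \<circ> real_of_ereal) \<longlongrightarrow> B) (at_left \<infinity>)"
    using B by (simp add: ereal_tendsto_simps1)
  have f': "AE x in lborel. 0 < ereal x \<longrightarrow> ereal x < \<infinity> \<longrightarrow> 0 \<le> f x"
    using f(2) by simp
  have e: "einterval 0 \<infinity> = {0::real<..}" by (simp add: zero_ereal_def)
  have "set_integrable lborel (einterval 0 \<infinity>) f" "(LBINT v=0..\<infinity>. f v) = B - A"
    using interval_integral_FTC_nonneg[OF _ _ _ f' A' B'] F f(1) by simp_all
  then show ?thesis
    unfolding has_bochner_integral_iff set_integrable_def interval_lebesgue_integral_def set_lebesgue_integral_def e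
    by simp
qed

text \<open>Both integrals have explicit primitives, because
  \<open>p\<^sup>2 v\<^sup>2 + q\<^sup>2 / v\<^sup>2 = (p v + q / v)\<^sup>2 - 2 p q = (p v - q / v)\<^sup>2 + 2 p q\<close>.\<close>

lemma gauss_subordination:
  fixes p q :: real
  assumes "p > 0" "q > 0"
  shows "has_bochner_integral lborel (\<lambda>v. indicator {0<..} v *\<^sub>R exp (- (p * v)\<^sup>2 - (q / v)\<^sup>2)) (sqrt pi / (2 * p) * exp (- 2 * p * q))"
    and "has_bochner_integral lborel (\<lambda>v. indicator {0<..} v *\<^sub>R (exp (- (p * v)\<^sup>2 - (q / v)\<^sup>2) / v\<^sup>2)) (sqrt pi / (2 * q) * exp (- 2 * p * q))"
proof -
  obtain E :: "real \<Rightarrow> real" where E: "\<And>t. (E has_real_derivative exp (- t\<^sup>2)) (at t)"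
    "(E \<longlongrightarrow> sqrt pi / 2) at_top" "(E \<longlongrightarrow> - (sqrt pi / 2)) at_bot"
    using gauss_primitive by metis
  define S where "S v = E (p * v + q / v)" for v
  define D where "D v = E (p * v - q / v)" for v
  define f where "f v = exp (- (p * v)\<^sup>2 - (q / v)\<^sup>2)" for v
  have S': "(S has_real_derivative exp (- 2 * p * q) * f v * (p - q / v\<^sup>2)) (at v)" if "v > 0" for v
  proof -
    have "((\<lambda>v. p * v + q / v) has_real_derivative p - q / v\<^sup>2) (at v)"
      using that by (auto intro!: derivative_eq_intros simp: power2_eq_square)
    from DERIV_chain2[OF E(1) this]
    have "(S has_real_derivative exp (- (p * v + q / v)\<^sup>2) * (p - q / v\<^sup>2)) (at v)" by (simp add: S_def[abs_def])
    also have "exp (- (p * v + q / v)\<^sup>2) = exp (- 2 * p * q) * f v"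
      using that by (simp add: f_def exp_add[symmetric] power2_sum)
    finally show ?thesis .
  qed
  have D': "(D has_real_derivative exp (2 * p * q) * f v * (p + q / v\<^sup>2)) (at v)" if "v > 0" for v
  proof -
    have "((\<lambda>v. p * v - q / v) has_real_derivative p + q / v\<^sup>2) (at v)"
      using that by (auto intro!: derivative_eq_intros simp: power2_eq_square)
    from DERIV_chain2[OF E(1) this]
    have "(D has_real_derivative exp (- (p * v - q / v)\<^sup>2) * (p + q / v\<^sup>2)) (at v)" by (simp add: D_def[abs_def])
    also have "exp (- (p * v - q / v)\<^sup>2) = exp (2 * p * q) * f v"
      using that by (simp add: f_def exp_add[symmetric] power2_diff)
    finally show ?thesis .
  qed
  \<comment> \<open>As v decreases to 0, the argument p v + q / v tends to plus infinity and p v - q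
    / v to minus infinity. Thus S has equal limits at both ends, and D alone contributes to the
    integrals.\<close>
  have lims: "(S \<longlongrightarrow> sqrt pi / 2) at_top" "(D \<longlongrightarrow> sqrt pi / 2) at_top"
     "(S \<longlongrightarrow> sqrt pi / 2) (at_right 0)" "(D \<longlongrightarrow> - (sqrt pi / 2)) (at_right 0)"
    unfolding S_def D_def using assms
    by (intro filterlim_compose[OF E(2)] filterlim_compose[OF E(3)]; real_asymp)+
  have cont: "isCont f v" "isCont (\<lambda>v. f v / v\<^sup>2) v" if "v > 0" for v
    using that unfolding f_def[abs_def] by (auto intro!: continuous_intros)
  \<comment> \<open>The derivatives of S and D carry the factors p - q / v^2 and p + q / v^2. The
    weights exp(2pq) and exp(-2pq) equalise their exponentials, so the sum keeps only p; the
    difference \<open>G\<close> below keeps only q / v^2.\<close>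
  define F where "F v = (exp (2 * p * q) * S v + exp (- 2 * p * q) * D v) / (2 * p)" for v
  have F: "has_bochner_integral lborel (\<lambda>v. indicator {0<..} v *\<^sub>R f v)
     ((exp (2 * p * q) * (sqrt pi / 2) + exp (- 2 * p * q) * (sqrt pi / 2)) / (2 * p)
        - (exp (2 * p * q) * (sqrt pi / 2) + exp (- 2 * p * q) * - (sqrt pi / 2)) / (2 * p))"
  proof (rule has_bochner_integral_FTC_half_line[where F = F])
    show "(F has_real_derivative f v) (at v)" if v: "v > 0" for v
    proof -
      have "(F has_real_derivative (exp (2 * p * q) * (exp (- 2 * p * q) * f v * (p - q / v\<^sup>2)) + exp (- 2 * p * q) * (exp (2 * p * q) * f v * (p + q / v\<^sup>2))) / (2 * p)) (at v)"
        unfolding F_def[abs_def] by (intro DERIV_cdivide DERIV_add DERIV_cmult S' D' v)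
      also have "(exp (2 * p * q) * (exp (- 2 * p * q) * f v * (p - q / v\<^sup>2)) + exp (- 2 * p * q) * (exp (2 * p * q) * f v * (p + q / v\<^sup>2))) / (2 * p) = f v"
      proof -
        have "exp (2 * p * q) * exp (- 2 * p * q) = 1" by (simp add: exp_add[symmetric])
        then have "exp (2 * p * q) * (exp (- 2 * p * q) * f v * (p - q / v\<^sup>2)) + exp (- 2 * p * q) * (exp (2 * p * q) * f v * (p + q / v\<^sup>2)) = f v * (2 * p)"
          by (simp add: mult.assoc[symmetric] mult.commute[of "exp (- 2 * p * q)"]) (simp add: algebra_simps)
        then show ?thesis using assms by simp
      qed
      finally show ?thesis .
    qed
  next
    show "(F \<longlongrightarrow> (exp (2 * p * q) * (sqrt pi / 2) + exp (- 2 * p * q) * - (sqrt pi / 2)) / (2 * p)) (at_right 0)"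
      unfolding F_def[abs_def] by (intro tendsto_intros lims) (use assms in auto)
    show "(F \<longlongrightarrow> (exp (2 * p * q) * (sqrt pi / 2) + exp (- 2 * p * q) * (sqrt pi / 2)) / (2 * p)) at_top"
      unfolding F_def[abs_def] by (intro tendsto_intros lims) (use assms in auto)
  qed (use cont in \<open>auto simp: f_def\<close>)
  define G where "G v = (exp (- 2 * p * q) * D v - exp (2 * p * q) * S v) / (2 * q)" for v
  have G: "has_bochner_integral lborel (\<lambda>v. indicator {0<..} v *\<^sub>R (f v / v\<^sup>2))
     ((exp (- 2 * p * q) * (sqrt pi / 2) - exp (2 * p * q) * (sqrt pi / 2)) / (2 * q)
        - (exp (- 2 * p * q) * - (sqrt pi / 2) - exp (2 * p * q) * (sqrt pi / 2)) / (2 * q))"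
  proof (rule has_bochner_integral_FTC_half_line[where F = G])
    show "(G has_real_derivative f v / v\<^sup>2) (at v)" if v: "v > 0" for v
    proof -
      have "(G has_real_derivative (exp (- 2 * p * q) * (exp (2 * p * q) * f v * (p + q / v\<^sup>2)) - exp (2 * p * q) * (exp (- 2 * p * q) * f v * (p - q / v\<^sup>2))) / (2 * q)) (at v)"
        unfolding G_def[abs_def] by (intro DERIV_cdivide DERIV_diff DERIV_cmult S' D' v)
      also have "(exp (- 2 * p * q) * (exp (2 * p * q) * f v * (p + q / v\<^sup>2)) - exp (2 * p * q) * (exp (- 2 * p * q) * f v * (p - q / v\<^sup>2))) / (2 * q) = f v / v\<^sup>2"
      proof -
        have "exp (2 * p * q) * exp (- 2 * p * q) = 1" by (simp add: exp_add[symmetric])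
        then have "exp (- 2 * p * q) * (exp (2 * p * q) * f v * (p + q / v\<^sup>2)) - exp (2 * p * q) * (exp (- 2 * p * q) * f v * (p - q / v\<^sup>2)) = f v / v\<^sup>2 * (2 * q)"
          by (simp add: mult.assoc[symmetric] mult.commute[of "exp (- 2 * p * q)"]) (simp add: algebra_simps)
        then show ?thesis using assms by simp
      qed
      finally show ?thesis .
    qed
  next
    show "(G \<longlongrightarrow> (exp (- 2 * p * q) * - (sqrt pi / 2) - exp (2 * p * q) * (sqrt pi / 2)) / (2 * q)) (at_right 0)"
      unfolding G_def[abs_def] by (intro tendsto_intros lims) (use assms in auto)
    show "(G \<longlongrightarrow> (exp (- 2 * p * q) * (sqrt pi / 2) - exp (2 * p * q) * (sqrt pi / 2)) / (2 * q)) at_top"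
      unfolding G_def[abs_def] by (intro tendsto_intros lims) (use assms in auto)
  qed (use cont in \<open>auto simp: f_def\<close>)
  show "has_bochner_integral lborel (\<lambda>v. indicator {0<..} v *\<^sub>R exp (- (p * v)\<^sup>2 - (q / v)\<^sup>2)) (sqrt pi / (2 * p) * exp (- 2 * p * q))"
    using F unfolding f_def by (rule has_bochner_integral_eq_rhs) (use assms in \<open>simp add: field_simps\<close>)
  show "has_bochner_integral lborel (\<lambda>v. indicator {0<..} v *\<^sub>R (exp (- (p * v)\<^sup>2 - (q / v)\<^sup>2) / v\<^sup>2)) (sqrt pi / (2 * q) * exp (- 2 * p * q))"
    using G unfolding f_def by (rule has_bochner_integral_eq_rhs) (use assms in \<open>simp add: field_simps\<close>)
qed

lemma gauss_fourier_1d: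
  fixes v k :: real
  assumes v: "v > 0"
  shows "has_bochner_integral lborel (\<lambda>x. of_real (exp (- (v * x)\<^sup>2)) * exp (- \<i> * of_real (k * x))) (of_real (sqrt pi / v * exp (- (k / (2 * v))\<^sup>2)))"
proof -
  \<comment> \<open>The formula is the characteristic function of the standard normal law, rescaled:
    the dilation by c turns x^2 / 2 into (v x)^2, and t makes the frequency k.\<close>
  define c where "c = sqrt 2 * v"
  have c: "c > 0" using v by (simp add: c_def)
  define t where "t = - k / c"
  have i: "integrable std_normal_distribution (\<lambda>x. iexp (t * x))"
  proof -
    interpret prob_space std_normal_distribution by (rule prob_space_normal_density) simp
    show ?thesis by (rule integrable_const_bound[of _ 1]) auto
  qed
  have "(CLINT x|std_normal_distribution. iexp (t * x)) = of_real (exp (- (t\<^sup>2) / 2))"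
    using char_std_normal_distribution by (metis char_def)
  then have 1: "has_bochner_integral lborel (\<lambda>x. std_normal_density x *\<^sub>R iexp (t * x)) (of_real (exp (- (t\<^sup>2) / 2)))"
    using i by (simp add: has_bochner_integral_iff integrable_density integral_density normal_density_nonneg)
  have "has_bochner_integral lborel (\<lambda>x. std_normal_density (0 + c * x) *\<^sub>R iexp (t * (0 + c * x))) (of_real (exp (- (t\<^sup>2) / 2)) /\<^sub>R \<bar>c\<bar>)"
    by (rule lborel_has_bochner_integral_real_affine_iff[THEN iffD1, OF _ 1]) (use c in auto)
  then have "has_bochner_integral lborel (\<lambda>x. sqrt (2 * pi) *\<^sub>R (std_normal_density (0 + c * x) *\<^sub>R iexp (t * (0 + c * x)))) (sqrt (2 * pi) *\<^sub>R (of_real (exp (- (t\<^sup>2) / 2)) /\<^sub>R \<bar>c\<bar>))"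
    by (rule has_bochner_integral_scaleR_right)
  also have "(\<lambda>x. sqrt (2 * pi) *\<^sub>R (std_normal_density (0 + c * x) *\<^sub>R iexp (t * (0 + c * x))))
     = (\<lambda>x. of_real (exp (- (v * x)\<^sup>2)) * exp (- \<i> * of_real (k * x)))"
  proof (rule ext)
    fix x
    have "sqrt (2 * pi) * std_normal_density (0 + c * x) = exp (- (v * x)\<^sup>2)"
      by (simp add: std_normal_density_def c_def power_mult_distrib)
    moreover have "iexp (t * (0 + c * x)) = exp (- \<i> * of_real (k * x))" using c by (simp add: t_def)
    ultimately show "sqrt (2 * pi) *\<^sub>R (std_normal_density (0 + c * x) *\<^sub>R iexp (t * (0 + c * x))) = of_real (exp (- (v * x)\<^sup>2)) * exp (- \<i> * of_real (k * x))"
      by (simp only: scaleR_scaleR) (simp add: scaleR_conv_of_real)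
  qed
  also have "sqrt (2 * pi) *\<^sub>R (complex_of_real (exp (- (t\<^sup>2) / 2)) /\<^sub>R \<bar>c\<bar>) = of_real (sqrt pi / v * exp (- (k / (2 * v))\<^sup>2))"
  proof -
    have "t\<^sup>2 / 2 = (k / (2 * v))\<^sup>2" using v by (simp add: t_def c_def power_divide power_mult_distrib)
    moreover have "sqrt (2 * pi) / c = sqrt pi / v" using v by (simp add: c_def real_sqrt_mult)
    moreover have "sqrt (2 * pi) *\<^sub>R (complex_of_real (exp (- (t\<^sup>2) / 2)) /\<^sub>R \<bar>c\<bar>) = of_real (sqrt (2 * pi) / c * exp (- (t\<^sup>2 / 2)))"
      using c by (simp only: scaleR_conv_of_real of_real_mult[symmetric] abs_of_pos) (simp add: inverse_eq_divide)
    ultimately show ?thesis by simp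
  qed
  finally show ?thesis .
qed

section \<open>Weyl's formula with absorption\<close>

lemma has_bochner_integral_lborel_prod:
  fixes f :: "'a::euclidean_space \<Rightarrow> complex" and g :: "'b::euclidean_space \<Rightarrow> complex"
  assumes f: "has_bochner_integral lborel f a" and g: "has_bochner_integral lborel g b"
  shows "has_bochner_integral lborel (\<lambda>p. f (fst p) * g (snd p)) (a * b)"
proof -
  have fi: "integrable lborel f" "(\<integral>x. f x \<partial>lborel) = a" and gi: "integrable lborel g" "(\<integral>x. g x \<partial>lborel) = b"
    using f g by (auto simp: has_bochner_integral_iff)
  have [measurable]: "f \<in> borel_measurable borel" "g \<in> borel_measurable borel"
    using fi(1) gi(1) by (auto dest: borel_measurable_integrable)
  have i: "integrable (lborel \<Otimes>\<^sub>M lborel) (\<lambda>(x, y). f x * g y)"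
  proof (rule lborel_pair.Fubini_integrable)
    show "integrable lborel (\<lambda>x. \<integral>y. norm (case (x, y) of (x, y) \<Rightarrow> f x * g y) \<partial>lborel)"
      using fi(1) by (simp add: norm_mult)
  qed (use fi(1) gi(1) in auto)
  have "(\<integral>p. (case p of (x, y) \<Rightarrow> f x * g y) \<partial>(lborel \<Otimes>\<^sub>M lborel)) = (\<integral>x. \<integral>y. f x * g y \<partial>lborel \<partial>lborel)"
    using lborel_pair.integral_fst'[OF i] by simp
  also have "\<dots> = a * b" using fi gi by simp
  finally show ?thesis
    using i by (simp add: has_bochner_integral_iff lborel_prod case_prod_unfold)
qed

lemma gauss_fourier_2d:
  assumes v: "v > 0"
  shows "has_bochner_integral lborel (\<lambda>p. of_real (exp (- (v * norm p)\<^sup>2)) * osc12 k p) (of_real (pi / v\<^sup>2 * exp (- (norm k / (2 * v))\<^sup>2)))"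
proof -
  have n: "(norm p)\<^sup>2 = (fst p)\<^sup>2 + (snd p)\<^sup>2" for p :: "real \<times> real"
    by (simp add: norm_prod_def)
  have "(\<lambda>p. (of_real (exp (- (v * fst p)\<^sup>2)) * exp (- \<i> * of_real (fst k * fst p))) * (of_real (exp (- (v * snd p)\<^sup>2)) * exp (- \<i> * of_real (snd k * snd p))))
    = (\<lambda>p. of_real (exp (- (v * norm p)\<^sup>2)) * osc12 k p)" (is "?L = ?R")
  proof
    fix p :: "real \<times> real"
    have "exp (- (v * norm p)\<^sup>2) = exp (- (v * fst p)\<^sup>2) * exp (- (v * snd p)\<^sup>2)"
      by (simp add: power_mult_distrib n exp_add[symmetric] algebra_simps)
    moreover have "osc12 k p = exp (- \<i> * of_real (fst k * fst p)) * exp (- \<i> * of_real (snd k * snd p))"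
      by (simp add: osc12_def exp_add[symmetric] algebra_simps)
    ultimately show "?L p = ?R p" by simp
  qed
  moreover have "of_real (sqrt pi / v * exp (- (fst k / (2 * v))\<^sup>2)) * of_real (sqrt pi / v * exp (- (snd k / (2 * v))\<^sup>2))
     = complex_of_real (pi / v\<^sup>2 * exp (- (norm k / (2 * v))\<^sup>2))"
  proof -
    have "exp (- (norm k / (2 * v))\<^sup>2) = exp (- (fst k / (2 * v))\<^sup>2) * exp (- (snd k / (2 * v))\<^sup>2)"
      by (simp add: power_divide n exp_add[symmetric] add_divide_distrib)
    moreover have "sqrt pi * sqrt pi = pi" by simp
    ultimately show ?thesis by (simp add: power2_eq_square flip: of_real_mult)
  qed
  ultimately show ?thesis
    using has_bochner_integral_lborel_prod[OF gauss_fourier_1d[OF v, of "fst k"] gauss_fourier_1d[OF v, of "snd k"]] by simp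
qed

definition hyp :: "real \<Rightarrow> real \<times> real \<Rightarrow> real" where
  "hyp z p = sqrt ((norm p)\<^sup>2 + z\<^sup>2)"

lemma hyp_pos: "z > 0 \<Longrightarrow> hyp z p > 0" and hyp_ge: "z > 0 \<Longrightarrow> hyp z p \<ge> z"
  by (auto simp: hyp_def add_nonneg_pos intro!: real_le_rsqrt)

lemma hyp_nonneg: "hyp z p \<ge> 0"
  by (simp add: hyp_def)

lemma hyp_sq: "(hyp z p)\<^sup>2 = (norm p)\<^sup>2 + z\<^sup>2"
  by (simp add: hyp_def)

lemma measurable_hyp [measurable]: "hyp z \<in> borel_measurable borel"
  unfolding hyp_def[abs_def] by (intro borel_measurable_continuous_onI continuous_intros)

text \<open>Subordination writes exp(-aR)/R as 2 / sqrt pi times the integral over v > 0 of exp(-(R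
  v)^2 - (a / (2v))^2). For fixed v the transform in p is Gaussian; it multiplies by pi / v^2 and
  replaces a^2 by a^2 + |k|^2 in the exponent. The remaining v-integral is the second formula of
  \<open>gauss_subordination\<close>.\<close>

lemma weyl_real:
  fixes a z :: real and k :: "real \<times> real"
  assumes a: "a > 0" and z: "z > 0"
  defines "b \<equiv> sqrt (a\<^sup>2 + (norm k)\<^sup>2)"
  shows "has_bochner_integral lborel (\<lambda>p. of_real (exp (- a * hyp z p) / hyp z p) * osc12 k p) (of_real (2 * pi * exp (- b * z) / b))"
proof -
  define H where "H k v p = indicator {0<..} v *\<^sub>R (of_real (exp (- (hyp z p * v)\<^sup>2 - (a / 2 / v)\<^sup>2)) * osc12 k p)" for k :: "real \<times> real" and v p
  have inner: "has_bochner_integral lborel (H k v) (indicator {0<..} v *\<^sub>R of_real (pi * (exp (- (z * v)\<^sup>2 - (sqrt (a\<^sup>2 + (norm k)\<^sup>2) / 2 / v)\<^sup>2) / v\<^sup>2)))" for v k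
  proof (cases "v > 0")
    case True
    have 1: "has_bochner_integral lborel (\<lambda>p. of_real (exp (- (z * v)\<^sup>2 - (a / 2 / v)\<^sup>2)) * (of_real (exp (- (v * norm p)\<^sup>2)) * osc12 k p))
       (of_real (exp (- (z * v)\<^sup>2 - (a / 2 / v)\<^sup>2)) * of_real (pi / v\<^sup>2 * exp (- (norm k / (2 * v))\<^sup>2)))"
      by (rule has_bochner_integral_mult_right[OF gauss_fourier_2d[OF True]])
    have 2: "of_real (exp (- (z * v)\<^sup>2 - (a / 2 / v)\<^sup>2)) * (of_real (exp (- (v * norm p)\<^sup>2)) * osc12 k p) = H k v p" for p
    proof -
      have "exp (- (z * v)\<^sup>2 - (a / 2 / v)\<^sup>2) * exp (- (v * norm p)\<^sup>2) = exp (- (hyp z p * v)\<^sup>2 - (a / 2 / v)\<^sup>2)"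
        by (simp add: exp_add[symmetric] power_mult_distrib hyp_sq algebra_simps)
      then show ?thesis using True by (simp add: H_def mult.assoc[symmetric] flip: of_real_mult)
    qed
    have 3: "exp (- (z * v)\<^sup>2 - (a / 2 / v)\<^sup>2) * (pi / v\<^sup>2 * exp (- (norm k / (2 * v))\<^sup>2))
       = pi * (exp (- (z * v)\<^sup>2 - (sqrt (a\<^sup>2 + (norm k)\<^sup>2) / 2 / v)\<^sup>2) / v\<^sup>2)"
    proof -
      have "exp (- (z * v)\<^sup>2 - (a / 2 / v)\<^sup>2) * exp (- (norm k / (2 * v))\<^sup>2) = exp (- (z * v)\<^sup>2 - (sqrt (a\<^sup>2 + (norm k)\<^sup>2) / 2 / v)\<^sup>2)"
        using True by (simp add: exp_add[symmetric] power_divide power_mult_distrib add_divide_distrib)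
      then show ?thesis by (simp add: mult_ac)
    qed
    from 1 have "has_bochner_integral lborel (H k v) (of_real (exp (- (z * v)\<^sup>2 - (a / 2 / v)\<^sup>2) * (pi / v\<^sup>2 * exp (- (norm k / (2 * v))\<^sup>2))))"
      by (simp only: 2 of_real_mult)
    then show ?thesis unfolding 3 using True by simp
  qed (simp add: H_def[abs_def] has_bochner_integral_zero)
  have outer: "has_bochner_integral lborel (\<lambda>v. indicator {0<..} v *\<^sub>R complex_of_real (pi * (exp (- (z * v)\<^sup>2 - (c / 2 / v)\<^sup>2) / v\<^sup>2)))
     (of_real (pi * (sqrt pi / c * exp (- c * z))))" if "c > 0" for c
  proof -
    have "has_bochner_integral lborel (\<lambda>v. of_real (pi * (indicator {0<..} v *\<^sub>R (exp (- (z * v)\<^sup>2 - (c / 2 / v)\<^sup>2) / v\<^sup>2))))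
      (complex_of_real (pi * (sqrt pi / (2 * (c / 2)) * exp (- 2 * z * (c / 2)))))"
      by (intro has_bochner_integral_of_real has_bochner_integral_mult_right gauss_subordination(2)) (use z that in auto)
    then show ?thesis by (simp add: scaleR_conv_of_real mult_ac)
  qed
  have b: "b > 0" using a by (simp add: b_def add_pos_nonneg)
  have [measurable]: "(\<lambda>(v, p). H k v p) \<in> borel_measurable (borel \<Otimes>\<^sub>M borel)" for k
    unfolding H_def by measurable
  have i: "integrable (lborel \<Otimes>\<^sub>M lborel) (\<lambda>(v, p). H k v p)"
  proof (rule lborel_pair.Fubini_integrable)
    \<comment> \<open>The oscillation has modulus 1, so absolute integrability for any k is the case
      k = 0, where the square root reduces to a.\<close>
    have "norm (H k v p) = Re (H 0 v p)" for v p
      by (simp add: H_def norm_mult osc12_def)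
    then have "(\<lambda>v. \<integral>p. norm (H k v p) \<partial>lborel) = (\<lambda>v. Re (\<integral>p. H 0 v p \<partial>lborel))"
      using inner[of 0] by (simp add: has_bochner_integral_iff)
    also have "\<dots> = (\<lambda>v. Re (indicator {0<..} v *\<^sub>R of_real (pi * (exp (- (z * v)\<^sup>2 - (a / 2 / v)\<^sup>2) / v\<^sup>2))))"
      using inner[of 0] a by (simp add: has_bochner_integral_iff)
    finally have eq: "(\<lambda>v. \<integral>p. norm (H k v p) \<partial>lborel) = (\<lambda>v. Re (indicator {0<..} v *\<^sub>R of_real (pi * (exp (- (z * v)\<^sup>2 - (a / 2 / v)\<^sup>2) / v\<^sup>2))))" .
    show "integrable lborel (\<lambda>v. \<integral>p. norm (case (v, p) of (v, p) \<Rightarrow> H k v p) \<partial>lborel)"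
      unfolding prod.case eq by (rule integrable_Re) (use outer[OF a] in \<open>simp only: has_bochner_integral_iff\<close>)
    show "AE v in lborel. integrable lborel (\<lambda>p. case (v, p) of (v, p) \<Rightarrow> H k v p)"
      using inner[of k] by (simp add: has_bochner_integral_iff)
  qed measurable
  have pv: "(\<integral>v. H k v p \<partial>lborel) = of_real (sqrt pi / 2) * (of_real (exp (- a * hyp z p) / hyp z p) * osc12 k p)" for p
  proof -
    have "has_bochner_integral lborel (\<lambda>v. of_real (indicator {0<..} v *\<^sub>R exp (- (hyp z p * v)\<^sup>2 - (a / 2 / v)\<^sup>2)) * osc12 k p)
       (of_real (sqrt pi / (2 * hyp z p) * exp (- 2 * hyp z p * (a / 2))) * osc12 k p)"
      by (intro has_bochner_integral_mult_left has_bochner_integral_of_real gauss_subordination(1)) (use a hyp_pos[OF z] in auto)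
    then show ?thesis
      by (simp add: H_def has_bochner_integral_iff scaleR_conv_of_real mult_ac)
  qed
  have "integrable lborel (\<lambda>p. \<integral>v. H k v p \<partial>lborel)"
    using lborel_pair.integrable_snd[OF i] .
  then have "integrable lborel (\<lambda>p. complex_of_real (sqrt pi / 2) * (of_real (exp (- a * hyp z p) / hyp z p) * osc12 k p))"
    unfolding pv .
  then have int: "integrable lborel (\<lambda>p. of_real (exp (- a * hyp z p) / hyp z p) * osc12 k p)"
  proof -
    have c: "of_real (2 / sqrt pi) * (complex_of_real (sqrt pi / 2) * y) = y" for y
      by (simp only: mult.assoc[symmetric] of_real_mult[symmetric]) simp
    assume "integrable lborel (\<lambda>p. complex_of_real (sqrt pi / 2) * (of_real (exp (- a * hyp z p) / hyp z p) * osc12 k p))"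
    from integrable_mult_right[OF this, of "of_real (2 / sqrt pi)"] show ?thesis unfolding c .
  qed
  have "(\<integral>p. \<integral>v. H k v p \<partial>lborel \<partial>lborel) = (\<integral>v. \<integral>p. H k v p \<partial>lborel \<partial>lborel)"
    using lborel_pair.Fubini_integral[OF i] .
  also have "\<dots> = of_real (pi * (sqrt pi / b * exp (- b * z)))"
    using inner[of k] outer[OF b] by (simp add: has_bochner_integral_iff b_def)
  also have "pi * (sqrt pi / b * exp (- b * z)) = sqrt pi / 2 * (2 * pi * exp (- b * z) / b)" by simp
  finally have "(\<integral>p. complex_of_real (sqrt pi / 2) * (of_real (exp (- a * hyp z p) / hyp z p) * osc12 k p) \<partial>lborel) = of_real (sqrt pi / 2) * of_real (2 * pi * exp (- b * z) / b)"
    unfolding pv of_real_mult[of "sqrt pi / 2"] .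
  then have "complex_of_real (sqrt pi / 2) * (\<integral>p. of_real (exp (- a * hyp z p) / hyp z p) * osc12 k p \<partial>lborel) = of_real (sqrt pi / 2) * of_real (2 * pi * exp (- b * z) / b)"
    unfolding integral_mult_right_zero .
  then have "(\<integral>p. of_real (exp (- a * hyp z p) / hyp z p) * osc12 k p \<partial>lborel) = complex_of_real (2 * pi * exp (- b * z) / b)"
    by (subst (asm) mult_left_cancel) auto
  with int show ?thesis by (simp add: has_bochner_integral_iff)
qed

text \<open>Around a positive real c, expand exp(-(w - c) R) in powers of w - c. If t = |w - c| < c,
  the partial sums are dominated by exp(-(c - t) R) |h|, so the integral is a power series on the
  disc of radius c. These discs touch the imaginary axis and together exhaust the half
  plane.\<close>

lemma holomorphic_laplace:
  fixes R :: "'b \<Rightarrow> real" and h :: "'b \<Rightarrow> complex"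
  assumes [measurable]: "R \<in> borel_measurable M" "h \<in> borel_measurable M"
    and R: "\<And>x. R x \<ge> 0" and int: "\<And>c. c > 0 \<Longrightarrow> integrable M (\<lambda>x. exp (- c * R x) * norm (h x))"
  shows "(\<lambda>a. \<integral>x. exp (- a * of_real (R x)) * h x \<partial>M) holomorphic_on {a. Re a > 0}"
proof -
  define f where "f a = (\<integral>x. exp (- a * of_real (R x)) * h x \<partial>M)" for a
  have ball: "f holomorphic_on ball (of_real c) c" if c: "c > 0" for c :: real
  proof (rule power_series_holomorphic)
    fix w :: complex assume w: "w \<in> ball (of_real c) c"
    define t where "t = norm (of_real c - w)"
    have t: "t < c" "t \<ge> 0" using w by (auto simp: t_def dist_norm)
    define T where "T n x = (- (w - of_real c) * of_real (R x)) ^ n / fact n * (exp (- of_real c * of_real (R x)) * h x)" for n x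
    have [measurable]: "T n \<in> borel_measurable M" for n unfolding T_def[abs_def] by measurable
    define B where "B x = exp (- (c - t) * R x) * norm (h x)" for x
    have B: "integrable M B" unfolding B_def[abs_def] using int[of "c - t"] t by simp
    have nT: "norm (T n x) = (t * R x) ^ n / fact n * (exp (- c * R x) * norm (h x))" for n x
      using R[of x] by (simp add: T_def norm_mult norm_divide norm_power t_def)
    have sumT: "(\<Sum>n<N. norm (T n x)) \<le> B x" for N x
    proof -
      have "(\<Sum>n<N. (t * R x) ^ n /\<^sub>R fact n) \<le> exp (t * R x)"
        unfolding exp_def by (rule sum_le_suminf) (use t R[of x] summable_exp_generic[of "t * R x"] in auto)
      then have "(\<Sum>n<N. (t * R x) ^ n / fact n) * (exp (- c * R x) * norm (h x)) \<le> exp (t * R x) * (exp (- c * R x) * norm (h x))"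
        by (intro mult_right_mono) (auto simp: divide_inverse mult.commute)
      also have "exp (t * R x) * (exp (- c * R x) * norm (h x)) = B x"
      proof -
        have "exp (t * R x) * exp (- c * R x) = exp (- (c - t) * R x)"
          by (simp add: exp_add[symmetric] left_diff_distrib)
        then show ?thesis by (simp only: B_def mult.assoc[symmetric])
      qed
      finally show ?thesis by (simp add: nT sum_distrib_right)
    qed
    have Tn: "norm (T n x) \<le> B x" for n x
    proof -
      have "norm (T n x) \<le> (\<Sum>m<Suc n. norm (T m x))" by (rule member_le_sum) auto
      then show ?thesis using sumT[where N = "Suc n" and x = x] by linarith
    qed
    have B0: "B x \<ge> 0" for x by (simp add: B_def)
    have Ti: "integrable M (T n)" for n
      by (rule Bochner_Integration.integrable_bound[OF B]) (use Tn B0 in auto)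
    have "(\<lambda>N. \<integral>x. (\<Sum>n<N. T n x) \<partial>M) \<longlonglongrightarrow> f w"
      unfolding f_def
    proof (rule integral_dominated_convergence[OF _ _ B])
      show "AE x in M. (\<lambda>N. \<Sum>n<N. T n x) \<longlonglongrightarrow> exp (- w * of_real (R x)) * h x"
      proof (intro always_eventually allI)
        fix x
        have "(\<lambda>n. (- (w - of_real c) * of_real (R x)) ^ n /\<^sub>R fact n) sums exp (- (w - of_real c) * of_real (R x))"
          by (rule exp_converges)
        from sums_mult2[OF this, of "exp (- of_real c * of_real (R x)) * h x"]
        have "(\<lambda>n. T n x) sums (exp (- (w - of_real c) * of_real (R x)) * (exp (- of_real c * of_real (R x)) * h x))"
          by (simp add: T_def scaleR_conv_of_real divide_inverse mult_ac)
        also have "exp (- (w - of_real c) * of_real (R x)) * (exp (- of_real c * of_real (R x)) * h x) = exp (- w * of_real (R x)) * h x"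
        proof -
          have "exp (- (w - of_real c) * of_real (R x)) * exp (- of_real c * of_real (R x)) = exp (- w * of_real (R x))"
            by (simp add: exp_add[symmetric] left_diff_distrib)
          then show ?thesis by (simp only: mult.assoc[symmetric])
        qed
        finally show "(\<lambda>N. \<Sum>n<N. T n x) \<longlonglongrightarrow> exp (- w * of_real (R x)) * h x" by (simp add: sums_def)
      qed
      show "AE x in M. norm (\<Sum>n<N. T n x) \<le> B x" for N
        by (intro always_eventually allI order_trans[OF norm_sum sumT])
    qed auto
    moreover have "(\<integral>x. T n x \<partial>M) = (\<integral>x. (- of_real (R x)) ^ n / fact n * (exp (- of_real c * of_real (R x)) * h x) \<partial>M) * (w - of_real c) ^ n" for n
    proof -
      have "T n x = ((- of_real (R x)) ^ n / fact n * (exp (- of_real c * of_real (R x)) * h x)) * (w - of_real c) ^ n" for x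
      proof -
        have eq: "- (w - of_real c) * of_real (R x) = - of_real (R x) * (w - of_real c)" by (simp add: algebra_simps)
        show ?thesis unfolding T_def eq power_mult_distrib by (simp only: divide_inverse mult_ac)
      qed
      then show ?thesis by simp
    qed
    ultimately show "(\<lambda>n. (\<integral>x. (- of_real (R x)) ^ n / fact n * (exp (- of_real c * of_real (R x)) * h x) \<partial>M) * (w - of_real c) ^ n) sums f w"
      using Ti by (simp add: sums_def)
  qed
  have "f field_differentiable (at a)" if a: "Re a > 0" for a
  proof -
    \<comment> \<open>This choice gives |a - c|^2 = c^2 - |a|^2 < c^2, so a lies in the disc about
      c.\<close>
    define c where "c = (norm a)\<^sup>2 / Re a"
    have a0: "norm a > 0" using a by auto
    then have c: "c > 0" using a by (simp add: c_def)
    have "(norm (a - of_real c))\<^sup>2 = (norm a)\<^sup>2 - 2 * (c * Re a) + c\<^sup>2"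
      unfolding cmod_power2 by (simp add: power2_eq_square algebra_simps)
    also have "c * Re a = (norm a)\<^sup>2" using a by (simp add: c_def)
    finally have "(norm (a - of_real c))\<^sup>2 < c\<^sup>2" using a0 by simp
    then have "norm (a - of_real c) < c" using c by (simp add: power2_less_imp_less)
    then have "a \<in> ball (of_real c) c" by (simp add: dist_norm norm_minus_commute)
    then show ?thesis using ball[OF c] by (metis holomorphic_on_imp_differentiable_at open_ball)
  qed
  then show ?thesis
    unfolding f_def[abs_def, symmetric] holomorphic_on_def by (auto intro: field_differentiable_at_within)
qed

text \<open>Both sides are holomorphic in a on the right half plane: the left as a Laplace
  transform, the right because the radicand avoids the cut of the principal root. They agree for
  real a > 0, and these points accumulate at 1.\<close>

lemma weyl_complex:
  fixes a :: complex and z :: real and k :: "real \<times> real"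
  assumes a: "Re a > 0" and z: "z > 0"
  defines "b \<equiv> csqrt (a\<^sup>2 + of_real ((norm k)\<^sup>2))"
  shows "has_bochner_integral lborel (\<lambda>p. exp (- a * of_real (hyp z p)) / of_real (hyp z p) * osc12 k p) (2 * of_real pi * exp (- b * of_real z) / b)"
proof -
  define h where "h p = osc12 k p / of_real (hyp z p)" for p
  have [measurable]: "h \<in> borel_measurable borel" unfolding h_def[abs_def] by measurable
  have nh: "norm (h p) = 1 / hyp z p" for p using hyp_pos[OF z, of p] by (simp add: h_def norm_divide)
  have int: "integrable lborel (\<lambda>p. exp (- c * hyp z p) * norm (h p))" if "c > 0" for c
  proof -
    have "integrable lborel (\<lambda>p. norm (of_real (exp (- c * hyp z p) / hyp z p) * osc12 k p))"
      using weyl_real[OF that z, of k] by (intro integrable_norm) (simp add: has_bochner_integral_iff)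
    then show ?thesis using hyp_pos[OF z] by (simp add: norm_mult nh norm_divide abs_of_pos)
  qed
  have int': "integrable lborel (\<lambda>p. exp (- a * of_real (hyp z p)) * h p)" if "Re a > 0" for a
    by (rule Bochner_Integration.integrable_bound[OF int[OF that]]) (auto simp: norm_mult norm_exp_eq_Re)
  \<comment> \<open>If a^2 + |k|^2 is real then so is a, because Re a > 0; but then the radicand is
    positive.\<close>
  have pos: "a\<^sup>2 + of_real ((norm k)\<^sup>2) \<notin> \<real>\<^sub>\<le>\<^sub>0" if "Re a > 0" for a
  proof
    assume "a\<^sup>2 + of_real ((norm k)\<^sup>2) \<in> \<real>\<^sub>\<le>\<^sub>0"
    then have *: "Im (a\<^sup>2) = 0" "Re (a\<^sup>2) + (norm k)\<^sup>2 \<le> 0" by (auto simp: complex_nonpos_Reals_iff)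
    then have "Im a = 0" using that by (simp add: power2_eq_square)
    then have "Re (a\<^sup>2) > 0" using that by (simp add: power2_eq_square)
    then show False using *(2) zero_le_power2[of "norm k"] by linarith
  qed
  define F where "F a = (\<integral>p. exp (- a * of_real (hyp z p)) * h p \<partial>lborel)" for a
  define G where "G a = 2 * of_real pi * exp (- csqrt (a\<^sup>2 + of_real ((norm k)\<^sup>2)) * of_real z) / csqrt (a\<^sup>2 + of_real ((norm k)\<^sup>2))" for a
  have "(\<lambda>a. F a - G a) holomorphic_on {a. Re a > 0}"
  proof (intro holomorphic_on_diff)
    show "F holomorphic_on {a. Re a > 0}"
      unfolding F_def[abs_def] by (rule holomorphic_laplace) (use int in \<open>auto simp: hyp_nonneg\<close>)
    show "G holomorphic_on {a. Re a > 0}"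
      unfolding G_def[abs_def] using pos by (intro holomorphic_intros) (auto, metis pos nonpos_Reals_zero_I of_real_power)
  qed
  moreover have "open {a. Re a > 0}" by (rule open_halfspace_Re_gt)
  moreover have "connected {a. Re a > 0}" by (intro convex_connected convex_halfspace_Re_gt)
  moreover have "of_real ` {0<..} \<subseteq> {a. Re a > 0}" by auto
  moreover have "(1::complex) \<in> {a. Re a > 0}" by simp
  moreover have "(1::complex) islimpt of_real ` {0<..}"
  proof -
    have "(\<lambda>n. complex_of_real (1 + inverse (real (Suc n)))) \<longlonglongrightarrow> of_real (1 + 0)"
      by (intro tendsto_intros LIMSEQ_inverse_real_of_nat)
    then show ?thesis
      unfolding islimpt_sequential by (intro exI[of _ "\<lambda>n. complex_of_real (1 + inverse (real (Suc n)))"]) 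
        (auto simp del: of_real_add simp: of_real_eq_1_iff add_pos_pos)
  qed
  moreover have "F w - G w = 0" if w: "w \<in> of_real ` {0<..}" for w
  proof -
    obtain c where c: "w = of_real c" "c > 0" using w by auto
    define \<beta> where "\<beta> = sqrt (c\<^sup>2 + (norm k)\<^sup>2)"
    have "csqrt (w\<^sup>2 + of_real ((norm k)\<^sup>2)) = of_real \<beta>"
      unfolding c(1) \<beta>_def by (simp flip: of_real_power of_real_add)
    moreover have "exp (- complex_of_real \<beta> * of_real z) = of_real (exp (- \<beta> * z))"
      by (simp add: exp_of_real[symmetric])
    ultimately have "G w = of_real (2 * pi * exp (- \<beta> * z) / \<beta>)"
      by (simp add: G_def)
    moreover have "F w = (\<integral>p. of_real (exp (- c * hyp z p) / hyp z p) * osc12 k p \<partial>lborel)"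
      unfolding F_def c(1) h_def by (intro Bochner_Integration.integral_cong) (auto simp: exp_of_real[symmetric])
    ultimately show ?thesis using weyl_real[OF c(2) z, of k] by (simp add: has_bochner_integral_iff \<beta>_def)
  qed
  ultimately have "F a - G a = 0"
    using analytic_continuation[of "\<lambda>a. F a - G a" "{a. Re a > 0}" "of_real ` {0<..}" 1 a] a by blast
  then show ?thesis
    using int'[OF a] by (simp add: has_bochner_integral_iff F_def G_def b_def h_def)
qed

section \<open>Weyl's formula\<close>

lemma AE_norm_neq: "AE x in (lborel :: 'a::euclidean_space measure). norm x \<noteq> c"
proof -
  have "sphere (0::'a) c \<in> null_sets lborel"
    using negligible_sphere[of 0 c] by (simp add: negligible_iff_null_sets null_sets_completion_iff)
  then show ?thesis by (auto intro: AE_I' simp: sphere_def)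
qed

text \<open>The factor r from polar coordinates gives explicit primitives on both sides of the
  singularity, - sqrt(c^2 - r^2) and sqrt(r^2 - c^2), and these are continuous up to r = c.\<close>

lemma nn_integral_inverse_sqrt_finite:
  fixes c M :: real
  assumes c: "c > 0"
  shows "(\<integral>\<^sup>+r. ennreal (indicator {0..M} r * (r / sqrt \<bar>r\<^sup>2 - c\<^sup>2\<bar>)) \<partial>lborel) < \<infinity>"
proof -
  \<comment> \<open>Above M so that the range is covered, and above c so that the outer interval is
    nonempty even if M < c.\<close>
  define N where "N = max M c + 1"
  have N: "N > c" "N > M" by (auto simp: N_def)
  have 1: "set_integrable lborel (einterval (ereal 0) (ereal c)) (\<lambda>r. r / sqrt (c\<^sup>2 - r\<^sup>2))"
  proof (rule interval_integral_FTC_nonneg(1)[where F = "\<lambda>r. - sqrt (c\<^sup>2 - r\<^sup>2)" and A = "- sqrt (c\<^sup>2 - 0\<^sup>2)" and B = "- sqrt (c\<^sup>2 - c\<^sup>2)"])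
    fix x assume x: "ereal 0 < ereal x" "ereal x < ereal c"
    then have pos: "c\<^sup>2 - x\<^sup>2 > 0" using power_strict_mono[of x c 2] by simp
    show "((\<lambda>r. - sqrt (c\<^sup>2 - r\<^sup>2)) has_real_derivative x / sqrt (c\<^sup>2 - x\<^sup>2)) (at x)"
      using pos by (auto intro!: derivative_eq_intros simp: field_simps)
    show "isCont (\<lambda>r. r / sqrt (c\<^sup>2 - r\<^sup>2)) x" using pos by (auto intro!: continuous_intros)
  next
    show "AE x in lborel. ereal 0 < ereal x \<longrightarrow> ereal x < ereal c \<longrightarrow> 0 \<le> x / sqrt (c\<^sup>2 - x\<^sup>2)"
      by (intro always_eventually allI impI divide_nonneg_nonneg) (auto simp: abs_le_square_iff[symmetric])
    show "(((\<lambda>r. - sqrt (c\<^sup>2 - r\<^sup>2)) \<circ> real_of_ereal) \<longlongrightarrow> - sqrt (c\<^sup>2 - 0\<^sup>2)) (at_right (ereal 0))"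
      unfolding ereal_tendsto_simps1 by (intro tendsto_intros)
    show "(((\<lambda>r. - sqrt (c\<^sup>2 - r\<^sup>2)) \<circ> real_of_ereal) \<longlongrightarrow> - sqrt (c\<^sup>2 - c\<^sup>2)) (at_left (ereal c))"
      unfolding ereal_tendsto_simps1 by (intro tendsto_intros)
  qed (use c in auto)
  have 2: "set_integrable lborel (einterval (ereal c) (ereal N)) (\<lambda>r. r / sqrt (r\<^sup>2 - c\<^sup>2))"
  proof (rule interval_integral_FTC_nonneg(1)[where F = "\<lambda>r. sqrt (r\<^sup>2 - c\<^sup>2)" and A = "sqrt (c\<^sup>2 - c\<^sup>2)" and B = "sqrt (N\<^sup>2 - c\<^sup>2)"])
    fix x assume x: "ereal c < ereal x" "ereal x < ereal N"
    then have pos: "x\<^sup>2 - c\<^sup>2 > 0" using power_strict_mono[of c x 2] c by simp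
    show "((\<lambda>r. sqrt (r\<^sup>2 - c\<^sup>2)) has_real_derivative x / sqrt (x\<^sup>2 - c\<^sup>2)) (at x)"
      using pos by (auto intro!: derivative_eq_intros simp: field_simps)
    show "isCont (\<lambda>r. r / sqrt (r\<^sup>2 - c\<^sup>2)) x" using pos by (auto intro!: continuous_intros)
  next
    show "AE x in lborel. ereal c < ereal x \<longrightarrow> ereal x < ereal N \<longrightarrow> 0 \<le> x / sqrt (x\<^sup>2 - c\<^sup>2)"
      using c by (intro always_eventually allI impI divide_nonneg_nonneg) (auto simp: abs_le_square_iff[symmetric])
    show "(((\<lambda>r. sqrt (r\<^sup>2 - c\<^sup>2)) \<circ> real_of_ereal) \<longlongrightarrow> sqrt (c\<^sup>2 - c\<^sup>2)) (at_right (ereal c))"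
      unfolding ereal_tendsto_simps1 by (intro tendsto_intros)
    show "(((\<lambda>r. sqrt (r\<^sup>2 - c\<^sup>2)) \<circ> real_of_ereal) \<longlongrightarrow> sqrt (N\<^sup>2 - c\<^sup>2)) (at_left (ereal N))"
      unfolding ereal_tendsto_simps1 by (intro tendsto_intros)
  qed (use N in auto)
  define g where "g r = norm (indicator {0<..<c} r *\<^sub>R (r / sqrt (c\<^sup>2 - r\<^sup>2))) + norm (indicator {c<..<N} r *\<^sub>R (r / sqrt (r\<^sup>2 - c\<^sup>2)))" for r
  have gi: "integrable lborel g"
    unfolding g_def using 1 2 by (intro Bochner_Integration.integrable_add integrable_norm) (simp_all add: set_integrable_def)
  have "indicator {0..M} r * (r / sqrt \<bar>r\<^sup>2 - c\<^sup>2\<bar>) \<le> g r" for r :: real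
  proof -
    consider "r \<le> 0" | "0 < r" "r < c" | "r = c" | "c < r" "r < N" | "r \<ge> N" by linarith
    then show ?thesis
    proof cases
      case 2
      then have "\<bar>r\<^sup>2 - c\<^sup>2\<bar> = c\<^sup>2 - r\<^sup>2" using power_strict_mono[of r c 2] by simp
      then show ?thesis using 2 by (simp add: g_def abs_mult indicator_def)
    next
      case 4
      then have "\<bar>r\<^sup>2 - c\<^sup>2\<bar> = r\<^sup>2 - c\<^sup>2" using power_strict_mono[of c r 2] c by simp
      then show ?thesis using 4 c by (simp add: g_def abs_mult indicator_def)
    qed (use N in \<open>auto simp: g_def indicator_def\<close>)
  qed
  then have "(\<integral>\<^sup>+r. ennreal (indicator {0..M} r * (r / sqrt \<bar>r\<^sup>2 - c\<^sup>2\<bar>)) \<partial>lborel) \<le> (\<integral>\<^sup>+r. ennreal (g r) \<partial>lborel)"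
    by (intro nn_integral_mono ennreal_leI)
  also have "\<dots> < \<infinity>"
    using gi by (subst nn_integral_eq_integral) (auto simp: g_def)
  finally show ?thesis .
qed

text \<open>The integrand is 1 / |kappa| on a disc. This function dominates every passage to the
  limit in the frequency variables and makes the formula for the transform locally
  integrable.\<close>

lemma integrable_inverse_sqrt_disc:
  assumes c: "c > 0"
  shows "integrable lborel (\<lambda>k::real \<times> real. indicator (cball 0 M) k / sqrt \<bar>(norm k)\<^sup>2 - c\<^sup>2\<bar>)"
proof (rule integrableI_bounded)
  have "(\<integral>\<^sup>+k. ennreal (norm (indicator (cball 0 M) (k::real \<times> real) / sqrt \<bar>(norm k)\<^sup>2 - c\<^sup>2\<bar> :: real)) \<partial>lborel)
    = (\<integral>\<^sup>+k. ennreal (indicator {..M} (norm (k::real \<times> real)) / sqrt \<bar>(norm k)\<^sup>2 - c\<^sup>2\<bar>) \<partial>lborel)"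
    by (intro nn_integral_cong) (auto simp: indicator_def)
  also have "\<dots> = (\<integral>\<^sup>+r. ennreal (2 * pi * r) * indicator {0..} r * ennreal (indicator {..M} r / sqrt \<bar>r\<^sup>2 - c\<^sup>2\<bar>) \<partial>lborel)"
    by (subst nn_integral_radial[where F = "\<lambda>r. ennreal (indicator {..M} r / sqrt \<bar>r\<^sup>2 - c\<^sup>2\<bar>)"]) (auto simp: unit_ball_vol_2)
  also have "\<dots> = (\<integral>\<^sup>+r. ennreal (2 * pi) * ennreal (indicator {0..M} r * (r / sqrt \<bar>r\<^sup>2 - c\<^sup>2\<bar>)) \<partial>lborel)"
    by (intro nn_integral_cong) (auto simp: indicator_def ennreal_mult[symmetric] simp del: ennreal_mult)
  also have "\<dots> = ennreal (2 * pi) * (\<integral>\<^sup>+r. ennreal (indicator {0..M} r * (r / sqrt \<bar>r\<^sup>2 - c\<^sup>2\<bar>)) \<partial>lborel)"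
    by (rule nn_integral_cmult) measurable
  also have "\<dots> < \<infinity>"
    using nn_integral_inverse_sqrt_finite[OF c, of M] by (simp add: ennreal_mult_less_top)
  finally show "(\<integral>\<^sup>+k. ennreal (norm (indicator (cball 0 M) (k::real \<times> real) / sqrt \<bar>(norm k)\<^sup>2 - c\<^sup>2\<bar> :: real)) \<partial>lborel) < \<infinity>" .
next
  have "(\<lambda>k::real \<times> real. indicator (cball 0 M) k :: real) \<in> borel_measurable borel"
    by (rule borel_measurable_indicator) simp
  moreover have "(\<lambda>k::real \<times> real. sqrt \<bar>(norm k)\<^sup>2 - c\<^sup>2\<bar>) \<in> borel_measurable borel"
    by (intro borel_measurable_continuous_onI continuous_intros)
  ultimately show "(\<lambda>k::real \<times> real. indicator (cball 0 M) k / sqrt \<bar>(norm k)\<^sup>2 - c\<^sup>2\<bar>) \<in> borel_measurable lborel"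
    by simp
qed

lemma norm_kappa: "norm (kappa c (fst k) (snd k)) = sqrt \<bar>(norm k)\<^sup>2 - c\<^sup>2\<bar>"
proof -
  have "(norm k)\<^sup>2 = (fst k)\<^sup>2 + (snd k)\<^sup>2" by (simp add: norm_prod_def)
  then show ?thesis by (simp add: kappa_def norm_mult)
qed

lemma norm_exp_kappa_le: "z \<ge> 0 \<Longrightarrow> norm (exp (\<i> * kappa c k1 k2 * of_real z)) \<le> 1"
  by (auto simp: norm_exp_eq_Re kappa_def)

text \<open>Here the branch of kappa is decided. For |k| < c the radicand approaches the cut of the
  principal root from below, where the root tends to -i times a positive number, that is to -i
  kappa. From above the opposite sign, and with it the incoming solution, would result.\<close>

lemma csqrt_limit_kappa:
  assumes c: "c > 0" and k: "norm k \<noteq> c"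
    and t: "\<And>n. t n > 0" "t \<longlonglongrightarrow> 0"
  shows "(\<lambda>n. csqrt (of_real ((norm k)\<^sup>2 - c\<^sup>2) - \<i> * of_real (t n))) \<longlonglongrightarrow> - \<i> * kappa c (fst k) (snd k)"
proof -
  have nk: "(norm k)\<^sup>2 = (fst k)\<^sup>2 + (snd k)\<^sup>2" by (simp add: norm_prod_def)
  show ?thesis
  proof (cases "norm k > c")
    case True
    then have pos: "(norm k)\<^sup>2 - c\<^sup>2 > 0" using c power_strict_mono[of c "norm k" 2] by simp
    have "(\<lambda>n. csqrt (of_real ((norm k)\<^sup>2 - c\<^sup>2) - \<i> * of_real (t n))) \<longlonglongrightarrow> csqrt (of_real ((norm k)\<^sup>2 - c\<^sup>2) - \<i> * of_real 0)"
    proof (rule isCont_tendsto_compose[OF continuous_at_csqrt])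
      show "(\<lambda>n. of_real ((norm k)\<^sup>2 - c\<^sup>2) - \<i> * of_real (t n)) \<longlonglongrightarrow> of_real ((norm k)\<^sup>2 - c\<^sup>2) - \<i> * of_real 0"
        by (intro tendsto_intros t)
    qed (use pos in \<open>simp add: complex_nonpos_Reals_iff\<close>)
    also have "csqrt (of_real ((norm k)\<^sup>2 - c\<^sup>2) - \<i> * of_real 0) = of_real (sqrt ((norm k)\<^sup>2 - c\<^sup>2))"
      using pos by simp
    also have "\<dots> = - \<i> * kappa c (fst k) (snd k)" using pos by (simp add: kappa_def nk)
    finally show ?thesis .
  next
    case False
    define L where "L = c\<^sup>2 - (norm k)\<^sup>2"
    have pos: "L > 0" using False k power_strict_mono[of "norm k" c 2] by (simp add: L_def)
    \<comment> \<open>Turning the root by -i moves the radicand away from the cut. The sign is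
      certified by 2 Re w Im w = t > 0 and Re w \<ge> 0, which force Im w > 0.\<close>
    have eq: "csqrt (of_real ((norm k)\<^sup>2 - c\<^sup>2) - \<i> * of_real (t n)) = - \<i> * csqrt (of_real L + \<i> * of_real (t n))" for n
    proof (rule csqrt_unique)
      define w where "w = csqrt (of_real L + \<i> * of_real (t n))"
      have w2: "w\<^sup>2 = of_real L + \<i> * of_real (t n)" by (simp add: w_def)
      then show "(- \<i> * csqrt (of_real L + \<i> * of_real (t n)))\<^sup>2 = of_real ((norm k)\<^sup>2 - c\<^sup>2) - \<i> * of_real (t n)"
        unfolding w_def[symmetric] by (simp add: power_mult_distrib L_def)
      have "Im (w\<^sup>2) = t n" using w2 by simp
      then have "2 * Re w * Im w = t n" by (simp add: power2_eq_square mult_ac)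
      moreover have "Re w \<ge> 0" unfolding w_def by (rule Re_csqrt)
      ultimately have "Im w > 0" using t(1)[of n] by (smt (verit) mult_nonneg_nonpos)
      then show "0 < Re (- \<i> * csqrt (of_real L + \<i> * of_real (t n))) \<or> Re (- \<i> * csqrt (of_real L + \<i> * of_real (t n))) = 0 \<and> 0 \<le> Im (- \<i> * csqrt (of_real L + \<i> * of_real (t n)))"
        unfolding w_def[symmetric] by simp
    qed
    have "(\<lambda>n. csqrt (of_real L + \<i> * of_real (t n))) \<longlonglongrightarrow> csqrt (of_real L + \<i> * of_real 0)"
    proof (rule isCont_tendsto_compose[OF continuous_at_csqrt])
      show "(\<lambda>n. of_real L + \<i> * of_real (t n)) \<longlonglongrightarrow> of_real L + \<i> * of_real 0"
        by (intro tendsto_intros t)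
    qed (use pos in \<open>simp add: complex_nonpos_Reals_iff\<close>)
    then have "(\<lambda>n. - \<i> * csqrt (of_real L + \<i> * of_real (t n))) \<longlonglongrightarrow> - \<i> * csqrt (of_real L + \<i> * of_real 0)"
      by (intro tendsto_intros)
    also have "csqrt (of_real L + \<i> * of_real 0) = of_real (sqrt L)"
      using pos by simp
    also have "complex_of_real (sqrt L) = kappa c (fst k) (snd k)" using pos by (simp add: kappa_def nk L_def)
    finally show ?thesis unfolding eq .
  qed
qed

lemma measurable_kappa [measurable]:
  "(\<lambda>k. kappa c (fst k) (snd k)) \<in> borel_measurable (borel :: (real \<times> real) measure)"
proof -
  have [measurable]: "(fst :: real \<times> real \<Rightarrow> real) \<in> borel_measurable borel" "(snd :: real \<times> real \<Rightarrow> real) \<in> borel_measurable borel"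
    by (intro borel_measurable_continuous_onI continuous_intros)+
  show ?thesis unfolding kappa_def by measurable
qed

text \<open>Without absorption the kernel decays only like 1 / |p| in the plane, so its transform is
  no absolutely convergent integral. Pairing with f before the limit moves the convergence to the
  transform of f, assumed integrable, and to 1 / |kappa|.\<close>

lemma weyl_outgoing:
  fixes f :: "real \<times> real \<Rightarrow> complex"
  assumes c: "c > 0" and z: "z > 0" and [measurable]: "f \<in> borel_measurable borel"
    and B: "\<And>k. norm (f k) \<le> B * indicator (cball 0 M) k"
    and fh: "integrable lborel (\<lambda>p. \<integral>k. f k * osc12 k p \<partial>lborel)"
  shows "(\<integral>p. outgoing c (hyp z p) * (\<integral>k. f k * osc12 k p \<partial>lborel) \<partial>lborel)
    = (\<integral>k. f k * (\<i> / (2 * kappa c (fst k) (snd k)) * exp (\<i> * kappa c (fst k) (snd k) * of_real z)) \<partial>lborel)"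
proof -
  define fhat where "fhat p = (\<integral>k. f k * osc12 k p \<partial>lborel)" for p
  define \<kappa> where "\<kappa> k = kappa c (fst k) (snd k)" for k
  have [measurable]: "\<kappa> \<in> borel_measurable borel" unfolding \<kappa>_def[abs_def] by measurable
  have fhi: "integrable lborel fhat" using fh by (simp add: fhat_def[abs_def])
  then have [measurable]: "fhat \<in> borel_measurable borel" by (auto dest: borel_measurable_integrable)
  have fi: "integrable lborel f"
    by (rule Bochner_Integration.integrable_bound[OF integrable_indicator_cball[of B M]])
       (use B in \<open>auto intro!: always_eventually order_trans[OF B] simp: abs_mult mult_right_mono\<close>)
  define t where "t n = inverse (real (Suc n))" for n
  have t: "t n > 0" "t \<longlonglongrightarrow> 0" for n unfolding t_def[abs_def] by (simp, rule LIMSEQ_inverse_real_of_nat)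
  \<comment> \<open>The imaginary part is tuned so that the real part of a^2 + |k|^2 is exactly
    |k|^2 - c^2 for every n. Hence |b| is at least |kappa|, a bound uniform in n; the negative sign
    gives the limit -ic of the outgoing wave.\<close>
  define a where "a n = of_real (t n) - \<i> * of_real (sqrt (c\<^sup>2 + (t n)\<^sup>2))" for n
  have Rea: "Re (a n) = t n" for n by (simp add: a_def)
  have a2: "(a n)\<^sup>2 + of_real ((norm k)\<^sup>2) = of_real ((norm k)\<^sup>2 - c\<^sup>2) - \<i> * of_real (2 * t n * sqrt (c\<^sup>2 + (t n)\<^sup>2))" for n and k :: "real \<times> real"
  proof -
    have "(complex_of_real (sqrt (c\<^sup>2 + (t n)\<^sup>2)))\<^sup>2 = of_real (c\<^sup>2 + (t n)\<^sup>2)"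
      by (simp only: of_real_power[symmetric]) simp
    then show ?thesis by (simp add: a_def power2_diff power_mult_distrib algebra_simps)
  qed
  define b where "b n k = csqrt ((a n)\<^sup>2 + of_real ((norm k)\<^sup>2))" for n and k :: "real \<times> real"
  have [measurable]: "b n \<in> borel_measurable borel" for n
  proof -
    have "(a n)\<^sup>2 + of_real ((norm k)\<^sup>2) \<notin> \<real>\<^sub>\<le>\<^sub>0" for k :: "real \<times> real"
      unfolding a2 using t(1)[of n] c by (auto simp: complex_nonpos_Reals_iff add_pos_nonneg)
    then show ?thesis unfolding b_def[abs_def]
      by (intro borel_measurable_continuous_onI continuous_at_imp_continuous_on ballI isCont_o2[OF _ continuous_at_csqrt] continuous_intros)
  qed
  have alim: "a \<longlonglongrightarrow> - \<i> * of_real c"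
  proof -
    have "a \<longlonglongrightarrow> of_real 0 - \<i> * of_real (sqrt (c\<^sup>2 + 0\<^sup>2))"
      unfolding a_def[abs_def] by (intro tendsto_intros t)
    then show ?thesis using c by simp
  qed
  have fubini: "(\<integral>p. exp (- a n * of_real (hyp z p)) / of_real (hyp z p) * fhat p \<partial>lborel)
     = (\<integral>k. f k * (2 * of_real pi * exp (- b n k * of_real z) / b n k) \<partial>lborel)" for n
  proof -
    define e where "e p = exp (- a n * of_real (hyp z p)) / of_real (hyp z p)" for p
    have [measurable]: "e \<in> borel_measurable borel" unfolding e_def[abs_def] by measurable
    have we: "has_bochner_integral lborel (\<lambda>p. e p * osc12 k p) (2 * of_real pi * exp (- b n k * of_real z) / b n k)" for k
      unfolding e_def b_def by (rule weyl_complex) (use Rea t z in auto)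
    have en: "integrable lborel (\<lambda>p. norm (e p))"
    proof -
      have "integrable lborel (\<lambda>p. norm (e p * osc12 0 p))"
        using we[of 0] by (intro integrable_norm) (simp add: has_bochner_integral_iff)
      then show ?thesis by (simp add: norm_mult)
    qed
    have i: "integrable (lborel \<Otimes>\<^sub>M lborel) (\<lambda>(k, p). f k * (e p * osc12 k p))"
    proof (rule lborel_pair.Fubini_integrable)
      show "integrable lborel (\<lambda>k. \<integral>p. norm (case (k, p) of (k, p) \<Rightarrow> f k * (e p * osc12 k p)) \<partial>lborel)"
        using fi by (simp add: norm_mult)
      show "AE k in lborel. integrable lborel (\<lambda>p. case (k, p) of (k, p) \<Rightarrow> f k * (e p * osc12 k p))"
        using we by (simp add: has_bochner_integral_iff)
    qed measurable
    have "(\<integral>p. e p * fhat p \<partial>lborel) = (\<integral>p. \<integral>k. f k * (e p * osc12 k p) \<partial>lborel \<partial>lborel)"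
      unfolding fhat_def integral_mult_right_zero[symmetric] by (simp only: mult_ac)
    also have "\<dots> = (\<integral>k. \<integral>p. f k * (e p * osc12 k p) \<partial>lborel \<partial>lborel)"
      using lborel_pair.Fubini_integral[OF i] .
    also have "\<dots> = (\<integral>k. f k * (2 * of_real pi * exp (- b n k * of_real z) / b n k) \<partial>lborel)"
      using we by (simp add: has_bochner_integral_iff)
    finally show ?thesis by (simp add: e_def)
  qed
  \<comment> \<open>The exponential has modulus at most 1 and the distance is at least z > 0, so the
    transform of f divided by z dominates.\<close>
  have left: "(\<lambda>n. \<integral>p. exp (- a n * of_real (hyp z p)) / of_real (hyp z p) * fhat p \<partial>lborel)
    \<longlonglongrightarrow> (\<integral>p. exp (- (- \<i> * of_real c) * of_real (hyp z p)) / of_real (hyp z p) * fhat p \<partial>lborel)"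
  proof (rule integral_dominated_convergence[where w = "\<lambda>p. norm (fhat p) / z"])
    show "AE p in lborel. (\<lambda>n. exp (- a n * of_real (hyp z p)) / of_real (hyp z p) * fhat p) \<longlonglongrightarrow> exp (- (- \<i> * of_real c) * of_real (hyp z p)) / of_real (hyp z p) * fhat p"
      using hyp_pos[OF z] by (intro always_eventually allI tendsto_intros alim) (metis less_irrefl of_real_eq_0_iff)
    show "AE p in lborel. norm (exp (- a n * of_real (hyp z p)) / of_real (hyp z p) * fhat p) \<le> norm (fhat p) / z" for n
    proof (intro always_eventually allI)
      fix p
      have "norm (exp (- a n * of_real (hyp z p))) \<le> 1"
        using t(1)[of n] hyp_nonneg[of z p] by (simp add: norm_exp_eq_Re Rea)
      moreover have "hyp z p \<ge> z" by (rule hyp_ge[OF z])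
      ultimately have "norm (exp (- a n * of_real (hyp z p)) / of_real (hyp z p)) \<le> 1 / z"
        using z by (simp add: norm_divide frac_le)
      then have "norm (exp (- a n * of_real (hyp z p)) / of_real (hyp z p) * fhat p) \<le> (1 / z) * norm (fhat p)"
        unfolding norm_mult[of "exp (- a n * of_real (hyp z p)) / of_real (hyp z p)"] by (rule mult_right_mono) simp
      then show "norm (exp (- a n * of_real (hyp z p)) / of_real (hyp z p) * fhat p) \<le> norm (fhat p) / z" by simp
    qed
  qed (use fhi in auto)
  \<comment> \<open>Off the null circle |k| = c the roots converge to -i kappa, which is nonzero
    there. The lower bound on |b| gives the dominating function.\<close>
  have right: "(\<lambda>n. \<integral>k. f k * (2 * of_real pi * exp (- b n k * of_real z) / b n k) \<partial>lborel)
    \<longlonglongrightarrow> (\<integral>k. f k * (2 * of_real pi * exp (- (- \<i> * \<kappa> k) * of_real z) / (- \<i> * \<kappa> k)) \<partial>lborel)"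
  proof (rule integral_dominated_convergence[where w = "\<lambda>k. (2 * pi * B) * (indicator (cball 0 M) k / sqrt \<bar>(norm k)\<^sup>2 - c\<^sup>2\<bar>)"])
    show "integrable lborel (\<lambda>k::real \<times> real. (2 * pi * B) * (indicator (cball 0 M) k / sqrt \<bar>(norm k)\<^sup>2 - c\<^sup>2\<bar>))"
      by (intro integrable_mult_right integrable_inverse_sqrt_disc c)
    show "AE k in lborel. (\<lambda>n. f k * (2 * of_real pi * exp (- b n k * of_real z) / b n k)) \<longlonglongrightarrow> f k * (2 * of_real pi * exp (- (- \<i> * \<kappa> k) * of_real z) / (- \<i> * \<kappa> k))"
      using AE_norm_neq[of c]
    proof eventually_elim
      case (elim k)
      have "\<bar>(norm k)\<^sup>2 - c\<^sup>2\<bar> > 0" using elim c norm_ge_zero[of k] by (auto simp: power2_eq_iff simp del: norm_ge_zero)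
      then have "norm (\<kappa> k) > 0" unfolding \<kappa>_def norm_kappa by simp
      then have k0: "- \<i> * \<kappa> k \<noteq> 0" by auto
      have "(\<lambda>n. 2 * t n * sqrt (c\<^sup>2 + (t n)\<^sup>2)) \<longlonglongrightarrow> 2 * 0 * sqrt (c\<^sup>2 + 0\<^sup>2)" by (intro tendsto_intros t)
      then have "(\<lambda>n. b n k) \<longlonglongrightarrow> - \<i> * \<kappa> k"
        unfolding b_def a2 \<kappa>_def using t(1) c by (intro csqrt_limit_kappa[OF c elim]) (auto intro!: mult_pos_pos add_pos_nonneg)
      then show ?case using k0 by (intro tendsto_intros)
    qed
    show "AE k in lborel. norm (f k * (2 * of_real pi * exp (- b n k * of_real z) / b n k)) \<le> (2 * pi * B) * (indicator (cball 0 M) k / sqrt \<bar>(norm k)\<^sup>2 - c\<^sup>2\<bar>)" for n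
      using AE_norm_neq[of c]
    proof eventually_elim
      case (elim k)
      have pos: "\<bar>(norm k)\<^sup>2 - c\<^sup>2\<bar> > 0" using elim c norm_ge_zero[of k] by (auto simp: power2_eq_iff simp del: norm_ge_zero)
      have "norm (b n k) ^ 2 = norm ((a n)\<^sup>2 + of_real ((norm k)\<^sup>2))" unfolding b_def norm_power[symmetric] by simp
      also have "\<dots> \<ge> \<bar>Re ((a n)\<^sup>2 + of_real ((norm k)\<^sup>2))\<bar>" by (rule abs_Re_le_cmod)
      finally have "\<bar>(norm k)\<^sup>2 - c\<^sup>2\<bar> \<le> norm (b n k) ^ 2" unfolding a2 by simp
      then have bn: "sqrt \<bar>(norm k)\<^sup>2 - c\<^sup>2\<bar> \<le> norm (b n k)" by (simp add: real_le_lsqrt)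
      have "Re (b n k) \<ge> 0" unfolding b_def by (rule Re_csqrt)
      then have e1: "norm (exp (- b n k * of_real z)) \<le> 1" using z by (simp add: norm_exp_eq_Re)
      have "norm (2 * of_real pi * exp (- b n k * of_real z) / b n k) = 2 * pi * norm (exp (- b n k * of_real z)) / norm (b n k)"
        by (simp add: norm_mult norm_divide)
      also have "\<dots> \<le> 2 * pi * 1 / sqrt \<bar>(norm k)\<^sup>2 - c\<^sup>2\<bar>"
        using e1 bn pos by (intro frac_le mult_left_mono) auto
      finally have "norm (f k * (2 * of_real pi * exp (- b n k * of_real z) / b n k)) \<le> (B * indicator (cball 0 M) k) * (2 * pi * 1 / sqrt \<bar>(norm k)\<^sup>2 - c\<^sup>2\<bar>)"
        unfolding norm_mult[of "f k"] by (intro mult_mono B order_trans[OF norm_ge_zero B]) auto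
      then show ?case by (simp add: mult_ac)
    qed
  qed measurable
  have "(\<integral>p. exp (- (- \<i> * of_real c) * of_real (hyp z p)) / of_real (hyp z p) * fhat p \<partial>lborel)
     = (\<integral>k. f k * (2 * of_real pi * exp (- (- \<i> * \<kappa> k) * of_real z) / (- \<i> * \<kappa> k)) \<partial>lborel)"
    using LIMSEQ_unique[OF left[unfolded fubini] right] .
  then have "1 / (4 * of_real pi) * (\<integral>p. exp (- (- \<i> * of_real c) * of_real (hyp z p)) / of_real (hyp z p) * fhat p \<partial>lborel)
     = 1 / (4 * of_real pi) * (\<integral>k. f k * (2 * of_real pi * exp (- (- \<i> * \<kappa> k) * of_real z) / (- \<i> * \<kappa> k)) \<partial>lborel)"
    by (rule arg_cong)
  also have "1 / (4 * of_real pi) * (\<integral>p. exp (- (- \<i> * of_real c) * of_real (hyp z p)) / of_real (hyp z p) * fhat p \<partial>lborel)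
    = (\<integral>p. outgoing c (hyp z p) * fhat p \<partial>lborel)"
    unfolding integral_mult_right_zero[symmetric] by (intro Bochner_Integration.integral_cong) (auto simp: outgoing_def)
  also have "1 / (4 * of_real pi) * (\<integral>k. f k * (2 * of_real pi * exp (- (- \<i> * \<kappa> k) * of_real z) / (- \<i> * \<kappa> k)) \<partial>lborel)
    = (\<integral>k. f k * (\<i> / (2 * \<kappa> k) * exp (\<i> * \<kappa> k * of_real z)) \<partial>lborel)"
    unfolding integral_mult_right_zero[symmetric]
  proof (intro Bochner_Integration.integral_cong refl)
    fix k
    have "2 * of_real pi * E / (- \<i> * \<kappa> k) = (4 * of_real pi) * (\<i> / (2 * \<kappa> k) * E)" for E
      by (cases "\<kappa> k = 0") (auto simp: field_simps)
    then show "1 / (4 * of_real pi) * (f k * (2 * of_real pi * exp (- (- \<i> * \<kappa> k) * of_real z) / (- \<i> * \<kappa> k))) = f k * (\<i> / (2 * \<kappa> k) * exp (\<i> * \<kappa> k * of_real z))"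
      by simp
  qed
  finally show ?thesis by (simp add: fhat_def \<kappa>_def)
qed

section \<open>Convolution kernels\<close>

text \<open>In polar coordinates the integrand is at most a multiple of 1 / (1 + r)^2, since r^(n-1)
  \<le> (1 + r)^(n-1) for dimension n.\<close>

lemma integrable_inverse_power_norm:
  "integrable lborel (\<lambda>x::'a::euclidean_space. 1 / (1 + norm x) ^ (DIM('a) + 1))"
proof (rule integrableI_bounded)
  let ?d = "DIM('a)"
  have FTC: "has_bochner_integral lborel (\<lambda>v. indicator {0<..} v *\<^sub>R (1 / (1 + v)\<^sup>2)) (0 - (- (1 / (1 + 0))) :: real)"
  proof (rule has_bochner_integral_FTC_half_line[where F = "\<lambda>v. - (1 / (1 + v))"])
    show "((\<lambda>v. - (1 / (1 + v))) has_real_derivative 1 / (1 + v)\<^sup>2) (at v)" if "v > 0" for v :: real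
      using that by (auto intro!: derivative_eq_intros simp: power2_eq_square)
    show "((\<lambda>v::real. - (1 / (1 + v))) \<longlongrightarrow> - (1 / (1 + 0))) (at_right 0)"
      by (intro tendsto_intros) auto
    show "((\<lambda>v::real. - (1 / (1 + v))) \<longlongrightarrow> 0) at_top" by real_asymp
  qed (auto intro!: continuous_intros)
  have i: "integrable lborel (\<lambda>v::real. indicator {0<..} v *\<^sub>R (1 / (1 + v)\<^sup>2) :: real)"
    using FTC by (simp only: has_bochner_integral_iff)
  have "(\<integral>\<^sup>+x. ennreal (norm (1 / (1 + norm (x::'a)) ^ (?d + 1))) \<partial>lborel) = (\<integral>\<^sup>+x. ennreal (1 / (1 + norm (x::'a)) ^ (?d + 1)) \<partial>lborel)"
    by (intro nn_integral_cong) (auto simp: abs_of_nonneg)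
  also have "\<dots> = (\<integral>\<^sup>+r. ennreal (?d * unit_ball_vol ?d * r ^ (?d - 1)) * indicator {0..} r * ennreal (1 / (1 + r) ^ (?d + 1)) \<partial>lborel)"
    by (rule nn_integral_radial[where F = "\<lambda>r. ennreal (1 / (1 + r) ^ (?d + 1))"]) measurable
  also have "\<dots> \<le> (\<integral>\<^sup>+r. ennreal (?d * unit_ball_vol ?d) * ennreal (indicator {0<..} r *\<^sub>R (1 / (1 + r)\<^sup>2)) \<partial>lborel)"
  proof (rule nn_integral_mono_AE, use AE_lborel_singleton[of "0::real"] in eventually_elim)
    case (elim r)
    show ?case
    proof (cases "r > 0")
      case True
      have "r ^ (?d - 1) * (1 + r)\<^sup>2 \<le> (1 + r) ^ (?d - 1) * (1 + r)\<^sup>2"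
        using True by (intro mult_right_mono power_mono) auto
      also have "\<dots> = (1 + r) ^ (?d + 1)"
        using DIM_positive[where 'a = 'a] by (simp add: power_add[symmetric])
      finally have "r ^ (?d - 1) * (1 + r)\<^sup>2 \<le> (1 + r) ^ (?d + 1)" .
      then have "r ^ (?d - 1) * (1 / (1 + r) ^ (?d + 1)) \<le> 1 / (1 + r)\<^sup>2"
      proof -
        have "p * (1 / X) \<le> 1 / Y" if "p * Y \<le> X" "X > 0" "Y > 0" for p X Y :: real
          using that by (simp add: field_simps)
        then show ?thesis using \<open>r ^ (?d - 1) * (1 + r)\<^sup>2 \<le> (1 + r) ^ (?d + 1)\<close> True by simp
      qed
      then have "(?d * unit_ball_vol ?d) * (r ^ (?d - 1) * (1 / (1 + r) ^ (?d + 1))) \<le> (?d * unit_ball_vol ?d) * (1 / (1 + r)\<^sup>2)"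
        by (intro mult_left_mono) auto
      then show ?thesis using True by (simp add: ennreal_mult[symmetric] ennreal_leI mult.assoc)
    qed (use elim in auto)
  qed
  also have "\<dots> = ennreal (?d * unit_ball_vol ?d) * (\<integral>\<^sup>+r. ennreal (indicator {0<..} r *\<^sub>R (1 / (1 + r)\<^sup>2)) \<partial>lborel)"
    by (rule nn_integral_cmult) measurable
  also have "(\<integral>\<^sup>+r. ennreal (indicator {0<..} r *\<^sub>R (1 / (1 + r)\<^sup>2)) \<partial>lborel) = ennreal (\<integral>r. indicator {0<..} r *\<^sub>R (1 / (1 + r)\<^sup>2) \<partial>lborel)"
    by (rule nn_integral_eq_integral[OF i]) auto
  also have "ennreal (?d * unit_ball_vol ?d) * \<dots> < \<infinity>" by (simp add: ennreal_mult_less_top)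
  finally show "(\<integral>\<^sup>+x. ennreal (norm (1 / (1 + norm (x::'a)) ^ (?d + 1))) \<partial>lborel) < \<infinity>" .
next
  show "(\<lambda>x::'a. 1 / (1 + norm x) ^ (DIM('a) + 1)) \<in> borel_measurable lborel" by measurable
qed

lemma integrable_weight3: "integrable lborel (\<lambda>x::real^3. 1 / (1 + norm x) ^ 4)"
  using integrable_inverse_power_norm[where 'a = "real^3"] by simp

lemma integrable_inverse_norm_ball:
  "integrable lborel (\<lambda>x::real^3. indicator (cball 0 1) x / norm x)"
proof (rule integrableI_bounded)
  have "(\<integral>\<^sup>+x. ennreal (norm (indicator (cball 0 1) (x::real^3) / norm x)) \<partial>lborel) = (\<integral>\<^sup>+x. ennreal (indicator {..1} (norm (x::real^3)) / norm x) \<partial>lborel)"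
    by (intro nn_integral_cong) (auto simp: indicator_def)
  also have "\<dots> = (\<integral>\<^sup>+r. ennreal (4 * pi * r ^ 2) * indicator {0..} r * ennreal (indicator {..1} r / r) \<partial>lborel)"
    by (subst nn_integral_radial[where F = "\<lambda>r. ennreal (indicator {..1} r / r)"]) (auto simp: unit_ball_vol_3)
  also have "\<dots> \<le> (\<integral>\<^sup>+r. ennreal (4 * pi) * indicator {0..1} (r::real) \<partial>lborel)"
  proof (rule nn_integral_mono)
    fix r :: real
    have "4 * pi * r\<^sup>2 * (1 / r) \<le> 4 * pi" if "0 < r" "r \<le> 1" using that by (simp add: power2_eq_square)
    then show "ennreal (4 * pi * r ^ 2) * indicator {0..} r * ennreal (indicator {..1} r / r) \<le> ennreal (4 * pi) * indicator {0..1} r"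
      by (cases "r > 0") (auto simp: indicator_def ennreal_mult[symmetric] ennreal_leI)
  qed
  also have "\<dots> < \<infinity>" by (simp add: nn_integral_cmult_indicator ennreal_mult_less_top)
  finally show "(\<integral>\<^sup>+x. ennreal (norm (indicator (cball 0 1) (x::real^3) / norm x)) \<partial>lborel) < \<infinity>" .
next
  have [measurable]: "(\<lambda>x::real^3. indicator (cball 0 1) x :: real) \<in> borel_measurable borel"
    by (rule borel_measurable_indicator) simp
  show "(\<lambda>x::real^3. indicator (cball 0 1) x / norm x) \<in> borel_measurable lborel" by simp
qed

text \<open>The kernel has mass close to 1. Its radial integrand A is an exact derivative plus B,
  where B carries no derivative of the step; B is O(r) on an interval of length 2 e, whence the
  error e^2.\<close>

lemma integral_outgoing_ker_estimate:
  obtains C where "\<And>e. 0 < e \<Longrightarrow> norm ((\<integral>x. outgoing_ker k e (norm x) \<partial>(lborel :: (real^3) measure)) - 1) \<le> C * e\<^sup>2"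
proof -
  obtain C where C: "C \<ge> 1" "\<And>t. norm (step t) \<le> C" using step_bounded by metis
  show thesis
  proof (rule that[of "4 * C * k\<^sup>2"])
    fix e :: real assume e: "0 < e"
    define E where "E r = exp (\<i> * of_real k * of_real r)" for r
    have E: "(E has_vector_derivative \<i> * of_real k * E r) (at r)" for r
    proof -
      have "((\<lambda>z. exp (\<i> * of_real k * z)) has_field_derivative \<i> * of_real k * exp (\<i> * of_real k * of_real r)) (at (complex_of_real r))"
        by (auto intro!: derivative_eq_intros)
      from has_vector_derivative_real_field[OF this] show ?thesis by (simp add: E_def[abs_def])
    qed
    define A where "A r = (step2 (r / e - 1) / of_real e / of_real e + 2 * \<i> * of_real k * (step1 (r / e - 1) / of_real e)) * (of_real r * E r)" for r
    define B where "B r = step (r / e - 1) * (of_real (k\<^sup>2) * of_real r * E r)" for r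
    \<comment> \<open>Obtained by integrating the derivatives of the step in A by parts. F is 0 at 2
      e, where the step and its derivative vanish, and -1 at 0, where the step is 1; this difference
      is the mass 1.\<close>
    define F where "F r = (step1 (r / e - 1) / of_real e) * (of_real r * E r) - step (r / e - 1) * ((1 - \<i> * of_real k * of_real r) * E r)" for r
    have F: "(F has_vector_derivative A r - B r) (at r)" for r
    proof -
      have r: "(complex_of_real has_vector_derivative 1) (at r)"
      proof -
        have "((\<lambda>r. complex_of_real r) has_vector_derivative of_real 1) (at r)"
          by (rule has_vector_derivative_of_real[OF DERIV_ident])
        then show ?thesis by simp
      qed
      have s1: "((\<lambda>r. step1 (r / e - 1) / of_real e) has_vector_derivative step2 (r / e - 1) / of_real e / of_real e) (at r)"
        by (intro has_vector_derivative_divide vector_derivative_affine step_deriv) (use e in auto)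
      have s0: "((\<lambda>r. step (r / e - 1)) has_vector_derivative step1 (r / e - 1) / of_real e) (at r)"
        by (intro vector_derivative_affine step_deriv) (use e in auto)
      have q: "((\<lambda>r. 1 - \<i> * of_real k * of_real r) has_vector_derivative 0 - \<i> * of_real k * 1) (at r)"
        by (intro has_vector_derivative_diff has_vector_derivative_const has_vector_derivative_mult_right r)
      from has_vector_derivative_diff[OF has_vector_derivative_mult[OF s1 has_vector_derivative_mult[OF r E]]
          has_vector_derivative_mult[OF s0 has_vector_derivative_mult[OF q E]]]
      show ?thesis unfolding F_def[abs_def]
        by (rule has_vector_derivative_eq_rhs) (simp add: A_def B_def algebra_simps power2_eq_square)
    qed
    have contE: "continuous_on S E" for S unfolding E_def by (intro continuous_intros)
    have cont: "continuous_on S A" "continuous_on S B" for S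
      unfolding A_def B_def using e
      by (intro continuous_intros contE continuous_on_compose2[OF continuous_step(1)[of UNIV]] continuous_on_compose2[OF continuous_step(2)[of UNIV]] continuous_on_compose2[OF continuous_step(3)[of UNIV]]; simp)+
    have "has_bochner_integral lborel (\<lambda>r. indicator {0..2 * e} r *\<^sub>R (A r - B r)) (F (2 * e) - F 0)"
    proof (rule has_bochner_integral_FTC_Icc)
      show "0 \<le> 2 * e" using e by simp
      show "(F has_vector_derivative A r - B r) (at r within {0..2 * e})" for r
        by (rule has_vector_derivative_at_within[OF F])
      show "continuous_on {0..2 * e} (\<lambda>r. A r - B r)"
        by (intro continuous_on_diff cont)
    qed
    moreover have "F (2 * e) - F 0 = 1" using e by (simp add: F_def step_eq step_deriv_zero E_def)
    ultimately have F1: "has_bochner_integral lborel (\<lambda>r. indicator {0..2 * e} r *\<^sub>R (A r - B r)) 1" by simp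
    have Bi: "integrable lborel (\<lambda>r. indicator {0..2 * e} r *\<^sub>R B r)"
      using borel_integrable_atLeastAtMost'[of 0 "2 * e" B] cont by (simp add: set_integrable_def)
    have Ai: "(\<integral>r. indicator {0..2 * e} r *\<^sub>R A r \<partial>lborel) = 1 + (\<integral>r. indicator {0..2 * e} r *\<^sub>R B r \<partial>lborel)"
    proof -
      have "(\<integral>r. indicator {0..2 * e} r *\<^sub>R A r \<partial>lborel) = (\<integral>r. indicator {0..2 * e} r *\<^sub>R (A r - B r) + indicator {0..2 * e} r *\<^sub>R B r \<partial>lborel)"
        by (simp add: scaleR_diff_right)
      also have "\<dots> = 1 + (\<integral>r. indicator {0..2 * e} r *\<^sub>R B r \<partial>lborel)"
        using F1 Bi by (subst Bochner_Integration.integral_add) (simp_all add: has_bochner_integral_iff)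
      finally show ?thesis .
    qed
    have "(\<integral>x. outgoing_ker k e (norm x) \<partial>(lborel :: (real^3) measure)) = (\<integral>r. (4 * pi * r\<^sup>2 * indicator {0..} r) *\<^sub>R outgoing_ker k e r \<partial>lborel)"
      by (subst radial_integral[where F = "outgoing_ker k e"]) (auto simp: unit_ball_vol_3)
    also have "\<dots> = (\<integral>r. indicator {0..2 * e} r *\<^sub>R A r \<partial>lborel)"
    proof (intro Bochner_Integration.integral_cong refl)
      fix r :: real
      show "(4 * pi * r\<^sup>2 * indicator {0..} r) *\<^sub>R outgoing_ker k e r = indicator {0..2 * e} r *\<^sub>R A r"
      proof (cases "0 < r \<and> r \<le> 2 * e")
        case True
        then have "complex_of_real r \<noteq> 0" by simp
        then show ?thesis using True e
          by (simp add: outgoing_ker_def A_def outgoing_def E_def scaleR_conv_of_real field_simps power2_eq_square)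
      next
        case False
        then consider "r < 0" | "r = 0" | "r > 2 * e" by linarith
        then show ?thesis by cases (use e in \<open>auto simp: A_def outgoing_ker_eq_0\<close>)
      qed
    qed
    finally have "(\<integral>x. outgoing_ker k e (norm x) \<partial>(lborel :: (real^3) measure)) - 1 = (\<integral>r. indicator {0..2 * e} r *\<^sub>R B r \<partial>lborel)"
      by (simp add: Ai)
    also have "norm \<dots> \<le> (\<integral>r. (C * (k\<^sup>2 * (2 * e))) * indicator {0..2 * e} r \<partial>lborel)"
    proof (rule Bochner_Integration.integral_norm_bound_integral[OF Bi])
      show "integrable lborel (\<lambda>r. (C * (k\<^sup>2 * (2 * e))) * indicator {0..2 * e} r)"
        by (intro integrable_mult_right integrable_real_indicator) (use e in \<open>auto simp: emeasure_lborel_Icc_eq\<close>)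
      fix r :: real
      have "norm (B r) \<le> C * (k\<^sup>2 * (2 * e))" if "0 \<le> r" "r \<le> 2 * e"
      proof -
        have "norm (of_real (k\<^sup>2) * of_real r * E r) = k\<^sup>2 * r"
          using that by (simp add: norm_mult norm_power E_def norm_exp_eq_Re)
        also have "\<dots> \<le> k\<^sup>2 * (2 * e)" using that by (intro mult_left_mono) auto
        finally show ?thesis unfolding B_def norm_mult[of "step (r / e - 1)"] using C by (intro mult_mono) auto
      qed
      then show "norm (indicator {0..2 * e} r *\<^sub>R B r) \<le> (C * (k\<^sup>2 * (2 * e))) * indicator {0..2 * e} r"
        by (auto simp: indicator_def)
    qed
    also have "\<dots> = 4 * C * k\<^sup>2 * e\<^sup>2" using e by (simp add: power2_eq_square)
    finally show "norm ((\<integral>x. outgoing_ker k e (norm x) \<partial>(lborel :: (real^3) measure)) - 1) \<le> 4 * C * k\<^sup>2 * e\<^sup>2" .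
  qed
qed

lemma integral_shift_norm:
  fixes F :: "real \<Rightarrow> 'b::{banach, second_countable_topology}" and x :: "'a::euclidean_space"
  assumes [measurable]: "F \<in> borel_measurable borel"
  shows "(\<integral>y. F (norm (x - y)) \<partial>lborel) = (\<integral>y. F (norm y) \<partial>(lborel :: 'a measure))"
    and "integrable lborel (\<lambda>y. F (norm (x - y))) \<longleftrightarrow> integrable (lborel :: 'a measure) (\<lambda>y. F (norm y))"
proof -
  have eq: "(lborel :: 'a measure) = distr lborel borel ((+) x)" using lborel_distr_plus[of x] by simp
  have "(\<integral>y. F (norm (x - y)) \<partial>lborel) = (\<integral>y. F (norm (x - y)) \<partial>distr lborel borel ((+) x))"
    using eq by simp
  also have "\<dots> = (\<integral>y. F (norm (- y)) \<partial>(lborel :: 'a measure))"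
    by (subst integral_distr) auto
  finally show "(\<integral>y. F (norm (x - y)) \<partial>lborel) = (\<integral>y. F (norm y) \<partial>(lborel :: 'a measure))" by simp
  have "integrable lborel (\<lambda>y. F (norm (x - y))) \<longleftrightarrow> integrable (distr lborel borel ((+) x)) (\<lambda>y. F (norm (x - y)))"
    using eq by simp
  also have "\<dots> \<longleftrightarrow> integrable (lborel :: 'a measure) (\<lambda>y. F (norm (- y)))"
    by (subst integrable_distr_eq) auto
  finally show "integrable lborel (\<lambda>y. F (norm (x - y))) \<longleftrightarrow> integrable (lborel :: 'a measure) (\<lambda>y. F (norm y))" by simp
qed

section \<open>Removing the cut-off\<close>

text \<open>The kernel has uniformly bounded L^1 norm and is supported in a ball of radius 2 e \<le>
  2. On such a ball 1 + |x| \<le> 3 (1 + |y|), so smoothing preserves the polynomial decay uniformly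
  in e.\<close>

lemma outgoing_ker_convolution_bound:
  fixes \<psi> :: "real^3 \<Rightarrow> complex"
  assumes [measurable]: "\<psi> \<in> borel_measurable borel" and \<psi>: "\<And>y. norm (\<psi> y) \<le> C' / (1 + norm y) ^ 5"
  obtains K where "K \<ge> 0"
    "\<And>e x. 0 < e \<Longrightarrow> e \<le> 1 \<Longrightarrow> integrable lborel (\<lambda>y. outgoing_ker k e (norm (x - y)) * \<psi> y)"
    "\<And>e x. 0 < e \<Longrightarrow> e \<le> 1 \<Longrightarrow> (\<integral>y. norm (outgoing_ker k e (norm (x - y)) * \<psi> y) \<partial>lborel) \<le> K / (1 + norm x) ^ 5"
proof -
  obtain C where C: "C \<ge> 0" "\<And>e t. 0 < e \<Longrightarrow> e \<le> 1 \<Longrightarrow> norm (outgoing_ker k e t) \<le> C / e ^ 3"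
    using outgoing_ker_bound[of k] by metis
  have C': "C' \<ge> 0" using \<psi>[of 0] norm_ge_zero[of "\<psi> 0"] by (simp del: norm_ge_zero)
  \<comment> \<open>3^5 is the loss in comparing the weights, and 4/3 pi 8 is the volume of the ball
    of radius 2 e divided by e^3.\<close>
  define K where "K = C * (3 ^ 5 * C') * (4 / 3 * pi * 8)"
  have b: "norm (outgoing_ker k e (norm (x - y)) * \<psi> y) \<le> (C / e ^ 3 * (3 ^ 5 * C' / (1 + norm x) ^ 5)) * indicator (cball x (2 * e)) y"
    if e: "0 < e" "e \<le> 1" for e x y
  proof (cases "y \<in> cball x (2 * e)")
    case True
    then have "norm x \<le> norm y + 2"
      using e norm_triangle_sub[of x y] by (simp add: dist_norm)
    then have "1 + norm x \<le> 3 + norm y" by simp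
    also have "\<dots> \<le> 3 * (1 + norm y)" by simp
    finally have "1 + norm x \<le> 3 * (1 + norm y)" .
    then have "(1 + norm x) ^ 5 \<le> (3 * (1 + norm y)) ^ 5" by (intro power_mono) auto
    then have "(1 + norm x) ^ 5 \<le> 3 ^ 5 * (1 + norm y) ^ 5" by (simp only: power_mult_distrib)
    then have "C' * (1 + norm x) ^ 5 \<le> C' * (3 ^ 5 * (1 + norm y) ^ 5)" using C' by (intro mult_left_mono) auto
    moreover have "(1 + norm x) ^ 5 > 0" "(1 + norm y) ^ 5 > 0" by (intro zero_less_power add_pos_nonneg; simp)+
    ultimately have "C' / (1 + norm y) ^ 5 \<le> 3 ^ 5 * C' / (1 + norm x) ^ 5"
      by (simp add: pos_divide_le_eq pos_le_divide_eq mult_ac)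
    then have "norm (\<psi> y) \<le> 3 ^ 5 * C' / (1 + norm x) ^ 5" using \<psi>[of y] by linarith
    then have "norm (outgoing_ker k e (norm (x - y)) * \<psi> y) \<le> C / e ^ 3 * (3 ^ 5 * C' / (1 + norm x) ^ 5)"
      unfolding norm_mult using C e by (intro mult_mono) auto
    then show ?thesis using True by simp
  next
    case False
    then show ?thesis using e by (simp add: dist_norm outgoing_ker_eq_0)
  qed
  have ii: "integrable lborel (\<lambda>y. c * indicator (cball x (2 * e)) y)" for c e :: real and x :: "real^3"
    by (intro integrable_mult_right integrable_real_indicator) (use emeasure_lborel_cball_finite in auto)
  have i: "integrable lborel (\<lambda>y. outgoing_ker k e (norm (x - y)) * \<psi> y)" if e: "0 < e" "e \<le> 1" for e x
    by (rule Bochner_Integration.integrable_bound[OF ii[where c = "C / e ^ 3 * (3 ^ 5 * C' / (1 + norm x) ^ 5)" and x = x and e = e]])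
       (measurable, intro always_eventually allI order_trans[OF b[OF e]], simp only: real_norm_def abs_ge_self)
  show thesis
  proof (rule that[of K])
    show "K \<ge> 0" using C C' by (simp add: K_def)
    fix e :: real and x :: "real^3" assume e: "0 < e" "e \<le> 1"
    show "integrable lborel (\<lambda>y. outgoing_ker k e (norm (x - y)) * \<psi> y)" by (rule i[OF e])
    have "(\<integral>y. norm (outgoing_ker k e (norm (x - y)) * \<psi> y) \<partial>lborel) \<le> (\<integral>y. (C / e ^ 3 * (3 ^ 5 * C' / (1 + norm x) ^ 5)) * indicator (cball x (2 * e)) y \<partial>lborel)"
      by (intro integral_mono integrable_norm i[OF e] ii b[OF e])
    also have "\<dots> = (C / e ^ 3 * (3 ^ 5 * C' / (1 + norm x) ^ 5)) * (4 / 3 * pi * (2 * e) ^ 3)"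
      using e by (simp add: content_cball unit_ball_vol_3)
    also have "\<dots> = K / (1 + norm x) ^ 5"
      using e by (simp add: K_def power_mult_distrib)
    finally show "(\<integral>y. norm (outgoing_ker k e (norm (x - y)) * \<psi> y) \<partial>lborel) \<le> K / (1 + norm x) ^ 5" .
  qed
qed

text \<open>The kernel is complex valued, so positivity is replaced by the uniform L^1 bound.
  Together with mass tending to 1 and shrinking support it gives convergence at each point of
  continuity.\<close>

lemma outgoing_ker_approximate_identity:
  fixes \<psi> :: "real^3 \<Rightarrow> complex"
  assumes cont: "continuous_on UNIV \<psi>" and \<psi>: "\<And>y. norm (\<psi> y) \<le> C' / (1 + norm y) ^ 5"
    and e: "\<And>n. 0 < e n" "\<And>n. e n \<le> 1" "e \<longlonglongrightarrow> 0"
  shows "(\<lambda>n. \<integral>y. outgoing_ker k (e n) (norm (x - y)) * \<psi> y \<partial>lborel) \<longlonglongrightarrow> \<psi> x"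
proof -
  have [measurable]: "\<psi> \<in> borel_measurable borel" using cont by (rule borel_measurable_continuous_onI)
  obtain C where C: "C \<ge> 0" "\<And>e t. 0 < e \<Longrightarrow> e \<le> 1 \<Longrightarrow> norm (outgoing_ker k e t) \<le> C / e ^ 3"
    using outgoing_ker_bound[of k] by metis
  obtain K where i: "\<And>e x. 0 < e \<Longrightarrow> e \<le> 1 \<Longrightarrow> integrable lborel (\<lambda>y. outgoing_ker k e (norm (x - y)) * \<psi> y)"
    using outgoing_ker_convolution_bound[of \<psi> C' k] \<psi> by auto
  have ii: "integrable lborel (\<lambda>y. c * indicator (cball x (2 * e)) y)" for c e :: real and x :: "real^3"
    by (intro integrable_mult_right integrable_real_indicator) (use emeasure_lborel_cball_finite in auto)
  have ik: "integrable lborel (\<lambda>y. outgoing_ker k (e n) (norm (x - y)))" for n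
  proof (rule Bochner_Integration.integrable_bound[OF ii])
    show "AE y in lborel. norm (outgoing_ker k (e n) (norm (x - y))) \<le> norm (C / e n ^ 3 * indicator (cball x (2 * e n)) y)"
    proof (intro always_eventually allI)
      fix y
      show "norm (outgoing_ker k (e n) (norm (x - y))) \<le> norm (C / e n ^ 3 * indicator (cball x (2 * e n)) y)"
        using C(1) C(2)[OF e(1,2), of n "norm (x - y)"] e(1)[of n]
        by (cases "y \<in> cball x (2 * e n)") (auto simp: dist_norm outgoing_ker_eq_0)
    qed
  qed measurable
  have one: "(\<lambda>n. \<integral>y. outgoing_ker k (e n) (norm (x - y)) \<partial>lborel) \<longlonglongrightarrow> 1"
  proof -
    obtain D where D: "\<And>e. 0 < e \<Longrightarrow> norm ((\<integral>x. outgoing_ker k e (norm x) \<partial>(lborel :: (real^3) measure)) - 1) \<le> D * e\<^sup>2"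
      using integral_outgoing_ker_estimate[of k] by metis
    have "(\<lambda>n. D * (e n)\<^sup>2) \<longlonglongrightarrow> D * 0\<^sup>2" by (intro tendsto_intros e)
    then have "(\<lambda>n. D * (e n)\<^sup>2) \<longlonglongrightarrow> 0" by simp
    then have "(\<lambda>n. (\<integral>x. outgoing_ker k (e n) (norm x) \<partial>(lborel :: (real^3) measure)) - 1) \<longlonglongrightarrow> 0"
      by (rule Lim_null_comparison[rotated]) (intro always_eventually allI D e)
    then show ?thesis by (simp add: integral_shift_norm LIM_zero_iff)
  qed
  have zero: "(\<lambda>n. \<integral>y. outgoing_ker k (e n) (norm (x - y)) * (\<psi> y - \<psi> x) \<partial>lborel) \<longlonglongrightarrow> 0"
  proof (rule LIMSEQ_I)
    fix \<epsilon> :: real assume \<epsilon>: "\<epsilon> > 0"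
    define \<eta> where "\<eta> = \<epsilon> / (C * (4 / 3 * pi * 8) + 1)"
    have den: "C * (4 / 3 * pi * 8) + 1 > 0" using C(1) by (intro add_nonneg_pos mult_nonneg_nonneg) auto
    then have \<eta>: "\<eta> > 0" using \<epsilon> by (simp add: \<eta>_def)
    have "isCont \<psi> x" using cont by (simp add: continuous_on_eq_continuous_at)
    then obtain \<delta> where \<delta>: "\<delta> > 0" "\<And>y. dist y x < \<delta> \<Longrightarrow> dist (\<psi> y) (\<psi> x) < \<eta>"
      using \<eta> unfolding continuous_at_eps_delta by blast
    obtain N where N: "\<And>n. n \<ge> N \<Longrightarrow> e n < \<delta> / 2"
      using e(3) \<delta>(1) by (metis (no_types, opaque_lifting) LIMSEQ_D abs_less_iff diff_zero half_gt_zero real_norm_def)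
    show "\<exists>N. \<forall>n\<ge>N. norm ((\<integral>y. outgoing_ker k (e n) (norm (x - y)) * (\<psi> y - \<psi> x) \<partial>lborel) - 0) < \<epsilon>"
    proof (intro exI[of _ N] allI impI)
      fix n assume n: "n \<ge> N"
      have "norm (\<integral>y. outgoing_ker k (e n) (norm (x - y)) * (\<psi> y - \<psi> x) \<partial>lborel) \<le> (\<integral>y. (C / e n ^ 3 * \<eta>) * indicator (cball x (2 * e n)) y \<partial>lborel)"
      proof (rule Bochner_Integration.integral_norm_bound_integral[OF _ ii])
        show "integrable lborel (\<lambda>y. outgoing_ker k (e n) (norm (x - y)) * (\<psi> y - \<psi> x))"
          using i[OF e(1,2), of n x] ik[of n] by (simp add: right_diff_distrib)
        fix y
        show "norm (outgoing_ker k (e n) (norm (x - y)) * (\<psi> y - \<psi> x)) \<le> (C / e n ^ 3 * \<eta>) * indicator (cball x (2 * e n)) y"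
        proof (cases "y \<in> cball x (2 * e n)")
          case True
          then have "dist y x < \<delta>" using N[OF n] by (simp add: dist_commute)
          then have "norm (\<psi> y - \<psi> x) \<le> \<eta>" using \<delta>(2) by (simp add: dist_norm less_imp_le)
          then have "norm (outgoing_ker k (e n) (norm (x - y)) * (\<psi> y - \<psi> x)) \<le> C / e n ^ 3 * \<eta>"
            unfolding norm_mult using C e(1,2)[of n] by (intro mult_mono) auto
          then show ?thesis using True by simp
        qed (use e(1)[of n] in \<open>simp add: dist_norm outgoing_ker_eq_0\<close>)
      qed
      also have "\<dots> = (C / e n ^ 3 * \<eta>) * (4 / 3 * pi * (2 * e n) ^ 3)"
        using e(1)[of n] by (simp add: content_cball unit_ball_vol_3)
      also have "\<dots> = (C * (4 / 3 * pi * 8)) * \<eta>"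
        using e(1)[of n] by (simp add: power_mult_distrib)
      also have "\<dots> < (C * (4 / 3 * pi * 8) + 1) * \<eta>" using \<eta> by (intro mult_strict_right_mono) auto
      also have "\<dots> = \<epsilon>" using den by (simp add: \<eta>_def)
      finally show "norm ((\<integral>y. outgoing_ker k (e n) (norm (x - y)) * (\<psi> y - \<psi> x) \<partial>lborel) - 0) < \<epsilon>" by simp
    qed
  qed
  have split: "(\<integral>y. outgoing_ker k (e n) (norm (x - y)) * \<psi> y \<partial>lborel)
     = (\<integral>y. outgoing_ker k (e n) (norm (x - y)) * (\<psi> y - \<psi> x) \<partial>lborel) + (\<integral>y. outgoing_ker k (e n) (norm (x - y)) \<partial>lborel) * \<psi> x" for n
    using i[OF e(1,2), of n x] ik[of n] by (simp add: right_diff_distrib)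
  have "(\<lambda>n. (\<integral>y. outgoing_ker k (e n) (norm (x - y)) * (\<psi> y - \<psi> x) \<partial>lborel) + (\<integral>y. outgoing_ker k (e n) (norm (x - y)) \<partial>lborel) * \<psi> x) \<longlonglongrightarrow> 0 + 1 * \<psi> x"
    by (intro tendsto_intros zero one)
  then show ?thesis unfolding split by simp
qed

lemma norm_outgoing_cut_le:
  obtains C where "C \<ge> 0" "\<And>e t. norm (outgoing_cut k e t) \<le> C * (1 / \<bar>t\<bar>)" "\<And>t. norm (outgoing k t) \<le> C * (1 / \<bar>t\<bar>)"
proof -
  obtain C where C: "C \<ge> 1" "\<And>t. norm (step t) \<le> C" using step_bounded by metis
  have o: "norm (outgoing k t) \<le> 1 / \<bar>t\<bar>" for t
  proof (cases "t = 0")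
    case False
    have "\<bar>t\<bar> \<le> 4 * pi * \<bar>t\<bar>" using pi_gt3 by (simp add: mult_le_cancel_right1)
    then show ?thesis unfolding norm_outgoing using False by (intro divide_left_mono) auto
  qed (simp add: norm_outgoing)
  show thesis
  proof (rule that[of "1 + C"])
    show "norm (outgoing k t) \<le> (1 + C) * (1 / \<bar>t\<bar>)" for t
      using mult_mono[of 1 "1 + C" "norm (outgoing k t)" "1 / \<bar>t\<bar>"] o[of t] C by simp
    show "norm (outgoing_cut k e t) \<le> (1 + C) * (1 / \<bar>t\<bar>)" for e t
    proof -
      have "norm (1 - step (t / e - 1)) \<le> 1 + C" using C(2)[of "t / e - 1"] norm_triangle_ineq4[of 1 "step (t / e - 1)"] by simp
      then show ?thesis unfolding outgoing_cut_def norm_mult using C o by (intro mult_mono) auto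
    qed
  qed (use C in auto)
qed

text \<open>Near x the bound on \<open>\<psi>\<close> is multiplied by the locally integrable 1 / |x
  - y|; away from x the kernel is at most 1. The dominating function has an integral independent of
  x, which makes potentials bounded and Fubini applicable against g.\<close>

lemma newton_potential_bound:
  fixes \<psi> :: "real^3 \<Rightarrow> complex"
  assumes [measurable]: "\<psi> \<in> borel_measurable borel" and i: "integrable lborel \<psi>" and C': "\<And>y. norm (\<psi> y) \<le> C'"
  obtains w :: "real^3 \<Rightarrow> real^3 \<Rightarrow> real" and K where
    "\<And>x y. (1 / norm (x - y)) * norm (\<psi> y) \<le> w x y" "\<And>x. integrable lborel (w x)" "\<And>x. (\<integral>y. w x y \<partial>lborel) = K"
proof -
  define F where "F t = indicator {..1} t / t" for t :: real
  have [measurable]: "F \<in> borel_measurable borel" unfolding F_def[abs_def] by measurable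
  have Fi: "integrable lborel (\<lambda>y::real^3. F (norm y))"
  proof -
    have "(\<lambda>y::real^3. F (norm y)) = (\<lambda>y. indicator (cball 0 1) y / norm y)" by (auto simp: F_def indicator_def)
    then show ?thesis using integrable_inverse_norm_ball by simp
  qed
  have Fi': "integrable lborel (\<lambda>y. F (norm (x - y)))" for x :: "real^3"
    using integral_shift_norm(2)[of F x] Fi by simp
  have C'0: "C' \<ge> 0" using C'[of 0] norm_ge_zero order_trans by blast
  show thesis
  proof (rule that[of "\<lambda>x y. norm (\<psi> y) + C' * F (norm (x - y))" "(\<integral>y. norm (\<psi> y) \<partial>lborel) + C' * (\<integral>y. F (norm y) \<partial>(lborel :: (real^3) measure))"])
    show "(1 / norm (x - y)) * norm (\<psi> y) \<le> norm (\<psi> y) + C' * F (norm (x - y))" for x y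
    proof (cases "norm (x - y) \<le> 1")
      case True
      then have "(1 / norm (x - y)) * norm (\<psi> y) \<le> C' * F (norm (x - y))"
        using C'[of y] by (simp add: F_def divide_right_mono)
      then show ?thesis using norm_ge_zero[of "\<psi> y"] by linarith
    next
      case False
      then have "(1 / norm (x - y)) * norm (\<psi> y) \<le> 1 * norm (\<psi> y)" by (intro mult_right_mono) (auto simp: divide_le_eq_1)
      then show ?thesis using False by (simp add: F_def)
    qed
    show "integrable lborel (\<lambda>y. norm (\<psi> y) + C' * F (norm (x - y)))" for x
      using i Fi' by auto
    show "(\<integral>y. norm (\<psi> y) + C' * F (norm (x - y)) \<partial>lborel) = (\<integral>y. norm (\<psi> y) \<partial>lborel) + C' * (\<integral>y. F (norm y) \<partial>(lborel :: (real^3) measure))" for x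
      using i Fi' by (simp add: integral_shift_norm)
  qed
qed

lemma fifth_power_decay:
  fixes \<psi> :: "real^3 \<Rightarrow> complex"
  assumes [measurable]: "\<psi> \<in> borel_measurable borel" and \<psi>: "\<And>y. norm (\<psi> y) \<le> C' / (1 + norm y) ^ 5"
  shows "integrable lborel \<psi>" and "norm (\<psi> y) \<le> C'"
proof -
  have C'0: "C' \<ge> 0" using \<psi>[of 0] norm_ge_zero[of "\<psi> 0"] by (simp del: norm_ge_zero)
  show "integrable lborel \<psi>"
  proof (rule Bochner_Integration.integrable_bound[OF integrable_mult_right[OF integrable_weight3, of C']])
    show "AE x in lborel. norm (\<psi> x) \<le> norm (C' * (1 / (1 + norm x) ^ 4))"
    proof (intro always_eventually allI)
      fix x :: "real^3"
      have "C' / (1 + norm x) ^ 5 \<le> C' / (1 + norm x) ^ 4"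
        using C'0 by (intro divide_left_mono power_increasing mult_pos_pos zero_less_power add_pos_nonneg) auto
      then show "norm (\<psi> x) \<le> norm (C' * (1 / (1 + norm x) ^ 4))" using \<psi>[of x] by (simp add: abs_of_nonneg C'0)
    qed
  qed measurable
  show "norm (\<psi> y) \<le> C'"
  proof -
    have "C' / (1 + norm y) ^ 5 \<le> C' / 1" using C'0 by (intro divide_left_mono one_le_power mult_pos_pos zero_less_power add_pos_nonneg) auto
    then show ?thesis using \<psi>[of y] by simp
  qed
qed

lemma integrable_outgoing_convolution:
  fixes \<psi> :: "real^3 \<Rightarrow> complex"
  assumes cont: "continuous_on UNIV \<psi>" and \<psi>: "\<And>y. norm (\<psi> y) \<le> C' / (1 + norm y) ^ 5"
  shows "integrable lborel (\<lambda>y. outgoing k (norm (x - y)) * \<psi> y)"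
proof -
  have [measurable]: "\<psi> \<in> borel_measurable borel" using cont by (rule borel_measurable_continuous_onI)
  have i: "integrable lborel \<psi>" and b: "norm (\<psi> y) \<le> C'" for y
    by (rule fifth_power_decay[OF _ \<psi>], measurable)+
  obtain w :: "real^3 \<Rightarrow> real^3 \<Rightarrow> real" and K where w: "\<And>x y. (1 / norm (x - y)) * norm (\<psi> y) \<le> w x y" "\<And>x. integrable lborel (w x)" "\<And>x. (\<integral>y. w x y \<partial>lborel) = K"
    using newton_potential_bound[OF _ i b] by auto
  obtain B where B: "B \<ge> 0" "\<And>t. norm (outgoing k t) \<le> B * (1 / \<bar>t\<bar>)"
    using norm_outgoing_cut_le[of k] by metis
  have Bw: "norm (outgoing k (norm (x - y)) * \<psi> y) \<le> B * w x y" for y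
  proof -
    have "norm (outgoing k (norm (x - y)) * \<psi> y) \<le> B * (1 / norm (x - y)) * norm (\<psi> y)"
      unfolding norm_mult using B(2)[of "norm (x - y)"] by (intro mult_right_mono) simp_all
    also have "\<dots> \<le> B * w x y" using mult_left_mono[OF w(1) B(1)] by (simp add: mult.assoc)
    finally show ?thesis .
  qed
  show ?thesis
    by (rule Bochner_Integration.integrable_bound[OF integrable_mult_right[OF w(2), of B x]])
       (measurable, intro always_eventually allI order_trans[OF Bw], simp)
qed

text \<open>Integrating \<open>convolution_representation\<close> against \<open>\<psi>\<close> in
  the centre y and applying Fubini moves both kernels onto \<open>\<psi>\<close>. As e tends to 0,
  the kernel on the side of u becomes an approximate identity and the one on the side of g becomes
  the full potential. The decay exponent 5 is 4 for integrability in space plus 1 that absorbs the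
  growth of u.\<close>

lemma outgoing_representation:
  fixes u g \<psi> :: "real^3 \<Rightarrow> complex"
  assumes k: "k > 0" and u: "helmholtz_weak k g u" "sommerfeld k u"
    and g: "integrable lborel g" "\<And>x. norm x \<ge> r \<Longrightarrow> g x = 0"
    and cont: "continuous_on UNIV \<psi>" and \<psi>: "\<And>y. norm (\<psi> y) \<le> C' / (1 + norm y) ^ 5"
  shows "integrable lborel (\<lambda>x. u x * \<psi> x)"
    and "(\<integral>x. u x * \<psi> x \<partial>lborel) = (\<integral>x. g x * (\<integral>y. outgoing k (norm (x - y)) * \<psi> y \<partial>lborel) \<partial>lborel)"
proof -
  have loc: "loc_int3 u" using u(1) by (simp add: helmholtz_weak_def)
  have [measurable]: "\<psi> \<in> borel_measurable borel" using cont by (rule borel_measurable_continuous_onI)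
  have [measurable]: "u \<in> borel_measurable borel" by (rule loc_int3_measurable[OF loc])
  have [measurable]: "g \<in> borel_measurable borel" using g(1) by (auto dest: borel_measurable_integrable)
  obtain A R where A: "A > 0" "R \<ge> 1" "\<And>x. norm x \<ge> R \<Longrightarrow> cmod (u x) \<le> A * sqrt (norm x)"
    using sommerfeld_growth[OF u(2)] by metis
  \<comment> \<open>Near the origin u is only locally integrable and the weight is at most 1.
    Outside, sqrt |x| \<le> 1 + |x| uses up one of the five powers.\<close>
  have uw: "integrable lborel (\<lambda>x. norm (u x) * (1 / (1 + norm x) ^ 5))"
  proof (rule Bochner_Integration.integrable_bound)
    show "integrable lborel (\<lambda>x. norm (indicator (cball 0 R) x *\<^sub>R u x) + A * (1 / (1 + norm x) ^ 4))"
      using loc integrable_weight3 unfolding loc_int3_def set_integrable_def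
      by (intro Bochner_Integration.integrable_add integrable_norm integrable_mult_right) auto
    show "AE x in lborel. norm (norm (u x) * (1 / (1 + norm x) ^ 5)) \<le> norm (norm (indicator (cball 0 R) x *\<^sub>R u x) + A * (1 / (1 + norm x) ^ 4))"
    proof (intro always_eventually allI)
      fix x :: "real^3"
      have p: "(1 + norm x) ^ 5 \<ge> 1" "(1 + norm x) ^ 4 > 0" by (rule one_le_power, simp) (intro zero_less_power add_pos_nonneg, auto)
      have "norm (u x) * (1 / (1 + norm x) ^ 5) \<le> norm (indicator (cball 0 R) x *\<^sub>R u x) + A * (1 / (1 + norm x) ^ 4)"
      proof (cases "norm x \<le> R")
        case True
        have "1 / (1 + norm x) ^ 5 \<le> 1 / 1" using p(1) by (intro divide_left_mono) linarith+
        then have "norm (u x) * (1 / (1 + norm x) ^ 5) \<le> norm (u x) * 1" by (intro mult_left_mono) auto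
        moreover have "A * (1 / (1 + norm x) ^ 4) \<ge> 0" using A p by auto
        ultimately show ?thesis using True by simp
      next
        case False
        have "sqrt (norm x) \<le> 1 + norm x" by (rule real_le_lsqrt) (auto simp: power2_eq_square algebra_simps)
        then have "norm (u x) \<le> A * (1 + norm x)" using A(3)[of x] False A(1) mult_left_mono[of "sqrt (norm x)" "1 + norm x" A] by linarith
        then have "norm (u x) * (1 / (1 + norm x) ^ 5) \<le> A * (1 + norm x) * (1 / (1 + norm x) ^ 5)" using p by (intro mult_right_mono) auto
        also have "\<dots> = A * (1 / (1 + norm x) ^ 4)"
        proof -
          have "1 + norm x \<noteq> 0" using norm_ge_zero[of x] by linarith
          then show ?thesis by (simp add: eval_nat_numeral)
        qed
        finally show ?thesis by (simp add: add_increasing)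
      qed
      then show "norm (norm (u x) * (1 / (1 + norm x) ^ 5)) \<le> norm (norm (indicator (cball 0 R) x *\<^sub>R u x) + A * (1 / (1 + norm x) ^ 4))"
        by (simp add: abs_mult abs_of_nonneg)
    qed
  qed measurable
  have bound_u: "integrable lborel (\<lambda>x. u x * f x)" if [measurable]: "f \<in> borel_measurable borel" and f: "\<And>x. norm (f x) \<le> D / (1 + norm x) ^ 5" for f :: "real^3 \<Rightarrow> complex" and D
  proof (rule Bochner_Integration.integrable_bound[OF integrable_mult_right[OF uw, of D]])
    show "AE x in lborel. norm (u x * f x) \<le> norm (D * (norm (u x) * (1 / (1 + norm x) ^ 5)))"
    proof (intro always_eventually allI)
      fix x
      have "norm (u x * f x) \<le> D * (norm (u x) * (1 / (1 + norm x) ^ 5))"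
        using mult_left_mono[OF f[of x], of "norm (u x)"] by (simp add: norm_mult mult_ac)
      also have "\<dots> \<le> norm (D * (norm (u x) * (1 / (1 + norm x) ^ 5)))"
        by (simp only: real_norm_def abs_ge_self)
      finally show "norm (u x * f x) \<le> norm (D * (norm (u x) * (1 / (1 + norm x) ^ 5)))" .
    qed
  qed measurable
  show ui: "integrable lborel (\<lambda>x. u x * \<psi> x)" by (rule bound_u[OF _ \<psi>]) measurable
  define e where "e n = inverse (real (Suc n))" for n
  have e: "0 < e n" "e n \<le> 1" "e \<longlonglongrightarrow> 0" for n
    unfolding e_def[abs_def] by (simp, simp add: inverse_le_1_iff, rule LIMSEQ_inverse_real_of_nat)
  obtain K where K: "K \<ge> 0"
    "\<And>e x. 0 < e \<Longrightarrow> e \<le> 1 \<Longrightarrow> integrable lborel (\<lambda>y. outgoing_ker k e (norm (x - y)) * \<psi> y)"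
    "\<And>e x. 0 < e \<Longrightarrow> e \<le> 1 \<Longrightarrow> (\<integral>y. norm (outgoing_ker k e (norm (x - y)) * \<psi> y) \<partial>lborel) \<le> K / (1 + norm x) ^ 5"
    using outgoing_ker_convolution_bound[of \<psi> C' k] \<psi> by auto
  have nK: "norm (\<integral>y. outgoing_ker k (e n) (norm (x - y)) * \<psi> y \<partial>lborel) \<le> K / (1 + norm x) ^ 5" for n x
    using integral_norm_bound[of lborel "\<lambda>y. outgoing_ker k (e n) (norm (x - y)) * \<psi> y"] K(3)[OF e(1,2), of n x] by linarith
  have \<psi>i: "integrable lborel \<psi>" and \<psi>C: "norm (\<psi> y) \<le> C'" for y
    by (rule fifth_power_decay[OF _ \<psi>], measurable)+
  obtain w :: "real^3 \<Rightarrow> real^3 \<Rightarrow> real" and K1 where w: "\<And>x y. (1 / norm (x - y)) * norm (\<psi> y) \<le> w x y" "\<And>x. integrable lborel (w x)" "\<And>x. (\<integral>y. w x y \<partial>lborel) = K1"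
    using newton_potential_bound[OF _ \<psi>i \<psi>C] by auto
  obtain B where B: "B \<ge> 0" "\<And>e t. norm (outgoing_cut k e t) \<le> B * (1 / \<bar>t\<bar>)" "\<And>t. norm (outgoing k t) \<le> B * (1 / \<bar>t\<bar>)"
    using norm_outgoing_cut_le[of k] by metis
  have Bw: "norm (outgoing_cut k (e n) (norm (x - y)) * \<psi> y) \<le> B * w x y" for n x y
  proof -
    have "norm (outgoing_cut k (e n) (norm (x - y)) * \<psi> y) \<le> B * (1 / norm (x - y)) * norm (\<psi> y)"
      unfolding norm_mult[of "outgoing_cut k (e n) (norm (x - y))"]
      using B(2)[of "e n" "norm (x - y)"] by (intro mult_right_mono) simp_all
    also have "\<dots> \<le> B * w x y" using mult_left_mono[OF w(1) B(1)] by (simp add: mult.assoc)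
    finally show ?thesis .
  qed
  have ci: "integrable lborel (\<lambda>y. outgoing_cut k (e n) (norm (x - y)) * \<psi> y)" for n x
    by (rule Bochner_Integration.integrable_bound[OF integrable_mult_right[OF w(2), of B x]])
       (measurable, intro always_eventually allI order_trans[OF Bw], simp)
  have nC: "(\<integral>y. norm (outgoing_cut k (e n) (norm (x - y)) * \<psi> y) \<partial>lborel) \<le> B * K1" for n x
  proof -
    have "(\<integral>y. norm (outgoing_cut k (e n) (norm (x - y)) * \<psi> y) \<partial>lborel) \<le> (\<integral>y. B * w x y \<partial>lborel)"
      by (intro integral_mono integrable_norm ci integrable_mult_right w(2) Bw)
    then show ?thesis using w(3) by simp
  qed
  have swap: "(\<integral>x. u x * (\<integral>y. outgoing_ker k (e n) (norm (x - y)) * \<psi> y \<partial>lborel) \<partial>lborel)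
     = (\<integral>x. g x * (\<integral>y. outgoing_cut k (e n) (norm (x - y)) * \<psi> y \<partial>lborel) \<partial>lborel)" for n
  proof -
    have 1: "integrable (lborel \<Otimes>\<^sub>M lborel) (\<lambda>(x, y). u x * (outgoing_ker k (e n) (norm (x - y)) * \<psi> y))"
    proof (rule lborel_pair.Fubini_integrable)
      have "integrable lborel (\<lambda>x. u x * of_real (\<integral>y. norm (outgoing_ker k (e n) (norm (x - y)) * \<psi> y) \<partial>lborel))"
      proof (rule bound_u[of _ K])
        show "(\<lambda>x. complex_of_real (\<integral>y. norm (outgoing_ker k (e n) (norm (x - y)) * \<psi> y) \<partial>lborel)) \<in> borel_measurable borel"
          by measurable
        show "norm (complex_of_real (\<integral>y. norm (outgoing_ker k (e n) (norm (x - y)) * \<psi> y) \<partial>lborel)) \<le> K / (1 + norm x) ^ 5" for x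
          using K(3)[OF e(1,2), of n x] by (simp only: norm_of_real) (simp add: integral_nonneg)
      qed
      from integrable_norm[OF this] show "integrable lborel (\<lambda>x. \<integral>y. norm (case (x, y) of (x, y) \<Rightarrow> u x * (outgoing_ker k (e n) (norm (x - y)) * \<psi> y)) \<partial>lborel)"
        by (simp add: norm_mult[of "u _"])
      show "AE x in lborel. integrable lborel (\<lambda>y. case (x, y) of (x, y) \<Rightarrow> u x * (outgoing_ker k (e n) (norm (x - y)) * \<psi> y))"
        using K(2)[OF e(1,2), of n] by simp
    qed measurable
    have 2: "integrable (lborel \<Otimes>\<^sub>M lborel) (\<lambda>(x, y). g x * (outgoing_cut k (e n) (norm (x - y)) * \<psi> y))"
    proof (rule lborel_pair.Fubini_integrable)
      have "integrable lborel (\<lambda>x. norm (g x) * (\<integral>y. norm (outgoing_cut k (e n) (norm (x - y)) * \<psi> y) \<partial>lborel))"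
      proof (rule Bochner_Integration.integrable_bound[OF integrable_mult_right[OF integrable_norm[OF g(1)], of "B * K1"]])
        show "AE x in lborel. norm (norm (g x) * (\<integral>y. norm (outgoing_cut k (e n) (norm (x - y)) * \<psi> y) \<partial>lborel)) \<le> norm (B * K1 * norm (g x))"
        proof (intro always_eventually allI)
          fix x
          have "norm (g x) * (\<integral>y. norm (outgoing_cut k (e n) (norm (x - y)) * \<psi> y) \<partial>lborel) \<le> norm (g x) * (B * K1)"
            by (intro mult_left_mono nC) simp
          moreover have "norm (g x) * (\<integral>y. norm (outgoing_cut k (e n) (norm (x - y)) * \<psi> y) \<partial>lborel) \<ge> 0"
            by (intro mult_nonneg_nonneg integral_nonneg) auto
          ultimately show "norm (norm (g x) * (\<integral>y. norm (outgoing_cut k (e n) (norm (x - y)) * \<psi> y) \<partial>lborel)) \<le> norm (B * K1 * norm (g x))"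
            by (simp only: real_norm_def mult.commute[of "B * K1"])
        qed
      qed measurable
      then show "integrable lborel (\<lambda>x. \<integral>y. norm (case (x, y) of (x, y) \<Rightarrow> g x * (outgoing_cut k (e n) (norm (x - y)) * \<psi> y)) \<partial>lborel)"
        by (simp add: norm_mult[of "g _"])
      show "AE x in lborel. integrable lborel (\<lambda>y. case (x, y) of (x, y) \<Rightarrow> g x * (outgoing_cut k (e n) (norm (x - y)) * \<psi> y))"
        using ci by simp
    qed measurable
    have "(\<integral>x. u x * (\<integral>y. outgoing_ker k (e n) (norm (x - y)) * \<psi> y \<partial>lborel) \<partial>lborel) = (\<integral>x. \<integral>y. u x * (outgoing_ker k (e n) (norm (x - y)) * \<psi> y) \<partial>lborel \<partial>lborel)"
      by simp
    also have "\<dots> = (\<integral>y. \<integral>x. u x * (outgoing_ker k (e n) (norm (x - y)) * \<psi> y) \<partial>lborel \<partial>lborel)"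
      using lborel_pair.Fubini_integral[OF 1] by simp
    also have "\<dots> = (\<integral>y. (\<integral>x. u x * outgoing_ker k (e n) (norm (x - y)) \<partial>lborel) * \<psi> y \<partial>lborel)"
      by (simp add: mult.assoc[symmetric])
    also have "\<dots> = (\<integral>y. (\<integral>x. g x * outgoing_cut k (e n) (norm (x - y)) \<partial>lborel) * \<psi> y \<partial>lborel)"
      by (simp only: convolution_representation[OF k e(1,2) u g(2)])
    also have "\<dots> = (\<integral>y. \<integral>x. g x * (outgoing_cut k (e n) (norm (x - y)) * \<psi> y) \<partial>lborel \<partial>lborel)"
      by (simp add: mult.assoc[symmetric])
    also have "\<dots> = (\<integral>x. \<integral>y. g x * (outgoing_cut k (e n) (norm (x - y)) * \<psi> y) \<partial>lborel \<partial>lborel)"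
      using lborel_pair.Fubini_integral[OF 2] by simp
    finally show ?thesis by simp
  qed
  have left: "(\<lambda>n. \<integral>x. u x * (\<integral>y. outgoing_ker k (e n) (norm (x - y)) * \<psi> y \<partial>lborel) \<partial>lborel) \<longlonglongrightarrow> (\<integral>x. u x * \<psi> x \<partial>lborel)"
  proof (rule integral_dominated_convergence[OF _ _ integrable_mult_right[OF uw, of K]])
    show "AE x in lborel. (\<lambda>n. u x * (\<integral>y. outgoing_ker k (e n) (norm (x - y)) * \<psi> y \<partial>lborel)) \<longlonglongrightarrow> u x * \<psi> x"
      by (intro always_eventually allI tendsto_mult tendsto_const outgoing_ker_approximate_identity[OF cont \<psi> e])
    show "AE x in lborel. norm (u x * (\<integral>y. outgoing_ker k (e n) (norm (x - y)) * \<psi> y \<partial>lborel)) \<le> K * (norm (u x) * (1 / (1 + norm x) ^ 5))" for n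
      using mult_left_mono[OF nK norm_ge_zero] by (intro always_eventually allI) (simp add: norm_mult mult_ac)
  qed measurable
  have inner: "(\<lambda>n. \<integral>y. outgoing_cut k (e n) (norm (x - y)) * \<psi> y \<partial>lborel) \<longlonglongrightarrow> (\<integral>y. outgoing k (norm (x - y)) * \<psi> y \<partial>lborel)" for x
  proof (rule integral_dominated_convergence[OF _ _ integrable_mult_right[OF w(2), of B x]])
    show "AE y in lborel. (\<lambda>n. outgoing_cut k (e n) (norm (x - y)) * \<psi> y) \<longlonglongrightarrow> outgoing k (norm (x - y)) * \<psi> y"
    proof (rule AE_mp[OF AE_lborel_singleton[of x]], intro always_eventually allI impI)
      fix y assume "y \<noteq> x"
      then have t: "norm (x - y) > 0" by simp
      then have "\<forall>\<^sub>F n in sequentially. e n < norm (x - y) / 2" using e(3) order_tendstoD(2) half_gt_zero by blast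
      then have "\<forall>\<^sub>F n in sequentially. outgoing_cut k (e n) (norm (x - y)) * \<psi> y = outgoing k (norm (x - y)) * \<psi> y"
        by eventually_elim (simp add: outgoing_cut_eq e)
      then show "(\<lambda>n. outgoing_cut k (e n) (norm (x - y)) * \<psi> y) \<longlonglongrightarrow> outgoing k (norm (x - y)) * \<psi> y"
        by (rule tendsto_eventually)
    qed
  qed (measurable, use Bw in auto)
  have right: "(\<lambda>n. \<integral>x. g x * (\<integral>y. outgoing_cut k (e n) (norm (x - y)) * \<psi> y \<partial>lborel) \<partial>lborel) \<longlonglongrightarrow> (\<integral>x. g x * (\<integral>y. outgoing k (norm (x - y)) * \<psi> y \<partial>lborel) \<partial>lborel)"
  proof (rule integral_dominated_convergence[OF _ _ integrable_mult_right[OF integrable_norm[OF g(1)], of "B * K1"]])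
    show "AE x in lborel. (\<lambda>n. g x * (\<integral>y. outgoing_cut k (e n) (norm (x - y)) * \<psi> y \<partial>lborel)) \<longlonglongrightarrow> g x * (\<integral>y. outgoing k (norm (x - y)) * \<psi> y \<partial>lborel)"
      by (intro always_eventually allI tendsto_mult tendsto_const inner)
    show "AE x in lborel. norm (g x * (\<integral>y. outgoing_cut k (e n) (norm (x - y)) * \<psi> y \<partial>lborel)) \<le> B * K1 * norm (g x)" for n
    proof (intro always_eventually allI)
      fix x
      have "norm (\<integral>y. outgoing_cut k (e n) (norm (x - y)) * \<psi> y \<partial>lborel) \<le> B * K1"
        using integral_norm_bound[of lborel "\<lambda>y. outgoing_cut k (e n) (norm (x - y)) * \<psi> y"] nC[of n x] by linarith
      from mult_left_mono[OF this norm_ge_zero[of "g x"]]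
      show "norm (g x * (\<integral>y. outgoing_cut k (e n) (norm (x - y)) * \<psi> y \<partial>lborel)) \<le> B * K1 * norm (g x)"
        by (simp add: norm_mult mult_ac)
    qed
  qed measurable
  show "(\<integral>x. u x * \<psi> x \<partial>lborel) = (\<integral>x. g x * (\<integral>y. outgoing k (norm (x - y)) * \<psi> y \<partial>lborel) \<partial>lborel)"
    using LIMSEQ_unique[OF left[unfolded swap] right] .
qed

section \<open>Identification of the partial Fourier transform\<close>

definition proj12 :: "real^3 \<Rightarrow> real \<times> real" where "proj12 x = (x $ 1, x $ 2)"
definition proj3 :: "real^3 \<Rightarrow> real" where "proj3 x = x $ 3"
definition kap :: "real \<Rightarrow> real \<times> real \<Rightarrow> complex" where "kap k q = kappa k (fst q) (snd q)"

lemma vec3_proj [simp]: "vec3 (proj12 x) (proj3 x) = x"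
  by (simp add: proj12_def proj3_def vec_eq_iff forall_3)

lemma measurable_proj [measurable]: "proj12 \<in> borel_measurable borel" "proj3 \<in> borel_measurable borel"
  unfolding proj12_def[abs_def] proj3_def[abs_def] by (intro borel_measurable_continuous_onI continuous_intros)+

lemma measurable_kap [measurable]: "kap k \<in> borel_measurable borel"
  unfolding kap_def[abs_def] by (rule measurable_kappa)

lemma prod_Basis_3: "(\<Prod>b\<in>(Basis :: (real^3) set). x \<bullet> b) = x $ 1 * x $ 2 * x $ 3"
proof -
  have B: "(Basis :: (real^3) set) = (\<lambda>i. axis i 1) ` UNIV" by (auto simp: Basis_vec_def)
  have "inj (\<lambda>i::3. axis i (1::real))" by (auto simp: inj_def axis_eq_axis)
  then have "(\<Prod>b\<in>(Basis :: (real^3) set). x \<bullet> b) = (\<Prod>i\<in>UNIV. x $ i)"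
    unfolding B by (subst prod.reindex) (auto simp: inner_axis)
  also have "\<dots> = (\<Prod>i\<in>{1, 2, 3}. x $ i)" by (simp only: UNIV_3)
  also have "\<dots> = x $ 1 * (x $ 2 * x $ 3)" by (subst prod.insert; simp)+
  finally show ?thesis by simp
qed

lemma lborel_vec3:
  "(lborel :: (real^3) measure) = distr (lborel :: ((real \<times> real) \<times> real) measure) borel (\<lambda>p. vec3 (fst p) (snd p))"
proof (rule lborel_eqI)
  have m: "(\<lambda>p. vec3 (fst p) (snd p)) \<in> borel_measurable (borel :: ((real \<times> real) \<times> real) measure)"
    by (intro borel_measurable_continuous_onI continuous_intros)
  fix l u :: "real^3" assume lu: "\<And>b. b \<in> Basis \<Longrightarrow> l \<bullet> b \<le> u \<bullet> b"
  have lui: "l $ i \<le> u $ i" for i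
    using lu[of "axis i 1"] by (simp add: axis_in_Basis_iff inner_axis)
  have "emeasure (distr (lborel :: ((real \<times> real) \<times> real) measure) borel (\<lambda>p. vec3 (fst p) (snd p))) (box l u)
     = emeasure (lborel :: ((real \<times> real) \<times> real) measure) (({l $ 1<..<u $ 1} \<times> {l $ 2<..<u $ 2}) \<times> {l $ 3<..<u $ 3})"
    by (subst emeasure_distr) (use m in \<open>auto simp: mem_box_cart forall_3 intro!: arg_cong2[where f = emeasure]\<close>)
  also have "\<dots> = emeasure lborel {l $ 1<..<u $ 1} * emeasure lborel {l $ 2<..<u $ 2} * emeasure lborel {l $ 3<..<u $ 3}"
  proof -
    have "emeasure (lborel \<Otimes>\<^sub>M lborel) (({l $ 1<..<u $ 1} \<times> {l $ 2<..<u $ 2}) \<times> {l $ 3<..<u $ 3})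
      = emeasure lborel ({l $ 1<..<u $ 1} \<times> {l $ 2<..<u $ 2}) * emeasure lborel {l $ 3<..<u $ 3}"
      by (rule lborel.emeasure_pair_measure_Times) (auto intro!: borel_open open_Times)
    moreover have "emeasure (lborel \<Otimes>\<^sub>M lborel) ({l $ 1<..<u $ 1} \<times> {l $ 2<..<u $ 2})
      = emeasure lborel {l $ 1<..<u $ 1} * emeasure lborel {l $ 2<..<u $ 2}"
      by (rule lborel.emeasure_pair_measure_Times) auto
    ultimately show ?thesis by (simp only: lborel_prod)
  qed
  also have "\<dots> = ennreal (\<Prod>b\<in>Basis. (u - l) \<bullet> b)"
    using lui by (simp add: prod_Basis_3 ennreal_mult)
  finally show "emeasure (distr (lborel :: ((real \<times> real) \<times> real) measure) borel (\<lambda>p. vec3 (fst p) (snd p))) (box l u) = ennreal (\<Prod>b\<in>Basis. (u - l) \<bullet> b)" .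
qed simp

lemma integral_vec3:
  fixes F :: "real^3 \<Rightarrow> complex"
  assumes [measurable]: "F \<in> borel_measurable borel"
  shows "integrable lborel F \<longleftrightarrow> integrable lborel (\<lambda>p. F (vec3 (fst p) (snd p)))"
    and "(\<integral>x. F x \<partial>lborel) = (\<integral>p. F (vec3 (fst p) (snd p)) \<partial>lborel)"
proof -
  have m: "(\<lambda>p. vec3 (fst p) (snd p)) \<in> borel_measurable (lborel :: ((real \<times> real) \<times> real) measure)"
    by (simp, intro borel_measurable_continuous_onI continuous_intros)
  show "integrable lborel F \<longleftrightarrow> integrable lborel (\<lambda>p. F (vec3 (fst p) (snd p)))"
    by (subst lborel_vec3, subst integrable_distr_eq[OF m]) auto
  show "(\<integral>x. F x \<partial>lborel) = (\<integral>p. F (vec3 (fst p) (snd p)) \<partial>lborel)"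
    by (subst lborel_vec3, subst integral_distr[OF m]) auto
qed

text \<open>\<open>Psi k x\<close> is the partial Fourier transform of \<open>G(\<cdot> - x)\<close>.\<close>

definition Psi :: "real \<Rightarrow> real^3 \<Rightarrow> real \<times> real \<Rightarrow> real \<Rightarrow> complex" where
  "Psi k x q c = \<i> / (4 * of_real pi * kap k q) * exp (\<i> * kap k q * of_real \<bar>c - proj3 x\<bar>) * osc12 q (proj12 x)"

lemma norm_Psi_le: "norm (Psi k x q c) \<le> 1 / (4 * pi * norm (kap k q))"
proof -
  have "norm (exp (\<i> * kap k q * of_real \<bar>c - proj3 x\<bar>)) \<le> 1"
    unfolding kap_def by (rule norm_exp_kappa_le) simp
  then have "norm (\<i> / (4 * of_real pi * kap k q)) * norm (exp (\<i> * kap k q * of_real \<bar>c - proj3 x\<bar>)) \<le> norm (\<i> / (4 * of_real pi * kap k q)) * 1"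
    by (intro mult_left_mono) auto
  then show ?thesis unfolding Psi_def norm_mult by (simp add: norm_divide norm_mult)
qed

lemma norm_diff_vec3: "norm (x - vec3 q c) = hyp \<bar>c - proj3 x\<bar> (q - proj12 x)"
proof -
  have "x - vec3 q c = vec3 (proj12 x - q) (proj3 x - c)"
    by (simp add: vec_eq_iff forall_3 proj12_def proj3_def)
  then show ?thesis
    by (simp add: norm_vec3 hyp_def norm_minus_commute power2_commute[of c])
qed

lemma integral_translate:
  fixes F :: "'a::euclidean_space \<Rightarrow> complex"
  assumes [measurable]: "F \<in> borel_measurable borel"
  shows "(\<integral>q. F q \<partial>lborel) = (\<integral>p. F (a + p) \<partial>lborel)" "integrable lborel F \<longleftrightarrow> integrable lborel (\<lambda>p. F (a + p))"
proof -
  have eq: "(lborel :: 'a measure) = distr lborel borel ((+) a)" using lborel_distr_plus[of a] by simp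
  show "(\<integral>q. F q \<partial>lborel) = (\<integral>p. F (a + p) \<partial>lborel)" by (subst eq, subst integral_distr) auto
  show "integrable lborel F \<longleftrightarrow> integrable lborel (\<lambda>p. F (a + p))" by (subst eq, subst integrable_distr_eq) auto
qed

text \<open>Translating the plane by the first two coordinates of x multiplies the slice of
  \<open>\<phi>\<close> by an oscillation and makes the kernel radial, which is the setting of
  \<open>weyl_outgoing\<close>. The slice through x is excluded because that formula needs a
  positive height; it is one point in c.\<close>

lemma fourier12_outgoing_slice:
  assumes k: "k > 0" and \<phi>: "test_fun3 \<phi>" and c: "c \<noteq> proj3 x"
  shows "(\<integral>q. outgoing k (norm (x - vec3 q c)) * fourier12 \<phi> (vec3 q c) \<partial>lborel) = (\<integral>q. \<phi> (vec3 q c) * Psi k x q c \<partial>lborel)"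
proof -
  note [measurable] = measurable_test_fun3[OF \<phi>]
  have [measurable]: "fourier12 \<phi> \<in> borel_measurable borel"
    by (intro borel_measurable_continuous_onI continuous_fourier12[OF \<phi>])
  define z where "z = \<bar>c - proj3 x\<bar>"
  have z: "z > 0" using c by (simp add: z_def)
  define f where "f q = \<phi> (vec3 q c) * osc12 q (proj12 x)" for q
  have [measurable]: "f \<in> borel_measurable borel" unfolding f_def[abs_def] by measurable
  obtain B M where B: "\<And>k c q. norm (\<phi> (vec3 k c) * osc12 k q) \<le> B * indicator (cball 0 M) k"
    using test_fun3_slice[OF \<phi>] by metis
  have fhat: "(\<integral>q. f q * osc12 q p \<partial>lborel) = 2 * of_real pi * fourier12 \<phi> (vec3 (proj12 x + p) c)" for p
  proof -
    have "osc12 q (proj12 x) * osc12 q p = osc12 q (proj12 x + p)" for q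
      by (simp add: osc12_def exp_add[symmetric] algebra_simps)
    then have "f q * osc12 q p = \<phi> (vec3 q c) * osc12 q (proj12 x + p)" for q by (simp add: f_def mult.assoc)
    then show ?thesis by (simp add: fourier12_vec3)
  qed
  have fi: "integrable lborel (\<lambda>q. fourier12 \<phi> (vec3 q c))"
  proof -
    obtain C where C: "C > 0" "\<And>x. norm (fourier12 \<phi> x) \<le> C / (1 + norm x) ^ 3"
      using fourier12_decay[OF \<phi>, of 3] by metis
    have w: "integrable lborel (\<lambda>q::real \<times> real. C * (1 / (1 + norm q) ^ 3))"
      using integrable_mult_right[OF integrable_inverse_power_norm[where 'a = "real \<times> real"], of C]
      by (simp add: power3_eq_cube mult.assoc)
    show ?thesis
    proof (rule Bochner_Integration.integrable_bound[OF w])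
      show "AE q in lborel. norm (fourier12 \<phi> (vec3 q c)) \<le> norm (C * (1 / (1 + norm q) ^ 3))"
      proof (intro always_eventually allI)
        fix q
        have "C / (1 + norm (vec3 q c)) ^ 3 \<le> C / (1 + norm q) ^ 3"
          using C(1) norm_le_norm_vec3(1)[of q c]
          by (intro divide_left_mono power_mono mult_pos_pos zero_less_power add_pos_nonneg) auto
        then have "norm (fourier12 \<phi> (vec3 q c)) \<le> C * (1 / (1 + norm q) ^ 3)" using C(2)[of "vec3 q c"] by simp
        also have "\<dots> \<le> norm (C * (1 / (1 + norm q) ^ 3))" by (simp only: real_norm_def abs_ge_self)
        finally show "norm (fourier12 \<phi> (vec3 q c)) \<le> norm (C * (1 / (1 + norm q) ^ 3))" .
      qed
    qed measurable
  qed
  have fi': "integrable lborel (\<lambda>p. \<integral>q. f q * osc12 q p \<partial>lborel)"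
    unfolding fhat using integral_translate(2)[of "\<lambda>q. fourier12 \<phi> (vec3 q c)" "proj12 x"] fi by simp
  have "(\<integral>q. outgoing k (norm (x - vec3 q c)) * fourier12 \<phi> (vec3 q c) \<partial>lborel)
     = (\<integral>p. outgoing k (hyp z p) * fourier12 \<phi> (vec3 (proj12 x + p) c) \<partial>lborel)"
    unfolding norm_diff_vec3 z_def[symmetric]
    by (subst integral_translate(1)[of _ "proj12 x"]) simp_all
  also have "\<dots> = (\<integral>p. 1 / (2 * of_real pi) * (outgoing k (hyp z p) * (\<integral>q. f q * osc12 q p \<partial>lborel)) \<partial>lborel)"
    unfolding fhat by simp
  also have "\<dots> = 1 / (2 * of_real pi) * (\<integral>q. f q * (\<i> / (2 * kappa k (fst q) (snd q)) * exp (\<i> * kappa k (fst q) (snd q) * of_real z)) \<partial>lborel)"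
    unfolding integral_mult_right_zero
    by (subst weyl_outgoing[OF k z _ _ fi', of B M]) (use B in \<open>auto simp: f_def\<close>)
  also have "\<dots> = (\<integral>q. \<phi> (vec3 q c) * Psi k x q c \<partial>lborel)"
    unfolding integral_mult_right_zero[symmetric]
    by (intro Bochner_Integration.integral_cong refl) (simp add: f_def Psi_def kap_def z_def mult_ac)
  finally show ?thesis .
qed

text \<open>The exponential in \<open>Psi\<close> never grows, since it contains the absolute height
  difference and Im kappa \<ge> 0. So the bound involves only 1 / |kappa| and is independent of x,
  as the exchange with the integral over g requires.\<close>

lemma integrable_test_fun3_kappa:
  assumes k: "k > 0" and \<phi>: "test_fun3 \<phi>"
  obtains b :: "(real \<times> real) \<times> real \<Rightarrow> real" where "integrable lborel b" "\<And>p. b p \<ge> 0"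
    "\<And>x p. norm (\<phi> (vec3 (fst p) (snd p)) * Psi k x (fst p) (snd p)) \<le> b p"
proof -
  obtain B M where B: "B > 0" "M > 0" "\<And>k c q. norm (\<phi> (vec3 k c) * osc12 k q) \<le> B * indicator (cball 0 M) k" "\<And>k c. \<bar>c\<bar> > M \<Longrightarrow> \<phi> (vec3 k c) = 0"
    using test_fun3_slice[OF \<phi>] by metis
  define b1 where "b1 q = indicator (cball 0 M) q / sqrt \<bar>(norm q)\<^sup>2 - k\<^sup>2\<bar>" for q :: "real \<times> real"
  have b1: "integrable lborel b1" unfolding b1_def[abs_def] by (rule integrable_inverse_sqrt_disc[OF k])
  have b2: "integrable lborel (\<lambda>c::real. indicator {-M..M} c :: real)"
    by (intro integrable_real_indicator) (use B in \<open>auto simp: emeasure_lborel_Icc_eq\<close>)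
  have "has_bochner_integral lborel (\<lambda>q. complex_of_real (b1 q)) (\<integral>q. complex_of_real (b1 q) \<partial>lborel)"
    "has_bochner_integral lborel (\<lambda>c::real. complex_of_real (indicator {-M..M} c)) (\<integral>c. complex_of_real (indicator {-M..M} c) \<partial>(lborel :: real measure))"
    using b1 b2 by (simp_all only: has_bochner_integral_iff complex_of_real_integrable_eq simp_thms)
  from has_bochner_integral_lborel_prod[OF this]
  have "integrable lborel (\<lambda>p. complex_of_real (b1 (fst p)) * complex_of_real (indicator {-M..M} (snd p)))"
    by (simp only: has_bochner_integral_iff)
  then have "integrable lborel (\<lambda>p. complex_of_real (b1 (fst p) * indicator {-M..M} (snd p)))"
    by (simp only: of_real_mult)
  then have b: "integrable lborel (\<lambda>p. b1 (fst p) * indicator {-M..M} (snd p))"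
    by (simp only: complex_of_real_integrable_eq)
  show thesis
  proof (rule that)
    show "integrable lborel (\<lambda>p. (B / (4 * pi)) * (b1 (fst p) * indicator {-M..M} (snd p)))"
      by (intro integrable_mult_right b)
    show "(B / (4 * pi)) * (b1 (fst p) * indicator {-M..M} (snd p)) \<ge> 0" for p
      using B(1) by (auto simp: b1_def indicator_def)
    fix x :: "real^3" and p :: "(real \<times> real) \<times> real"
    show "norm (\<phi> (vec3 (fst p) (snd p)) * Psi k x (fst p) (snd p)) \<le> (B / (4 * pi)) * (b1 (fst p) * indicator {-M..M} (snd p))"
    proof (cases "\<bar>snd p\<bar> > M")
      case False
      have "norm (\<phi> (vec3 (fst p) (snd p))) \<le> B * indicator (cball 0 M) (fst p)"
        using B(3)[of "fst p" "snd p" 0] by (simp add: norm_mult)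
      then have "norm (\<phi> (vec3 (fst p) (snd p)) * Psi k x (fst p) (snd p)) \<le> (B * indicator (cball 0 M) (fst p)) * (1 / (4 * pi * norm (kap k (fst p))))"
        unfolding norm_mult using B(1) by (intro mult_mono norm_Psi_le) auto
      also have "\<dots> = (B / (4 * pi)) * (b1 (fst p) * indicator {-M..M} (snd p))"
      proof -
        have "snd p \<in> {-M..M}" using False by auto
        then show ?thesis by (simp add: b1_def kap_def norm_kappa)
      qed
      finally show ?thesis .
    next
      case True
      then have "snd p \<notin> {-M..M}" by auto
      then show ?thesis using B(4)[OF True] by simp
    qed
  qed
qed

lemma measurable_Psi [measurable (raw)]:
  assumes [measurable]: "f \<in> borel_measurable M" "g \<in> borel_measurable M" "h \<in> borel_measurable M"
  shows "(\<lambda>x. Psi k (f x) (g x) (h x)) \<in> borel_measurable M"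
proof -
  have [measurable]: "(\<lambda>x. kap k (g x)) \<in> borel_measurable M" "(\<lambda>x. proj12 (f x)) \<in> borel_measurable M" "(\<lambda>x. proj3 (f x)) \<in> borel_measurable M"
    using assms by (auto intro: measurable_compose[OF _ measurable_kap] measurable_compose[OF _ measurable_proj(1)] measurable_compose[OF _ measurable_proj(2)])
  show ?thesis unfolding Psi_def by measurable
qed

lemma measurable_fst_snd_prod [measurable]:
  "fst \<in> borel_measurable (borel :: ((real \<times> real) \<times> real) measure)" "snd \<in> borel_measurable (borel :: ((real \<times> real) \<times> real) measure)"
  by (intro borel_measurable_continuous_onI continuous_intros)+

text \<open>The slice identity integrated over the height. It fails to be available on one slice
  only, and both three-dimensional integrands are integrable, so Fubini applies to each
  side.\<close>

lemma fourier12_outgoing: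
  assumes k: "k > 0" and \<phi>: "test_fun3 \<phi>"
    and int: "integrable lborel (\<lambda>y. outgoing k (norm (x - y)) * fourier12 \<phi> y)"
  shows "(\<integral>y. outgoing k (norm (x - y)) * fourier12 \<phi> y \<partial>lborel) = (\<integral>p. \<phi> (vec3 (fst p) (snd p)) * Psi k x (fst p) (snd p) \<partial>lborel)"
    and "integrable lborel (\<lambda>p. \<phi> (vec3 (fst p) (snd p)) * Psi k x (fst p) (snd p))"
proof -
  note [measurable] = measurable_test_fun3[OF \<phi>]
  have [measurable]: "fourier12 \<phi> \<in> borel_measurable borel"
    by (intro borel_measurable_continuous_onI continuous_fourier12[OF \<phi>])
  obtain b :: "(real \<times> real) \<times> real \<Rightarrow> real" where b: "integrable lborel b" "\<And>p. b p \<ge> 0"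
    "\<And>x p. norm (\<phi> (vec3 (fst p) (snd p)) * Psi k x (fst p) (snd p)) \<le> b p"
    using integrable_test_fun3_kappa[OF k \<phi>] by metis
  have m: "(\<lambda>p. \<phi> (vec3 (fst p) (snd p)) * Psi k x (fst p) (snd p)) \<in> borel_measurable lborel"
    by measurable
  show i: "integrable lborel (\<lambda>p. \<phi> (vec3 (fst p) (snd p)) * Psi k x (fst p) (snd p))"
    by (rule Bochner_Integration.integrable_bound[OF b(1) m]) (use b in \<open>auto intro!: always_eventually\<close>)
  then have i': "integrable (lborel \<Otimes>\<^sub>M lborel) (\<lambda>(q, c). \<phi> (vec3 q c) * Psi k x q c)"
    by (simp add: lborel_prod case_prod_unfold)
  have j: "integrable lborel (\<lambda>p. outgoing k (norm (x - vec3 (fst p) (snd p))) * fourier12 \<phi> (vec3 (fst p) (snd p)))"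
    using int by (subst (asm) integral_vec3(1)) simp_all
  then have j': "integrable (lborel \<Otimes>\<^sub>M lborel) (\<lambda>(q, c). outgoing k (norm (x - vec3 q c)) * fourier12 \<phi> (vec3 q c))"
    by (simp add: lborel_prod case_prod_unfold)
  have "(\<integral>y. outgoing k (norm (x - y)) * fourier12 \<phi> y \<partial>lborel) = (\<integral>p. outgoing k (norm (x - vec3 (fst p) (snd p))) * fourier12 \<phi> (vec3 (fst p) (snd p)) \<partial>lborel)"
    by (rule integral_vec3(2)) simp
  also have "\<dots> = (\<integral>c. \<integral>q. outgoing k (norm (x - vec3 q c)) * fourier12 \<phi> (vec3 q c) \<partial>lborel \<partial>lborel)"
    using lborel_pair.integral_snd[OF j'] by (simp add: lborel_prod case_prod_unfold)
  also have "\<dots> = (\<integral>c. \<integral>q. \<phi> (vec3 q c) * Psi k x q c \<partial>lborel \<partial>lborel)"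
  proof (rule integral_cong_AE)
    show "AE c in lborel. (\<integral>q. outgoing k (norm (x - vec3 q c)) * fourier12 \<phi> (vec3 q c) \<partial>lborel) = (\<integral>q. \<phi> (vec3 q c) * Psi k x q c \<partial>lborel)"
      using AE_lborel_singleton[of "proj3 x"] by eventually_elim (rule fourier12_outgoing_slice[OF k \<phi>])
    show "(\<lambda>c. \<integral>q. outgoing k (norm (x - vec3 q c)) * fourier12 \<phi> (vec3 q c) \<partial>lborel) \<in> borel_measurable lborel"
      using borel_measurable_integrable[OF lborel_pair.integrable_snd[OF j']] by simp
    show "(\<lambda>c. \<integral>q. \<phi> (vec3 q c) * Psi k x q c \<partial>lborel) \<in> borel_measurable lborel"
      using borel_measurable_integrable[OF lborel_pair.integrable_snd[OF i']] by simp
  qed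
  also have "\<dots> = (\<integral>p. \<phi> (vec3 (fst p) (snd p)) * Psi k x (fst p) (snd p) \<partial>lborel)"
    using lborel_pair.integral_snd[OF i'] by (simp add: lborel_prod case_prod_unfold)
  finally show "(\<integral>y. outgoing k (norm (x - y)) * fourier12 \<phi> y \<partial>lborel) = (\<integral>p. \<phi> (vec3 (fst p) (snd p)) * Psi k x (fst p) (snd p) \<partial>lborel)" .
qed

text \<open>The two Heaviside pieces resolve the absolute value |c - s3| in \<open>Psi\<close> by
  sign. The identity holds at every point, even where kappa = 0: there division by 0 makes both
  sides 0.\<close>

lemma F12u_vec3:
  assumes g: "integrable lborel g" "\<And>x. norm x \<ge> r \<Longrightarrow> g x = 0"
  shows "F12u k g (vec3 q c) = (\<integral>s. g s * Psi k s q c \<partial>lborel)"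
proof -
  have [measurable]: "g \<in> borel_measurable borel" using g(1) by (auto dest: borel_measurable_integrable)
  define \<kappa> where "\<kappa> = kap k q"
  define h where "h s = osc12 q (proj12 s)" for s
  have [measurable]: "h \<in> borel_measurable borel" unfolding h_def[abs_def] by measurable
  define X where "X s = complex_of_real (1 - heaviside3 c s) * g s * (h s * exp (- \<i> * \<kappa> * of_real (proj3 s)))" for s
  define Y where "Y s = complex_of_real (heaviside3 c s) * g s * (h s * exp (\<i> * \<kappa> * of_real (proj3 s)))" for s
  have [measurable]: "heaviside3 c \<in> borel_measurable borel"
  proof -
    have "heaviside3 c = (\<lambda>s. if proj3 s < c then 0 else 1)" by (auto simp: heaviside3_def proj3_def)
    then show ?thesis by simp
  qed
  have p3: "\<bar>proj3 s\<bar> \<le> norm s" for s unfolding proj3_def using component_le_norm_cart[of s 3] by simp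
  \<comment> \<open>Separately each exponential can grow when kappa is imaginary; it is bounded
    because g lives in a ball of radius r.\<close>
  have ex: "norm (g s) * norm (exp (a * \<kappa> * of_real (proj3 s))) \<le> exp (norm \<kappa> * r) * norm (g s)" if a: "norm a = 1" for a s
  proof (cases "norm s \<ge> r")
    case False
    have "norm (exp (a * \<kappa> * of_real (proj3 s))) \<le> exp (norm (a * \<kappa> * of_real (proj3 s)))" by (rule norm_exp)
    also have "norm (a * \<kappa> * of_real (proj3 s)) \<le> norm \<kappa> * r"
      using p3[of s] False a by (auto simp: norm_mult intro!: mult_left_mono)
    finally have "norm (exp (a * \<kappa> * of_real (proj3 s))) \<le> exp (norm \<kappa> * r)" by simp
    from mult_right_mono[OF this, of "norm (g s)"] show ?thesis by (simp add: mult.commute)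
  qed (use g in simp)
  have X: "integrable lborel X"
  proof (rule Bochner_Integration.integrable_bound[OF integrable_mult_right[OF integrable_norm[OF g(1)], of "exp (norm \<kappa> * r)"]])
    show "AE s in lborel. norm (X s) \<le> norm (exp (norm \<kappa> * r) * norm (g s))"
      using ex[of "- \<i>"] by (intro always_eventually allI) (auto simp: X_def h_def norm_mult heaviside3_def)
    show "X \<in> borel_measurable lborel" unfolding X_def[abs_def] by measurable
  qed
  have Y: "integrable lborel Y"
  proof (rule Bochner_Integration.integrable_bound[OF integrable_mult_right[OF integrable_norm[OF g(1)], of "exp (norm \<kappa> * r)"]])
    show "AE s in lborel. norm (Y s) \<le> norm (exp (norm \<kappa> * r) * norm (g s))"
      using ex[of "\<i>"] by (intro always_eventually allI) (auto simp: Y_def h_def norm_mult heaviside3_def)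
    show "Y \<in> borel_measurable lborel" unfolding Y_def[abs_def] by measurable
  qed
  have fX: "fourier3 (\<lambda>s. complex_of_real (1 - heaviside3 c s) * g s) (of_real (fst q)) (of_real (snd q)) \<kappa> = of_real ((2 * pi) powr (-3/2)) * (\<integral>s. X s \<partial>lborel)"
    unfolding fourier3_def X_def h_def osc12_def
    by (intro arg_cong2[where f = "(*)"] refl Bochner_Integration.integral_cong)
       (simp add: proj12_def proj3_def exp_add[symmetric] algebra_simps)
  have fY: "fourier3 (\<lambda>s. complex_of_real (heaviside3 c s) * g s) (of_real (fst q)) (of_real (snd q)) (- \<kappa>) = of_real ((2 * pi) powr (-3/2)) * (\<integral>s. Y s \<partial>lborel)"
    unfolding fourier3_def Y_def h_def osc12_def
    by (intro arg_cong2[where f = "(*)"] refl Bochner_Integration.integral_cong)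
       (simp add: proj12_def proj3_def exp_add[symmetric] algebra_simps)
  have const: "complex_of_real (sqrt (pi / 2)) * of_real ((2 * pi) powr (-3/2)) = 1 / (4 * of_real pi)"
  proof -
    have "(2 * pi) powr (-3/2) = (2 * pi) powr (- 1 + - (1/2))" by simp
    also have "\<dots> = (2 * pi) powr (- 1) * (2 * pi) powr (- (1/2))" by (rule powr_add)
    also have "\<dots> = 1 / (2 * pi) * (1 / sqrt (2 * pi))"
      by (simp add: powr_minus_divide powr_half_sqrt)
    finally have "sqrt (pi / 2) * (2 * pi) powr (-3/2) = sqrt (pi / 2) / sqrt (2 * pi) / (2 * pi)" by simp
    also have "sqrt (pi / 2) / sqrt (2 * pi) = 1 / 2"
    proof -
      have "sqrt (pi / 2) / sqrt (2 * pi) = sqrt (pi / 2 / (2 * pi))" by (rule real_sqrt_divide[symmetric])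
      also have "pi / 2 / (2 * pi) = (1 / 2)\<^sup>2" by (simp add: power2_eq_square)
      finally show ?thesis by (simp add: real_sqrt_abs)
    qed
    finally have "sqrt (pi / 2) * (2 * pi) powr (-3/2) = 1 / (4 * pi)" by simp
    then show ?thesis by (simp only: of_real_mult[symmetric]) simp
  qed
  \<comment> \<open>Exactly one of X and Y is nonzero at s, and the exponential in front of it
    completes the phase to the nonnegative height difference. The plane s3 = c belongs to Y.\<close>
  have pt: "\<i> / (4 * of_real pi * \<kappa>) * (exp (\<i> * \<kappa> * of_real c) * X s + exp (- \<i> * \<kappa> * of_real c) * Y s) = g s * Psi k s q c" for s
  proof (cases "proj3 s < c")
    case True
    have "exp (\<i> * \<kappa> * of_real c) * exp (- \<i> * \<kappa> * of_real (proj3 s)) = exp (\<i> * \<kappa> * of_real \<bar>c - proj3 s\<bar>)"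
      using True by (simp add: exp_add[symmetric] algebra_simps)
    then show ?thesis
      using True by (simp add: X_def Y_def heaviside3_def proj3_def[symmetric] Psi_def \<kappa>_def[symmetric] h_def[symmetric] mult_ac)
  next
    case False
    have "exp (- \<i> * \<kappa> * of_real c) * exp (\<i> * \<kappa> * of_real (proj3 s)) = exp (\<i> * \<kappa> * of_real \<bar>c - proj3 s\<bar>)"
      using False by (simp add: exp_add[symmetric] algebra_simps)
    then show ?thesis
      using False by (simp add: X_def Y_def heaviside3_def proj3_def[symmetric] Psi_def \<kappa>_def[symmetric] h_def[symmetric] mult_ac)
  qed
  have "F12u k g (vec3 q c) = complex_of_real (sqrt (pi / 2)) * (\<i> / \<kappa>) * (exp (\<i> * \<kappa> * of_real c) * (of_real ((2 * pi) powr (-3/2)) * (\<integral>s. X s \<partial>lborel))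
      + exp (- \<i> * \<kappa> * of_real c) * (of_real ((2 * pi) powr (-3/2)) * (\<integral>s. Y s \<partial>lborel)))"
    unfolding F12u_def Let_def vec3_nth kap_def[symmetric] \<kappa>_def[symmetric] fX fY ..
  also have "\<dots> = (complex_of_real (sqrt (pi / 2)) * of_real ((2 * pi) powr (-3/2))) * (\<i> / \<kappa>) * (exp (\<i> * \<kappa> * of_real c) * (\<integral>s. X s \<partial>lborel) + exp (- \<i> * \<kappa> * of_real c) * (\<integral>s. Y s \<partial>lborel))"
    by (simp only: algebra_simps)
  also have "\<dots> = \<i> / (4 * of_real pi * \<kappa>) * (exp (\<i> * \<kappa> * of_real c) * (\<integral>s. X s \<partial>lborel) + exp (- \<i> * \<kappa> * of_real c) * (\<integral>s. Y s \<partial>lborel))"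
    unfolding const by simp
  also have "\<dots> = (\<integral>s. \<i> / (4 * of_real pi * \<kappa>) * (exp (\<i> * \<kappa> * of_real c) * X s + exp (- \<i> * \<kappa> * of_real c) * Y s) \<partial>lborel)"
    using X Y by (simp add: integral_add)
  also have "\<dots> = (\<integral>s. g s * Psi k s q c \<partial>lborel)" unfolding pt ..
  finally show ?thesis .
qed

text \<open>Where |g| > 1 it is at most its own p-th power; elsewhere it is at most the indicator of
  the ball containing its support.\<close>

lemma integrable_of_powr:
  fixes g :: "'a::euclidean_space \<Rightarrow> complex"
  assumes "p > 1" and [measurable]: "g \<in> borel_measurable lborel" and int: "integrable lborel (\<lambda>x. cmod (g x) powr p)"
    and supp: "\<And>x. norm x \<ge> r \<Longrightarrow> g x = 0"
  shows "integrable lborel g"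
proof (rule Bochner_Integration.integrable_bound)
  show "integrable lborel (\<lambda>x. cmod (g x) powr p + indicator (cball 0 r) x)"
    by (intro Bochner_Integration.integrable_add int integrable_real_indicator) (use emeasure_lborel_cball_finite in auto)
  show "AE x in lborel. norm (g x) \<le> norm (cmod (g x) powr p + indicator (cball 0 r) x)"
  proof (intro always_eventually allI)
    fix x
    consider "g x = 0" | "norm (g x) \<le> 1" "g x \<noteq> 0" | "norm (g x) > 1" by force
    then show "norm (g x) \<le> norm (cmod (g x) powr p + indicator (cball 0 r) x)"
    proof cases
      case 2
      then have "norm x \<le> r" using supp[of x] by force
      then show ?thesis using 2 by (simp add: add_increasing)
    next
      case 3
      then have "cmod (g x) powr 1 \<le> cmod (g x) powr p" using assms(1) by (intro powr_mono) auto
      then show ?thesis using 3 by (auto simp: indicator_def)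
    qed simp
  qed
qed measurable

theorem theorem3p1:
  fixes k0 p r :: real and g u :: "real^3 \<Rightarrow> complex"
  assumes "k0 > 0" and "p > 1" and "r > 0"
    and "g \<in> borel_measurable lborel"
    and "integrable lborel (\<lambda>x. cmod (g x) powr p)"
    and "closure {x. g x \<noteq> 0} \<subseteq> ball 0 r"
    and "helmholtz_weak k0 g u"
    and "sommerfeld k0 u"
  shows "\<forall>\<phi>. test_fun3 \<phi> \<longrightarrow>
           integrable lborel (\<lambda>x. u x * fourier12 \<phi> x) \<and>
           integrable lborel (\<lambda>k. F12u k0 g k * \<phi> k) \<and>
           (\<integral>x. u x * fourier12 \<phi> x \<partial>lborel) = (\<integral>k. F12u k0 g k * \<phi> k \<partial>lborel)"
proof (intro allI impI)
  fix \<phi> assume \<phi>: "test_fun3 \<phi>"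
  have g0: "g x = 0" if "norm x \<ge> r" for x
  proof (rule ccontr)
    assume "g x \<noteq> 0"
    then have "x \<in> closure {x. g x \<noteq> 0}" using closure_subset[of "{x. g x \<noteq> 0}"] by auto
    then show False using assms(6) that by auto
  qed
  have gi: "integrable lborel g" by (rule integrable_of_powr[OF assms(2,4,5) g0])
  have [measurable]: "g \<in> borel_measurable borel" using gi by (auto dest: borel_measurable_integrable)
  note [measurable] = measurable_test_fun3[OF \<phi>]
  have cont: "continuous_on UNIV (fourier12 \<phi>)" by (rule continuous_fourier12[OF \<phi>])
  then have [measurable]: "fourier12 \<phi> \<in> borel_measurable borel" by (rule borel_measurable_continuous_onI)
  obtain C where C: "C > 0" "\<And>x. norm (fourier12 \<phi> x) \<le> C / (1 + norm x) ^ 5"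
    using fourier12_decay[OF \<phi>, of 5] by metis
  note rep = outgoing_representation[OF assms(1,7,8) gi g0 cont C(2)]
  have oi: "integrable lborel (\<lambda>y. outgoing k0 (norm (x - y)) * fourier12 \<phi> y)" for x
    by (rule integrable_outgoing_convolution[OF cont C(2)])
  define P where "P x p = g x * (\<phi> (vec3 (fst p) (snd p)) * Psi k0 x (fst p) (snd p))" for x and p :: "(real \<times> real) \<times> real"
  obtain b :: "(real \<times> real) \<times> real \<Rightarrow> real" where b: "integrable lborel b" "\<And>p. b p \<ge> 0"
    "\<And>x p. norm (\<phi> (vec3 (fst p) (snd p)) * Psi k0 x (fst p) (snd p)) \<le> b p"
    using integrable_test_fun3_kappa[OF assms(1) \<phi>] by metis
  \<comment> \<open>The double integrand is dominated by |g(x)| b(p), a product of integrable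
    functions, because b does not depend on x. This is the last exchange of integrals.\<close>
  have P: "integrable (lborel \<Otimes>\<^sub>M lborel) (\<lambda>(x, p). P x p)"
  proof -
    have "has_bochner_integral lborel (\<lambda>x. complex_of_real (norm (g x))) (\<integral>x. complex_of_real (norm (g x)) \<partial>lborel)"
      "has_bochner_integral lborel (\<lambda>p. complex_of_real (b p)) (\<integral>p. complex_of_real (b p) \<partial>lborel)"
      using integrable_norm[OF gi] b(1) by (simp_all only: has_bochner_integral_iff complex_of_real_integrable_eq simp_thms)
    from has_bochner_integral_lborel_prod[OF this]
    have "integrable (lborel \<Otimes>\<^sub>M lborel) (\<lambda>z. complex_of_real (norm (g (fst z))) * complex_of_real (b (snd z)))"
      by (simp only: has_bochner_integral_iff lborel_prod)
    then show ?thesis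
    proof (rule Bochner_Integration.integrable_bound)
      show "AE z in lborel \<Otimes>\<^sub>M lborel. norm (case z of (x, p) \<Rightarrow> P x p) \<le> norm (complex_of_real (norm (g (fst z))) * complex_of_real (b (snd z)))"
        using b(2,3) by (intro always_eventually allI) (auto simp: P_def norm_mult intro!: mult_left_mono split: prod.split)
      have "(\<lambda>z. P (fst z) (snd z)) \<in> borel_measurable (borel \<Otimes>\<^sub>M borel)"
        unfolding P_def by measurable
      then show "(\<lambda>(x, p). P x p) \<in> borel_measurable (lborel \<Otimes>\<^sub>M lborel)"
        by (simp add: case_prod_unfold cong: measurable_cong_sets)
    qed
  qed
  have F: "F12u k0 g (vec3 (fst p) (snd p)) * \<phi> (vec3 (fst p) (snd p)) = (\<integral>x. P x p \<partial>lborel)" for p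
  proof -
    have "P x p = (g x * Psi k0 x (fst p) (snd p)) * \<phi> (vec3 (fst p) (snd p))" for x by (simp add: P_def)
    then show ?thesis by (simp add: F12u_vec3[OF gi g0])
  qed
  \<comment> \<open>Measurability is inherited from the parametric integral of \<open>Psi\<close>,
    to which \<open>F12u\<close> is equal at every point.\<close>
  have [measurable]: "F12u k0 g \<in> borel_measurable borel"
  proof -
    have "F12u k0 g x = (\<integral>s. g s * Psi k0 s (proj12 x) (proj3 x) \<partial>lborel)" for x
      using F12u_vec3[OF gi g0, where k = k0 and q = "proj12 x" and c = "proj3 x"] by simp
    then have "F12u k0 g = (\<lambda>x. \<integral>s. g s * Psi k0 s (proj12 x) (proj3 x) \<partial>lborel)" by blast
    then show ?thesis by simp
  qed
  have Fi: "integrable lborel (\<lambda>k. F12u k0 g k * \<phi> k)"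
  proof -
    have "integrable lborel (\<lambda>p. F12u k0 g (vec3 (fst p) (snd p)) * \<phi> (vec3 (fst p) (snd p)))"
      unfolding F using lborel_pair.integrable_snd[OF P] by simp
    then show ?thesis by (subst integral_vec3(1)) simp_all
  qed
  have "(\<integral>x. u x * fourier12 \<phi> x \<partial>lborel) = (\<integral>x. g x * (\<integral>y. outgoing k0 (norm (x - y)) * fourier12 \<phi> y \<partial>lborel) \<partial>lborel)"
    by (rule rep(2))
  also have "\<dots> = (\<integral>x. \<integral>p. P x p \<partial>lborel \<partial>lborel)"
    unfolding fourier12_outgoing(1)[OF assms(1) \<phi> oi] P_def by simp
  also have "\<dots> = (\<integral>p. \<integral>x. P x p \<partial>lborel \<partial>lborel)"
    using lborel_pair.Fubini_integral[OF P] by simp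
  also have "\<dots> = (\<integral>k. F12u k0 g k * \<phi> k \<partial>lborel)"
    unfolding F[symmetric] by (rule integral_vec3(2)[symmetric]) simp
  finally show "integrable lborel (\<lambda>x. u x * fourier12 \<phi> x) \<and> integrable lborel (\<lambda>k. F12u k0 g k * \<phi> k) \<and>
           (\<integral>x. u x * fourier12 \<phi> x \<partial>lborel) = (\<integral>k. F12u k0 g k * \<phi> k \<partial>lborel)"
    using rep(1) Fi by blast
qed

end
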